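(* Let $1<p<\infty$ and let $w$ be a weight on $\mathbb{R}$. Then the segment multiplier $S$, given by $$Sf(x)=\int_{\mathbb{R}}\frac{\sin(x-y)}{x-y}\,f(y)\,dy,$$ is bounded from $L^p(w)$ to $L^p(w)$ if and only if $w\in A_{p,1}$, i.e. if and only if $$\sup_{|I|\ge 1}\left(\frac1{|I|}\int_I w(x)\,dx\right)\left(\frac1{|I|}\int_I w(x)^{-\frac1{p-1}}\,dx\right)^{p-1}<\infty,$$ where the supremum is taken over all bounded intervals $I\subseteq\mathbb{R}$ of length $|I|\ge 1$.
   Context: A weight on $\mathbb{R}$ is a locally integrable, almost everywhere positive function $w$. The space $L^p(w)$ consists of the (classes of) measurable functions $f$ on $\mathbb{R}$ with $\|f\|_{L^p(w)}=\left(\int_{\mathbb{R}}|f(x)|^p w(x)\,dx\right)^{1/p}<\infty$. The function $\frac{\sin t}{t}$ is understood to equal $1$ at $t=0$. That $S$ is bounded on $L^p(w)$ means: for every $f\in L^p(w)$ the integral defining $Sf(x)$ converges absolutely for a.e. $x$, and there is a constant $C$ independent of $f$ with $\|Sf\|_{L^p(w)}\le C\|f\|_{L^p(w)}$. *)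

theory Defs
  imports "HOL-Analysis.Analysis" "HOL-Probability.Sinc_Integral"
begin

definition weight :: "(real \<Rightarrow> real) \<Rightarrow> bool" where
  "weight w \<longleftrightarrow>
     (\<forall>K. compact K \<longrightarrow> set_integrable lebesgue K w) \<and> (AE x in lebesgue. 0 < w x)"

text \<open>Elements of the weighted Lebesgue space are represented by Lebesgue measurable,
  complex-valued functions, without passing to classes modulo null sets.\<close>

definition Lp_weighted :: "real \<Rightarrow> (real \<Rightarrow> real) \<Rightarrow> (real \<Rightarrow> complex) set" where
  "Lp_weighted p w =
     {f \<in> borel_measurable lebesgue. integrable lebesgue (\<lambda>x. norm (f x) powr p * w x)}"

definition Lp_norm :: "real \<Rightarrow> (real \<Rightarrow> real) \<Rightarrow> (real \<Rightarrow> complex) \<Rightarrow> real" where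
  "Lp_norm p w f = (LINT x|lebesgue. norm (f x) powr p * w x) powr (1 / p)"

text \<open>The library's \<^term>\<open>sinc\<close> is the unnormalised one, with value 1 at 0.\<close>

definition segment_multiplier :: "(real \<Rightarrow> complex) \<Rightarrow> real \<Rightarrow> complex" where
  "segment_multiplier f x = (LINT y|lebesgue. complex_of_real (sinc (x - y)) * f y)"

definition segment_multiplier_bounded :: "real \<Rightarrow> (real \<Rightarrow> real) \<Rightarrow> bool" where
  "segment_multiplier_bounded p w \<longleftrightarrow>
     (\<forall>f \<in> Lp_weighted p w.
        AE x in lebesgue. integrable lebesgue (\<lambda>y. complex_of_real (sinc (x - y)) * f y)) \<and>
     (\<exists>C. \<forall>f \<in> Lp_weighted p w.
        segment_multiplier f \<in> Lp_weighted p w \<and>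
        Lp_norm p w (segment_multiplier f) \<le> C * Lp_norm p w f)"

text \<open>Powers with positive real exponent on the extended nonnegative reals, so that the
  condition below fails when the dual weight has infinite integral over an interval.\<close>

definition ennreal_powr :: "ennreal \<Rightarrow> real \<Rightarrow> ennreal" where
  "ennreal_powr x a = (if x = \<infinity> then \<infinity> else ennreal (enn2real x powr a))"

definition interval_average :: "real set \<Rightarrow> (real \<Rightarrow> real) \<Rightarrow> ennreal" where
  "interval_average I g = ennreal (1 / measure lebesgue I) * (\<integral>\<^sup>+x\<in>I. ennreal (g x) \<partial>lebesgue)"

definition A_p1 :: "real \<Rightarrow> (real \<Rightarrow> real) set" where
  "A_p1 p = {w. weight w \<and>
     (SUP I \<in> {I. is_interval I \<and> bounded I \<and> measure lebesgue I \<ge> 1}.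
        interval_average I w *
        ennreal_powr (interval_average I (\<lambda>x. w x powr (- 1 / (p - 1)))) (p - 1)) < \<infinity>}"

end

theory Submission
  imports Defs
begin

text \<open>
  Sufficiency. Integrating Haar-type forms over all translates and dilates of a triadic grid whose
  atoms have length at least 1 yields a convolution kernel that equals a constant multiple of
  \<open>1 / t\<close> for \<open>\<bar>t\<bar> \<ge> 3\<close>. Modulated by sines and cosines it reproduces \<open>sinc\<close> up to a bounded kernel
  supported in \<open>\<bar>t\<bar> < 3\<close>. On a single grid, a stopping-time argument dominates the Haar form by
  averages over a sparse family of cells, and the condition at scales at least 1 together with
  Doob's maximal inequality for the measures \<open>w\<close> and \<open>w\<^sup>1\<^sup>-\<^sup>q\<close> bounds these. All estimates are kept in
  the additive form \<open>\<integral>\<bar>f\<bar>\<^sup>p w + \<integral>\<bar>g\<bar>\<^sup>q w\<^sup>1\<^sup>-\<^sup>q\<close>, so that they sum over cells and integrate over grids.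

  Necessity. The kernel is bounded below near the diagonal, which gives the condition on intervals
  of length 2. For long intervals one tests on functions modulated by \<open>e\<^sup>i\<^sup>y\<close>; the zeros of the
  resulting kernel \<open>sin\<^sup>2 (x - y) / (x - y)\<close> are harmless by the condition at length 2.
\<close>

section \<open>Haar forms on ternary trees\<close>

text \<open>Hence an atom is a cell of which only the integrals of \<open>f\<close>,
  \<open>g\<close> and the two weights are kept, and every step is an inequality between such
  integrals on a finite tree.

  Why ternary: three equal children carry two orthogonal mean-zero patterns of opposite parity,
  \<open>(-1, 0, 1)\<close> and \<open>(1, -2, 1)\<close>. Pairing one with the other gives an odd
  kernel without any shift between generations. Two children carry only one such pattern, and its
  correlation with itself is even.

  The stopping argument needs one consequence of the condition: a union of atoms that fills at least
  half of a cell carries a fixed share of both weights of that cell. This involves only the cell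
  itself and its atoms, so lengths of at least 1 suffice.

  The additive form of the estimates is not homogeneous in \<open>f\<close> and \<open>g\<close>.
  Homogeneity is recovered at the end by multiplying the dual function by a small constant.\<close>

datatype 'a tree = Leaf 'a | Node "'a tree" "'a tree" "'a tree"

primrec tsum :: "('a \<Rightarrow> real) \<Rightarrow> 'a tree \<Rightarrow> real" where
  "tsum f (Leaf a) = f a"
| "tsum f (Node a b c) = tsum f a + tsum f b + tsum f c"

primrec full :: "nat \<Rightarrow> 'a tree \<Rightarrow> bool" where
  "full k (Leaf a) \<longleftrightarrow> k = 0"
| "full k (Node a b c) \<longleftrightarrow> (\<exists>j. k = Suc j \<and> full j a \<and> full j b \<and> full j c)"

primrec subtrees :: "'a tree \<Rightarrow> 'a tree set" where
  "subtrees (Leaf a) = {Leaf a}"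
| "subtrees (Node a b c) = insert (Node a b c) (subtrees a \<union> subtrees b \<union> subtrees c)"

definition len :: "real \<Rightarrow> 'a tree \<Rightarrow> real" where
  "len l = tsum (\<lambda>_. l)"

lemma len_simps [simp]:
  "len l (Leaf i) = l" "len l (Node a b c) = len l a + len l b + len l c"
  by (simp_all add: len_def)

text \<open>The coefficients enter with absolute values, so the form dominates every choice of signs
  and Tonelli's theorem applies when it is integrated over roots. The single division by the length
  is, up to a constant, the L^2 normalisation of the two Haar functions.\<close>

primrec haar_form :: "real \<Rightarrow> ('a \<Rightarrow> real) \<Rightarrow> ('a \<Rightarrow> real) \<Rightarrow> 'a tree \<Rightarrow> real" where
  "haar_form l f g (Leaf a) = 0"
| "haar_form l f g (Node a b c) =
     \<bar>tsum f c - tsum f a\<bar> * \<bar>tsum g a + tsum g c - 2 * tsum g b\<bar> / len l (Node a b c)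
     + (haar_form l f g a + haar_form l f g b + haar_form l f g c)"

definition heavy :: "real \<Rightarrow> ('a \<Rightarrow> real) \<Rightarrow> ('a \<Rightarrow> real) \<Rightarrow> real \<Rightarrow> real \<Rightarrow> 'a tree \<Rightarrow> bool" where
  "heavy l F G \<alpha> \<beta> t \<longleftrightarrow> \<alpha> * len l t < tsum F t \<or> \<beta> * len l t < tsum G t"

primrec stops :: "real \<Rightarrow> ('a \<Rightarrow> real) \<Rightarrow> ('a \<Rightarrow> real) \<Rightarrow> real \<Rightarrow> real \<Rightarrow> 'a tree \<Rightarrow> 'a tree list" where
  "stops l F G \<alpha> \<beta> (Leaf a) = (if heavy l F G \<alpha> \<beta> (Leaf a) then [Leaf a] else [])"
| "stops l F G \<alpha> \<beta> (Node a b c) = (if heavy l F G \<alpha> \<beta> (Node a b c) then [Node a b c]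
     else stops l F G \<alpha> \<beta> a @ stops l F G \<alpha> \<beta> b @ stops l F G \<alpha> \<beta> c)"

text \<open>The integral of \<open>\<phi>\<close> over the part of the cell that no stopping cell
  covers: the large disjoint piece which a sparse family assigns to this cell.\<close>

primrec rest :: "real \<Rightarrow> ('a \<Rightarrow> real) \<Rightarrow> ('a \<Rightarrow> real) \<Rightarrow> real \<Rightarrow> real \<Rightarrow> ('a \<Rightarrow> real) \<Rightarrow> 'a tree \<Rightarrow> real" where
  "rest l F G \<alpha> \<beta> \<phi> (Leaf a) = (if heavy l F G \<alpha> \<beta> (Leaf a) then 0 else \<phi> a)"
| "rest l F G \<alpha> \<beta> \<phi> (Node a b c) = (if heavy l F G \<alpha> \<beta> (Node a b c) then 0
     else rest l F G \<alpha> \<beta> \<phi> a + rest l F G \<alpha> \<beta> \<phi> b + rest l F G \<alpha> \<beta> \<phi> c)"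

text \<open>The \<open>v\<close>-integral of the p-th power of the maximal function of the density
  \<open>F / v\<close>. The argument \<open>m\<close> is the largest average met on the way from the
  root; carrying it along lets a subtree inherit the maximum of its ancestors.\<close>

primrec maximal_sum :: "real \<Rightarrow> ('a \<Rightarrow> real) \<Rightarrow> ('a \<Rightarrow> real) \<Rightarrow> 'a tree \<Rightarrow> real \<Rightarrow> real" where
  "maximal_sum p v F (Leaf a) m = v a * max m (F a / v a) powr p"
| "maximal_sum p v F (Node a b c) m =
     (let m' = max m (tsum F (Node a b c) / tsum v (Node a b c)) in
      maximal_sum p v F a m' + maximal_sum p v F b m' + maximal_sum p v F c m')"

text \<open>The integral of the power \<open>p - 1\<close> of the same maximal function against
  \<open>F\<close>, the quantity that appears on the right in the proof of Doob's
  inequality.\<close>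

primrec mixed_sum :: "real \<Rightarrow> ('a \<Rightarrow> real) \<Rightarrow> ('a \<Rightarrow> real) \<Rightarrow> 'a tree \<Rightarrow> real \<Rightarrow> real" where
  "mixed_sum p v F (Leaf a) m = F a * max m (F a / v a) powr (p - 1)"
| "mixed_sum p v F (Node a b c) m =
     (let m' = max m (tsum F (Node a b c) / tsum v (Node a b c)) in
      mixed_sum p v F a m' + mixed_sum p v F b m' + mixed_sum p v F c m')"

section \<open>Elementary properties of tree sums and stopping cells\<close>

lemma tsum_nonneg: "(\<And>i. 0 \<le> f i) \<Longrightarrow> 0 \<le> tsum f t"
  by (induction t) auto

lemma tsum_pos: "(\<And>i. 0 < f i) \<Longrightarrow> 0 < tsum f t"
  by (induction t) (auto intro: add_pos_pos)

lemma tsum_mono: "(\<And>i. f i \<le> g i) \<Longrightarrow> tsum f t \<le> tsum g t"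
  by (induction t) (auto intro: add_mono)

lemma tsum_add: "tsum (\<lambda>i. f i + g i) t = tsum f t + tsum g t"
  by (induction t) auto

lemma tsum_cmult: "tsum (\<lambda>i. c * f i) t = c * tsum f t"
  by (induction t) (auto simp: algebra_simps)

lemma abs_tsum_le: "(\<And>i. \<bar>f i\<bar> \<le> F i) \<Longrightarrow> \<bar>tsum f t\<bar> \<le> tsum F t"
  by (induction t) (auto intro: order_trans[OF abs_triangle_ineq] add_mono)

lemma len_full: "full k t \<Longrightarrow> len l t = l * 3 ^ k"
  by (induction t arbitrary: k) auto

lemma len_pos: "0 < l \<Longrightarrow> 0 < len l t"
  unfolding len_def by (rule tsum_pos)

text \<open>Settles the degenerate case in which a stopping threshold would be 0.\<close>

lemma haar_form_eq_0:
  assumes f: "\<And>i. \<bar>f i\<bar> \<le> F i" and g: "\<And>i. \<bar>g i\<bar> \<le> G i" and "tsum F t = 0 \<or> tsum G t = 0"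
  shows "haar_form l f g t = 0"
  using assms(3)
proof (induction t)
  case (Node a b c)
  have zero: "tsum h a = 0 \<and> tsum h b = 0 \<and> tsum h c = 0 \<and> tsum H a = 0 \<and> tsum H b = 0 \<and> tsum H c = 0"
    if h: "\<And>i. \<bar>h i\<bar> \<le> H i" and H: "tsum H (Node a b c) = 0" for h H :: "'a \<Rightarrow> real"
  proof -
    have le: "\<bar>tsum h u\<bar> \<le> tsum H u" for u using h by (rule abs_tsum_le)
    show ?thesis using le[of a] le[of b] le[of c] H unfolding tsum.simps by linarith
  qed
  have IH: "haar_form l f g a = 0 \<and> haar_form l f g b = 0 \<and> haar_form l f g c = 0"
    using Node zero[of f F, OF f] zero[of g G, OF g] by metis
  have "(tsum f a = 0 \<and> tsum f c = 0) \<or> (tsum g a = 0 \<and> tsum g b = 0 \<and> tsum g c = 0)"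
    using Node.prems zero[of f F, OF f] zero[of g G, OF g] by metis
  with IH show ?case by auto
qed simp

lemma tsum_rest: "tsum \<phi> t = rest l F G \<alpha> \<beta> \<phi> t + (\<Sum>P\<leftarrow>stops l F G \<alpha> \<beta> t. tsum \<phi> P)"
  by (induction t) (auto simp: heavy_def)

lemma rest_mono:
  "(\<And>i. \<phi> i \<le> \<psi> i) \<Longrightarrow> rest l F G \<alpha> \<beta> \<phi> t \<le> rest l F G \<alpha> \<beta> \<psi> t"
  by (induction t) (auto intro: add_mono)

lemma rest_linear:
  "rest l F G \<alpha> \<beta> (\<lambda>i. x * \<phi> i + y * \<psi> i) t =
     x * rest l F G \<alpha> \<beta> \<phi> t + y * rest l F G \<alpha> \<beta> \<psi> t"
  by (induction t) (auto simp: algebra_simps)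

lemma rest_nonneg: "(\<And>i. 0 \<le> \<phi> i) \<Longrightarrow> 0 \<le> rest l F G \<alpha> \<beta> \<phi> t"
  by (induction t) auto

lemma rest_le_tsum: "(\<And>i. 0 \<le> \<phi> i) \<Longrightarrow> rest l F G \<alpha> \<beta> \<phi> t \<le> tsum \<phi> t"
  by (induction t) (auto simp: tsum_nonneg add_mono)

lemma stops_full: "full k t \<Longrightarrow> P \<in> set (stops l F G \<alpha> \<beta> t) \<Longrightarrow> \<exists>j\<le>k. full j P"
proof (induction t arbitrary: k)
  case (Node a b c)
  show ?case
  proof (cases "heavy l F G \<alpha> \<beta> (Node a b c)")
    case True
    then show ?thesis using Node.prems by auto
  next
    case False
    obtain j where j: "k = Suc j" "full j a" "full j b" "full j c" using Node.prems by auto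
    show ?thesis using Node.prems(2) False Node.IH(1)[OF j(2)] Node.IH(2)[OF j(3)] Node.IH(3)[OF j(4)] j(1)
      by (auto simp: le_Suc_eq)
  qed
qed (auto split: if_splits)

lemma stops_subtrees: "P \<in> set (stops l F G \<alpha> \<beta> t) \<Longrightarrow> subtrees P \<subseteq> subtrees t"
proof (induction t)
  case (Leaf x)
  then show ?case by (auto split: if_splits)
next
  case (Node a b c)
  then show ?case by (cases "heavy l F G \<alpha> \<beta> (Node a b c)") auto
qed

text \<open>Makes the recursion into the stopping cells well-founded. At a heavy root the list would
  consist of the tree itself.\<close>

lemma stops_size:
  "\<not> heavy l F G \<alpha> \<beta> t \<Longrightarrow> P \<in> set (stops l F G \<alpha> \<beta> t) \<Longrightarrow> size P < size t"
proof -
  have le: "P \<in> set (stops l F G \<alpha> \<beta> t) \<Longrightarrow> size P \<le> size t" for t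
    by (induction t) (auto split: if_splits)
  show "\<not> heavy l F G \<alpha> \<beta> t \<Longrightarrow> P \<in> set (stops l F G \<alpha> \<beta> t) \<Longrightarrow> size P < size t"
    by (cases t) (auto dest!: le)
qed

text \<open>Weak-type bound: the stopping cells are disjoint, and each is no longer than its
  \<open>F\<close>-mass over \<open>\<alpha>\<close> or its \<open>G\<close>-mass over
  \<open>\<beta>\<close>.\<close>

lemma stops_len:
  assumes "\<And>i. 0 \<le> F i" "\<And>i. 0 \<le> G i" "0 < \<alpha>" "0 < \<beta>"
  shows "(\<Sum>P\<leftarrow>stops l F G \<alpha> \<beta> t. len l P) \<le> tsum F t / \<alpha> + tsum G t / \<beta>"
proof -
  have *: "heavy l F G \<alpha> \<beta> t \<Longrightarrow> len l t \<le> tsum F t / \<alpha> + tsum G t / \<beta>" for t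
    using assms tsum_nonneg[of F t] tsum_nonneg[of G t] unfolding heavy_def
    by (smt (verit) divide_nonneg_pos less_divide_eq mult.commute)
  show ?thesis
  proof (induction t)
    case (Leaf x)
    then show ?case using *[of "Leaf x"] assms by auto
  next
    case (Node a b c)
    show ?case
    proof (cases "heavy l F G \<alpha> \<beta> (Node a b c)")
      case True
      then show ?thesis using *[of "Node a b c"] by simp
    next
      case False
      then show ?thesis using Node.IH by (simp add: add_divide_distrib)
    qed
  qed
qed

text \<open>One step of the stopping argument: on the tree cut at the heavy nodes the Haar coefficients
  satisfy Bessel's inequality, encoded by the two negative quadratic terms, and the leaves of the
  cut tree have averages comparable to \<open>\<alpha>\<close> and \<open>\<beta>\<close>.\<close>

lemma haar_form_stops:
  assumes l: "0 < l" and lm: "0 < \<alpha>" "0 < \<beta>"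
    and f: "\<And>i. \<bar>f i\<bar> \<le> F i" and g: "\<And>i. \<bar>g i\<bar> \<le> G i"
    and "full k t" "tsum F t \<le> 3 * \<alpha> * len l t" "tsum G t \<le> 3 * \<beta> * len l t"
  shows "haar_form l f g t \<le> (\<Sum>P\<leftarrow>stops l F G \<alpha> \<beta> t. haar_form l f g P)
    + 3 * \<beta> * tsum F t + 3 * \<alpha> * tsum G t
    - \<beta> / \<alpha> * (tsum f t)\<^sup>2 / len l t - \<alpha> / \<beta> * (tsum g t)\<^sup>2 / len l t"
  using assms(6-8)
proof (induction t arbitrary: k)
  have nnF: "0 \<le> tsum F t" for t :: "'a tree" using f by (intro tsum_nonneg) (smt (verit))
  have nnG: "0 \<le> tsum G t" for t :: "'a tree" using g by (intro tsum_nonneg) (smt (verit))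
  \<comment> \<open>At a stopped cell the quadratic term is paid for by the linear one: one factor
    \<bar>u\<bar> is bounded by \<open>U\<close>, and one \<open>U\<close> by three times threshold
    times length.\<close>
  have sq: "x / y * u\<^sup>2 / n \<le> 3 * x * U" if "0 < x" "0 < y" "0 < n" "\<bar>u\<bar> \<le> U" "U \<le> 3 * y * n"
    for x y u n U :: real
  proof -
    have "u\<^sup>2 \<le> U * U" using that(4) by (metis abs_ge_zero abs_mult_self_eq mult_mono order_trans power2_eq_square)
    also have "\<dots> \<le> (3 * y * n) * U" using that by (intro mult_right_mono) auto
    finally have "x * u\<^sup>2 \<le> x * (3 * y * n * U)" using that by (intro mult_left_mono) auto
    then show ?thesis using that by (simp add: field_simps)
  qed
  have stopped: "0 \<le> 3 * \<beta> * tsum F t + 3 * \<alpha> * tsum G t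
      - \<beta> / \<alpha> * (tsum f t)\<^sup>2 / len l t - \<alpha> / \<beta> * (tsum g t)\<^sup>2 / len l t"
    if "tsum F t \<le> 3 * \<alpha> * len l t" "tsum G t \<le> 3 * \<beta> * len l t" for t :: "'a tree"
    using sq[of \<beta> \<alpha> "len l t" "tsum f t" "tsum F t"] sq[of \<alpha> \<beta> "len l t" "tsum g t" "tsum G t"]
      that lm abs_tsum_le[of f F t, OF f] abs_tsum_le[of g G t, OF g] len_pos[OF l, of t]
    by linarith
  {
    case (Leaf x)
    show ?case using stopped[of "Leaf x"] Leaf.prems by simp
  next
    case (Node a b c)
    let ?t = "Node a b c"
    show ?case
    proof (cases "heavy l F G \<alpha> \<beta> ?t")
      case True
      then show ?thesis using stopped[of ?t] Node.prems by simp
    next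
      case False
      obtain j where j: "full j a" "full j b" "full j c" using Node.prems by auto
      define n where "n = l * 3 ^ j"
      have n: "0 < n" using l by (simp add: n_def)
      have ln: "len l a = n" "len l b = n" "len l c = n" using j by (simp_all add: len_full n_def)
      have FG: "tsum F a + tsum F b + tsum F c \<le> \<alpha> * (3 * n)"
        "tsum G a + tsum G b + tsum G c \<le> \<beta> * (3 * n)"
        using False by (auto simp: heavy_def ln)
      have IH: "haar_form l f g u \<le> (\<Sum>P\<leftarrow>stops l F G \<alpha> \<beta> u. haar_form l f g P)
          + 3 * \<beta> * tsum F u + 3 * \<alpha> * tsum G u
          - \<beta> / \<alpha> * (tsum f u)\<^sup>2 / n - \<alpha> / \<beta> * (tsum g u)\<^sup>2 / n" if "u \<in> {a, b, c}" for u
      proof -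
        \<comment> \<open>The parent is not heavy, all masses are nonnegative, and a child has a
          third of the length. This is the origin of the 3 in the hypotheses.\<close>
        have "tsum F u \<le> 3 * \<alpha> * len l u" "tsum G u \<le> 3 * \<beta> * len l u"
          using FG nnF[of a] nnF[of b] nnF[of c] nnG[of a] nnG[of b] nnG[of c] that ln
          by (auto simp: algebra_simps)
        then show ?thesis using Node.IH j that ln by auto
      qed
      define D where "D = \<bar>tsum f c - tsum f a\<bar>"
      define E where "E = \<bar>tsum g a + tsum g c - 2 * tsum g b\<bar>"
      \<comment> \<open>The vectors \<open>(1, 1, 1)\<close>, \<open>(-1, 0, 1)\<close> and
        \<open>(1, -2, 1)\<close> are orthogonal with squared norms 3, 2 and 6. This bound and the
        next are Parseval's identity for the three child sums with one term dropped.\<close>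
      have D2: "D\<^sup>2 / 2 \<le> (tsum f a)\<^sup>2 + (tsum f b)\<^sup>2 + (tsum f c)\<^sup>2 - (tsum f a + tsum f b + tsum f c)\<^sup>2 / 3"
      proof -
        have "D\<^sup>2 / 2 = (tsum f a)\<^sup>2 + (tsum f b)\<^sup>2 + (tsum f c)\<^sup>2 - (tsum f a + tsum f b + tsum f c)\<^sup>2 / 3
            - (tsum f a + tsum f c - 2 * tsum f b)\<^sup>2 / 6"
          unfolding D_def power2_abs by (simp add: power2_eq_square field_simps)
        then show ?thesis by simp
      qed
      have E2: "E\<^sup>2 / 6 \<le> (tsum g a)\<^sup>2 + (tsum g b)\<^sup>2 + (tsum g c)\<^sup>2 - (tsum g a + tsum g b + tsum g c)\<^sup>2 / 3"
      proof -
        have "E\<^sup>2 / 6 = (tsum g a)\<^sup>2 + (tsum g b)\<^sup>2 + (tsum g c)\<^sup>2 - (tsum g a + tsum g b + tsum g c)\<^sup>2 / 3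
            - (tsum g c - tsum g a)\<^sup>2 / 2"
          unfolding E_def power2_abs by (simp add: power2_eq_square field_simps)
        then show ?thesis by simp
      qed
      \<comment> \<open>The factors \<open>\<beta> / \<alpha>\<close> and
        \<open>\<alpha> / \<beta>\<close> balance the two squares, whatever the relative sizes of
        \<open>f\<close> and \<open>g\<close>.\<close>
      have DE: "D * E / 3 \<le> \<beta> / \<alpha> * (D\<^sup>2 / 2) + \<alpha> / \<beta> * (E\<^sup>2 / 6)"
      proof -
        have "0 \<le> (\<beta> * D - \<alpha> * E)\<^sup>2" by simp
        then have "2 * (\<alpha> * \<beta> * (D * E)) \<le> \<beta>\<^sup>2 * D\<^sup>2 + \<alpha>\<^sup>2 * E\<^sup>2"
          by (simp add: power2_eq_square algebra_simps)
        moreover have "0 \<le> \<beta>\<^sup>2 * D\<^sup>2" by simp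
        ultimately have "\<alpha> * \<beta> * (D * E) / 3 \<le> \<beta>\<^sup>2 * D\<^sup>2 / 2 + \<alpha>\<^sup>2 * E\<^sup>2 / 6" by linarith
        then have "(\<alpha> * \<beta> * (D * E) / 3) / (\<alpha> * \<beta>) \<le> (\<beta>\<^sup>2 * D\<^sup>2 / 2 + \<alpha>\<^sup>2 * E\<^sup>2 / 6) / (\<alpha> * \<beta>)"
          using lm by (intro divide_right_mono) auto
        then show ?thesis using lm by (simp add: add_divide_distrib power2_eq_square)
      qed
      have m1: "\<beta> / \<alpha> * (D\<^sup>2 / 2) \<le> \<beta> / \<alpha> * ((tsum f a)\<^sup>2 + (tsum f b)\<^sup>2 + (tsum f c)\<^sup>2 - (tsum f a + tsum f b + tsum f c)\<^sup>2 / 3)"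
        using D2 lm by (intro mult_left_mono) auto
      have m2: "\<alpha> / \<beta> * (E\<^sup>2 / 6) \<le> \<alpha> / \<beta> * ((tsum g a)\<^sup>2 + (tsum g b)\<^sup>2 + (tsum g c)\<^sup>2 - (tsum g a + tsum g b + tsum g c)\<^sup>2 / 3)"
        using E2 lm by (intro mult_left_mono) auto
      have "D * E / 3 / n \<le> (\<beta> / \<alpha> * ((tsum f a)\<^sup>2 + (tsum f b)\<^sup>2 + (tsum f c)\<^sup>2 - (tsum f a + tsum f b + tsum f c)\<^sup>2 / 3)
        + \<alpha> / \<beta> * ((tsum g a)\<^sup>2 + (tsum g b)\<^sup>2 + (tsum g c)\<^sup>2 - (tsum g a + tsum g b + tsum g c)\<^sup>2 / 3)) / n"
        using DE m1 m2 n by (intro divide_right_mono) linarith+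
      then have key: "D * E / (3 * n) \<le>
          (\<beta> / \<alpha> * (tsum f a)\<^sup>2 / n + \<beta> / \<alpha> * (tsum f b)\<^sup>2 / n + \<beta> / \<alpha> * (tsum f c)\<^sup>2 / n
            - \<beta> / \<alpha> * (tsum f a + tsum f b + tsum f c)\<^sup>2 / (3 * n))
        + (\<alpha> / \<beta> * (tsum g a)\<^sup>2 / n + \<alpha> / \<beta> * (tsum g b)\<^sup>2 / n + \<alpha> / \<beta> * (tsum g c)\<^sup>2 / n
            - \<alpha> / \<beta> * (tsum g a + tsum g b + tsum g c)\<^sup>2 / (3 * n))"
        by (simp add: add_divide_distrib diff_divide_distrib ring_distribs)
      have n3: "len l ?t = 3 * n" by (simp add: ln)
      have hf: "haar_form l f g ?t = D * E / (3 * n) + (haar_form l f g a + haar_form l f g b + haar_form l f g c)"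
        by (simp add: ln D_def E_def)
      show ?thesis
        unfolding hf n3 using key IH[of a] IH[of b] IH[of c] False
        by (simp add: algebra_simps)
    qed
  }
qed

section \<open>Conjugate exponents and Doob's maximal inequality on a tree\<close>

lemma conj_exp:
  fixes p q :: real
  assumes "1 < p" "1 / p + 1 / q = 1"
  shows "1 < q" "(p - 1) * q = p" "(q - 1) * p = q"
    "(p - 1) * (q - 1) = 1" "1 / (p - 1) = q - 1" "p / q = p - 1" "q / p = q - 1"
proof -
  have q0: "q \<noteq> 0" using assms by auto
  have e: "p + q = p * q" using assms q0 by (simp add: field_simps)
  have "q = p / (p - 1)" using e assms by (simp add: field_simps)
  then show q1: "1 < q" using assms by simp
  show "(p - 1) * q = p" "(q - 1) * p = q" "(p - 1) * (q - 1) = 1" using e by (simp_all add: algebra_simps)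
  then show "1 / (p - 1) = q - 1" "p / q = p - 1" "q / p = q - 1"
    using assms q1 by (simp_all add: field_simps)
qed

lemma young_powr:
  fixes p q x y :: real
  assumes "1 < p" "1 / p + 1 / q = 1" "0 \<le> x" "0 \<le> y"
  shows "q * (x powr (p - 1) * y) \<le> x powr p + (q / p) * y powr p"
proof -
  note c = conj_exp[OF assms(1,2)]
  have "x powr (p - 1) * y \<le> (x powr (p - 1)) powr q / q + y powr p / p"
    using assms c(1) by (intro Youngs_inequality) (auto simp: add.commute)
  then have "q * (x powr (p - 1) * y) \<le> q * (x powr p / q + y powr p / p)"
    using c by (intro mult_left_mono) (auto simp: powr_powr)
  then show ?thesis using c(1) by (simp add: distrib_left)
qed

lemma maximal_sum_mono:
  assumes "\<And>i. 0 < v i" "\<And>i. 0 \<le> F i" "0 < p" "m \<le> n"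
  shows "maximal_sum p v F t m \<le> maximal_sum p v F t n"
  using assms(4)
proof (induction t arbitrary: m n)
  case (Leaf i)
  have "0 \<le> F i / v i" using assms(1,2)[of i] by simp
  then have "max m (F i / v i) powr p \<le> max n (F i / v i) powr p"
    using Leaf assms(3) by (intro powr_mono2) auto
  then show ?case using assms(1)[of i] by (auto intro: mult_left_mono)
next
  case (Node a b c)
  have "max m x \<le> max n x" for x using Node.prems by auto
  then show ?case by (auto simp: Let_def intro!: add_mono Node.IH)
qed

text \<open>Outside the stopping cells the maximal function is at least the starting value
  \<open>m\<close>; inside, starting from \<open>m\<close> instead of the true running maximum only
  lowers the sum. So the charge of one cell and the charges of its stopping cells fit together into
  a single maximal sum.\<close>

lemma maximal_sum_stops:
  assumes v: "\<And>i. 0 < v i" and F: "\<And>i. 0 \<le> F i" and p: "0 < p" and m: "0 \<le> m"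
  shows "(\<Sum>P\<leftarrow>stops l F' G' \<alpha> \<beta> t. maximal_sum p v F P m) + m powr p * rest l F' G' \<alpha> \<beta> v t
    \<le> maximal_sum p v F t m"
proof (induction t)
  case (Leaf i)
  have "m powr p \<le> max m (F i / v i) powr p"
    using m p by (intro powr_mono2) auto
  then show ?case using v[of i] by (auto simp: mult.commute intro: mult_left_mono)
next
  case (Node a b c)
  show ?case
  proof (cases "heavy l F' G' \<alpha> \<beta> (Node a b c)")
    case False
    define m' where "m' = max m (tsum F (Node a b c) / tsum v (Node a b c))"
    have "maximal_sum p v F u m \<le> maximal_sum p v F u m'" for u
      using v F p by (intro maximal_sum_mono) (auto simp: m'_def)
    moreover have "maximal_sum p v F (Node a b c) m = maximal_sum p v F a m' + maximal_sum p v F b m' + maximal_sum p v F c m'"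
      by (simp add: Let_def m'_def)
    ultimately show ?thesis using False Node.IH
      by (simp del: maximal_sum.simps(2) add: distrib_left) (smt (verit))
  qed simp
qed

text \<open>Pathwise form of Doob's maximal inequality: by Young's inequality, the excess of the maximal
  sum over \<open>q\<close> times the mixed sum can only decrease when the tree is refined.\<close>

lemma maximal_sum_mixed_sum:
  assumes v: "\<And>i. 0 < v i" and F: "\<And>i. 0 \<le> F i" and pq: "1 < p" "1 / p + 1 / q = 1" and m: "0 \<le> m"
  shows "maximal_sum p v F t m - q * mixed_sum p v F t m
    \<le> tsum v t * max m (tsum F t / tsum v t) powr p
      - q * (max m (tsum F t / tsum v t) powr (p - 1) * tsum F t)"
  using m
proof (induction t arbitrary: m)
  case (Leaf i)
  then show ?case by (simp add: mult.commute)
next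
  case (Node a b c)
  define M where "M = max m (tsum F (Node a b c) / tsum v (Node a b c))"
  have M: "0 \<le> M" using Node.prems by (simp add: M_def)
  have child: "maximal_sum p v F u M - q * mixed_sum p v F u M
      \<le> tsum v u * M powr p - q * (M powr (p - 1) * tsum F u)" if u: "u \<in> {a, b, c}" for u
  proof -
    define y where "y = tsum F u / tsum v u"
    have vu: "0 < tsum v u" using v by (rule tsum_pos)
    have y: "tsum F u = tsum v u * y" "0 \<le> y"
      using vu tsum_nonneg[of F u] F by (auto simp: y_def)
    have IH: "maximal_sum p v F u M - q * mixed_sum p v F u M
      \<le> tsum v u * max M y powr p - q * (max M y powr (p - 1) * tsum F u)"
      using Node.IH u M unfolding y_def by blast
    \<comment> \<open>As \<open>(p - 1) * q = p\<close>, the function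
      \<open>x powr p - q * (x powr (p - 1) * y)\<close> of \<open>x \<ge> 0\<close> is smallest at
      \<open>x = y\<close>. Raising the maximum from \<open>M\<close> to \<open>y\<close> therefore
      lowers it.\<close>
    also have "\<dots> \<le> tsum v u * M powr p - q * (M powr (p - 1) * tsum F u)"
    proof (cases "y \<le> M")
      case False
      have "y powr p = y powr (p - 1) * y" using False M by (simp add: powr_diff)
      moreover have "q * (M powr (p - 1) * y) \<le> M powr p + (q - 1) * y powr p"
        using young_powr[OF pq M y(2)] conj_exp[OF pq] by simp
      ultimately have "y powr p - q * (y powr (p - 1) * y) \<le> M powr p - q * (M powr (p - 1) * y)"
        by (simp add: algebra_simps)
      then have "tsum v u * (y powr p - q * (y powr (p - 1) * y)) \<le> tsum v u * (M powr p - q * (M powr (p - 1) * y))"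
        using vu by (intro mult_left_mono) auto
      then show ?thesis using False by (simp add: y algebra_simps max_def)
    qed (simp add: max_def)
    finally show ?thesis .
  qed
  have "maximal_sum p v F (Node a b c) m = maximal_sum p v F a M + maximal_sum p v F b M + maximal_sum p v F c M"
    "mixed_sum p v F (Node a b c) m = mixed_sum p v F a M + mixed_sum p v F b M + mixed_sum p v F c M"
    by (simp_all add: Let_def M_def)
  then show ?case unfolding M_def[symmetric] using child[of a] child[of b] child[of c]
    by (simp del: maximal_sum.simps(2) mixed_sum.simps(2) add: algebra_simps)
qed

text \<open>Young's inequality is applied at each leaf with \<open>2 * x\<close> in place of
  \<open>x\<close>, so that the maximal sum returns with the factor 1/2 and can be absorbed.\<close>

lemma mixed_sum_le:
  assumes v: "\<And>i. 0 < v i" and F: "\<And>i. 0 \<le> F i" and pq: "1 < p" "1 / p + 1 / q = 1"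
  shows "q * mixed_sum p v F t m \<le> maximal_sum p v F t m / 2
    + q / p * 2 powr (p - 1) * tsum (\<lambda>i. v i * (F i / v i) powr p) t"
proof (induction t arbitrary: m)
  case (Leaf i)
  define x where "x = F i / v i"
  define M where "M = max m x"
  have vi: "0 < v i" using v .
  have x: "F i = v i * x" "0 \<le> x" using v[of i] F[of i] by (auto simp: x_def)
  have "q * (M powr (p - 1) * (2 * x)) \<le> M powr p + (q / p) * (2 * x) powr p"
    using x by (intro young_powr[OF pq]) (auto simp: M_def)
  then have "q * (M powr (p - 1) * x) \<le> M powr p / 2 + (q / p) * 2 powr (p - 1) * x powr p"
  proof -
    have "2 powr p = 2 * 2 powr (p - 1)" by (simp add: powr_diff)
    then have "(2 * x) powr p = 2 * (2 powr (p - 1) * x powr p)" using x by (simp add: powr_mult)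
    then have "q / p * (2 * x) powr p = 2 * (q / p * 2 powr (p - 1) * x powr p)" by simp
    moreover have "q * (M powr (p - 1) * (2 * x)) = 2 * (q * (M powr (p - 1) * x))" by simp
    ultimately show ?thesis
      using \<open>q * (M powr (p - 1) * (2 * x)) \<le> M powr p + q / p * (2 * x) powr p\<close> by linarith
  qed
  then have "v i * (q * (M powr (p - 1) * x)) \<le> v i * (M powr p / 2 + (q / p) * 2 powr (p - 1) * x powr p)"
    using vi by (intro mult_left_mono) auto
  then show ?case by (simp add: x_def[symmetric] M_def[symmetric] x(1) algebra_simps)
next
  case (Node a b c)
  define M where "M = max m (tsum F (Node a b c) / tsum v (Node a b c))"
  have "maximal_sum p v F (Node a b c) m = maximal_sum p v F a M + maximal_sum p v F b M + maximal_sum p v F c M"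
    "mixed_sum p v F (Node a b c) m = mixed_sum p v F a M + mixed_sum p v F b M + mixed_sum p v F c M"
    by (simp_all add: Let_def M_def)
  then show ?case using Node.IH[of M]
    by (simp del: maximal_sum.simps(2) mixed_sum.simps(2) add: distrib_left add_divide_distrib)
qed

text \<open>For \<open>m = 0\<close> the right-hand side of \<open>maximal_sum_mixed_sum\<close> is
  \<open>1 - q\<close> times a nonnegative number, hence the maximal sum is at most \<open>q\<close>
  times the mixed sum. Half of it is then absorbed.\<close>

lemma maximal_sum_le:
  assumes v: "\<And>i. 0 < v i" and F: "\<And>i. 0 \<le> F i" and pq: "1 < p" "1 / p + 1 / q = 1"
  shows "maximal_sum p v F t 0 \<le> q / p * 2 powr p * tsum (\<lambda>i. v i * (F i / v i) powr p) t"
proof -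
  define y where "y = tsum F t / tsum v t"
  have vt: "0 < tsum v t" using v by (rule tsum_pos)
  have y: "tsum F t = tsum v t * y" "0 \<le> y" using vt tsum_nonneg[of F t] F by (auto simp: y_def)
  have "y powr p = y powr (p - 1) * y" using y by (cases "y = 0") (auto simp: powr_diff)
  then have "maximal_sum p v F t 0 - q * mixed_sum p v F t 0 \<le> tsum v t * ((1 - q) * y powr p)"
    using maximal_sum_mixed_sum[where t = t and m = 0 and v = v and F = F, OF v F pq] y vt
    by (simp add: max_def algebra_simps)
  also have "\<dots> \<le> 0" using vt conj_exp[OF pq] by (intro mult_nonneg_nonpos mult_nonpos_nonneg) auto
  finally have 1: "maximal_sum p v F t 0 - q * mixed_sum p v F t 0 \<le> 0" .
  define X where "X = q / p * 2 powr (p - 1) * tsum (\<lambda>i. v i * (F i / v i) powr p) t"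
  have "maximal_sum p v F t 0 \<le> 2 * X"
    using 1 mixed_sum_le[where t = t and m = 0 and v = v and F = F, OF v F pq]
    unfolding X_def[symmetric] by linarith
  also have "2 * X = q / p * 2 powr p * tsum (\<lambda>i. v i * (F i / v i) powr p) t"
    by (simp add: X_def powr_diff)
  finally show ?thesis .
qed

text \<open>The condition enters as
  \<open>v powr (1 / q) * w powr (1 / p) \<le> A powr (1 / p) * L\<close>. Splitting this factor off
  leaves a product \<open>a * b\<close> whose Young terms involve \<open>F / v\<close> and
  \<open>G / w\<close>, averages with respect to the weights themselves, which is what the maximal
  sums control.\<close>

lemma product_average_le:
  fixes p q F G v w L A :: real
  assumes pq: "1 < p" "1 / p + 1 / q = 1" and pos: "0 < v" "0 < w" "0 < L" "0 \<le> F" "0 \<le> G"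
    and A: "w * v powr (p - 1) \<le> A * L powr p"
  shows "F * G / L \<le> A powr (1 / p) * (v * (F / v) powr p + w * (G / w) powr q)"
proof -
  note c = conj_exp[OF pq]
  have A0: "0 \<le> A" using A pos by (smt (verit) mult_nonneg_nonneg powr_gt_zero mult_pos_pos zero_less_mult_pos2)
  define a where "a = F * v powr (- 1 / q)"
  define b where "b = G * w powr (- 1 / p)"
  have dual: "(H * u powr (- 1 / r')) powr r = u * (H / u) powr r"
    if "0 < u" "0 \<le> H" "r / r' = r - 1" for H u r r' :: real
  proof -
    have "(H * u powr (- 1 / r')) powr r = H powr r * u powr (1 - r)"
      using that by (simp add: powr_mult powr_powr)
    also have "\<dots> = u * (H / u) powr r" using that by (simp add: powr_divide powr_diff)
    finally show ?thesis .
  qed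
  have ap: "a powr p = v * (F / v) powr p" and bq: "b powr q = w * (G / w) powr q"
    unfolding a_def b_def using pos c by (simp_all only: dual)
  have e: "(p - 1) / p = 1 / q" using pq by (simp add: diff_divide_distrib)
  have "v powr (1 / q) * w powr (1 / p) = (w * v powr (p - 1)) powr (1 / p)"
    using pos by (simp add: powr_mult powr_powr e)
  also have "\<dots> \<le> (A * L powr p) powr (1 / p)"
    using A pos pq by (intro powr_mono2) auto
  also have "\<dots> = A powr (1 / p) * L" using A0 pos pq by (simp add: powr_mult powr_powr)
  finally have k: "v powr (1 / q) * w powr (1 / p) \<le> A powr (1 / p) * L" .
  have ab: "a * b \<le> a powr p / p + b powr q / q"
    using pq c pos by (intro Youngs_inequality) (auto simp: a_def b_def)
  have ab2: "a * b \<le> a powr p + b powr q"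
  proof -
    have "a powr p / p \<le> a powr p" "b powr q / q \<le> b powr q"
      using pq c(1) by (auto simp: divide_le_eq_numeral mult_le_cancel_left1 pos_divide_le_eq)
    then show ?thesis using ab by linarith
  qed
  have "F * G / L = (a * b) * (v powr (1 / q) * w powr (1 / p)) / L"
    using pos by (simp add: a_def b_def powr_minus_divide)
  also have "\<dots> \<le> (a * b) * (A powr (1 / p) * L) / L"
    using k pos by (intro divide_right_mono mult_left_mono) (auto simp: a_def b_def)
  also have "\<dots> = A powr (1 / p) * (a * b)" using pos by simp
  also have "\<dots> \<le> A powr (1 / p) * (a powr p + b powr q)"
    using ab2 by (intro mult_left_mono) auto
  finally show ?thesis unfolding ap bq .
qed

text \<open>The premise \<open>half\<close> is Hoelder's inequality for the parts \<open>v'\<close>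
  and \<open>w'\<close>, unfolded into a family of inequalities linear in both, so that it can be
  summed over leaves. As \<open>v'\<close> is at most \<open>v\<close>, a suitable
  \<open>\<theta>\<close> leaves a quarter of the length to \<open>w'\<close> alone.\<close>

lemma mass_ge:
  fixes p v w v' w' L A :: real
  assumes p: "1 < p" and pos: "0 < v" "0 < w" "0 < L" and A0: "0 < A"
    and A: "w * v powr (p - 1) \<le> A * L powr p" and le: "v' \<le> v"
    and half: "\<And>\<theta>. 0 < \<theta> \<Longrightarrow> L / 2 \<le> \<theta> * v' + \<theta> powr (1 - p) * w'"
  shows "w \<le> A * 4 powr p * w'"
proof -
  \<comment> \<open>With this value the \<open>v\<close>-term is at most \<open>L / 4\<close>, half
    of the left-hand side.\<close>
  define \<theta> where "\<theta> = L / (4 * v)"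
  have \<theta>: "0 < \<theta>" using pos by (simp add: \<theta>_def)
  have "\<theta> * v' \<le> \<theta> * v" using le \<theta> by (intro mult_left_mono) auto
  also have "\<dots> = L / 4" using pos by (simp add: \<theta>_def)
  finally have "L / 4 \<le> \<theta> powr (1 - p) * w'" using half[OF \<theta>] by simp
  then have "\<theta> powr (p - 1) * (L / 4) \<le> \<theta> powr (p - 1) * (\<theta> powr (1 - p) * w')"
    by (intro mult_left_mono) auto
  also have "\<dots> = w'" using \<theta> by (simp add: mult.assoc[symmetric] powr_add[symmetric])
  also have "\<theta> powr (p - 1) * (L / 4) = L powr p / (4 powr p * v powr (p - 1))"
    unfolding \<theta>_def using pos by (simp add: powr_divide powr_mult powr_diff)
  finally have 1: "L powr p \<le> 4 powr p * w' * v powr (p - 1)"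
    using pos by (simp add: field_simps)
  have "w * v powr (p - 1) \<le> A * (4 powr p * w' * v powr (p - 1))"
    using A 1 A0 by (meson mult_left_mono order_trans less_imp_le)
  then have "w * v powr (p - 1) \<le> (A * 4 powr p * w') * v powr (p - 1)" by (simp add: mult.assoc)
  then show ?thesis using pos by (metis mult_le_cancel_right_pos powr_gt_zero less_numeral_extra(3))
qed

text \<open>An A_infinity property with explicit constants. The second bound is the first with the
  exponents exchanged: the condition is raised to the power \<open>q - 1\<close>, and
  \<open>\<theta>\<close> is replaced by \<open>\<eta> powr (1 - q)\<close>.\<close>

lemma half_mass:
  fixes p q v w v' w' L A :: real
  assumes pq: "1 < p" "1 / p + 1 / q = 1" and pos: "0 < v" "0 < w" "0 < L"
    and A: "w * v powr (p - 1) \<le> A * L powr p"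
    and le: "v' \<le> v" "w' \<le> w"
    and half: "\<And>\<theta>. 0 < \<theta> \<Longrightarrow> L / 2 \<le> \<theta> * v' + \<theta> powr (1 - p) * w'"
  shows "w \<le> A * 4 powr p * w'" "v \<le> A powr (q - 1) * 4 powr q * v'"
proof -
  note c = conj_exp[OF pq]
  have A0: "0 < A" using A pos by (smt (verit) mult_pos_pos powr_gt_zero zero_less_mult_pos2)
  show "w \<le> A * 4 powr p * w'" by (rule mass_ge[OF pq(1) pos A0 A le(1) half])
  have "(w * v powr (p - 1)) powr (q - 1) \<le> (A * L powr p) powr (q - 1)"
    using A pos c by (intro powr_mono2) auto
  also have "\<dots> = A powr (q - 1) * L powr q"
    using A0 pos c by (simp add: powr_mult powr_powr mult.commute)
  finally have "v * w powr (q - 1) \<le> A powr (q - 1) * L powr q"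
    using pos c by (simp add: powr_mult powr_powr mult.commute)
  moreover have "L / 2 \<le> \<eta> * w' + \<eta> powr (1 - q) * v'" if "0 < \<eta>" for \<eta>
  proof -
    have "(1 - q) * (1 - p) = 1" using c(4) by (simp add: algebra_simps)
    then show ?thesis using half[of "\<eta> powr (1 - q)"] that by (simp add: powr_powr add.commute)
  qed
  ultimately show "v \<le> A powr (q - 1) * 4 powr q * v'"
    using A0 le(2) by (intro mass_ge[OF c(1) pos(2,1,3)]) auto
qed

text \<open>The 24 is 2 * 3 * 4: two linear terms in \<open>haar_form_stops\<close>, each with a
  factor 3 and a threshold of four times the average.\<close>

definition tree_const :: "real \<Rightarrow> real \<Rightarrow> real \<Rightarrow> real" where
  "tree_const p q A = 24 * (A powr (1 / p) * (A powr (q - 1) * 4 powr q + A * 4 powr p))"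

lemma subtrees_refl [simp]: "t \<in> subtrees t"
  by (cases t) auto

text \<open>Sparse domination by induction on the size of the tree. The root contributes a product
  of two integrals over its length; \<open>half_mass\<close> charges it to the part outside the
  stopping cells, where the maximal functions are at least the root averages. The stopping cells are
  charged inductively, with the root averages as starting maxima, and all charges add up to one
  maximal sum for each weight.\<close>

lemma haar_form_le_maximal_sum:
  assumes pq: "1 < p" "1 / p + 1 / q = 1" and l: "0 < l"
    and f: "\<And>i. \<bar>f i\<bar> \<le> F i" and g: "\<And>i. \<bar>g i\<bar> \<le> G i"
    and v: "\<And>i. 0 < v i" and w: "\<And>i. 0 < w i"
    and leaf: "\<And>i \<theta>. 0 < \<theta> \<Longrightarrow> l \<le> \<theta> * v i + \<theta> powr (1 - p) * w i"
    and Ap: "\<And>u. u \<in> subtrees t \<Longrightarrow> tsum w u * tsum v u powr (p - 1) \<le> A * len l u powr p"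
    and "full k t"
  shows "haar_form l f g t \<le> tree_const p q A * (maximal_sum p v F t 0 + maximal_sum q w G t 0)"
  using Ap \<open>full k t\<close>
proof (induction "size t" arbitrary: t k rule: less_induct)
  case less
  note c = conj_exp[OF pq]
  have F: "0 \<le> F i" for i using f[of i] by linarith
  have G: "0 \<le> G i" for i using g[of i] by linarith
  let ?C = "tree_const p q A"
  have C: "0 \<le> ?C" if "0 < A" unfolding tree_const_def using that by simp
  define L where "L = len l t"
  have L: "0 < L" unfolding L_def using l by (rule len_pos)
  have vt: "0 < tsum v t" and wt: "0 < tsum w t" using v w by (auto intro: tsum_pos)
  have A: "tsum w t * tsum v t powr (p - 1) \<le> A * L powr p"
    unfolding L_def by (rule less.prems(1)) simp
  have A0: "0 < A" using A L vt wt by (smt (verit) mult_pos_pos powr_gt_zero zero_less_mult_pos2)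
  have mn: "0 \<le> maximal_sum p v F t 0" "0 \<le> maximal_sum q w G t 0"
  proof -
    have "0 \<le> maximal_sum r z H t m" if "\<And>i. (0::real) < z i" for r z H m
      using that by (induction t arbitrary: m) (auto simp: Let_def less_imp_le intro!: add_nonneg_nonneg)
    then show "0 \<le> maximal_sum p v F t 0" "0 \<le> maximal_sum q w G t 0" using v w by auto
  qed
  show ?case
  proof (cases "tsum F t = 0 \<or> tsum G t = 0")
    case True
    then have "haar_form l f g t = 0" using haar_form_eq_0[of f F g G, OF f g] by blast
    then show ?thesis using C[OF A0] mn by simp
  next
    case False
    then have Ft: "0 < tsum F t" and Gt: "0 < tsum G t"
      using tsum_nonneg[of F t, OF F] tsum_nonneg[of G t, OF G] by auto
    \<comment> \<open>Thresholds of four times the average: by the weak-type bound each of the two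
      functions accounts for at most a quarter of the length, so at least half remains
      uncovered.\<close>
    define \<alpha> where "\<alpha> = 4 * tsum F t / L"
    define \<beta> where "\<beta> = 4 * tsum G t / L"
    have \<alpha>\<beta>: "0 < \<alpha>" "0 < \<beta>" using Ft Gt L by (auto simp: \<alpha>_def \<beta>_def)
    have ts: "tsum F t = \<alpha> * L / 4" "tsum G t = \<beta> * L / 4" using L by (auto simp: \<alpha>_def \<beta>_def)
    let ?S = "stops l F G \<alpha> \<beta> t"
    let ?R = "\<lambda>\<phi>. rest l F G \<alpha> \<beta> \<phi> t"
    have nh: "\<not> heavy l F G \<alpha> \<beta> t"
      unfolding heavy_def L_def[symmetric] ts using \<alpha>\<beta> L by (simp add: field_simps)
    have "haar_form l f g t \<le> (\<Sum>P\<leftarrow>?S. haar_form l f g P)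
      + 3 * \<beta> * tsum F t + 3 * \<alpha> * tsum G t
      - \<beta> / \<alpha> * (tsum f t)\<^sup>2 / len l t - \<alpha> / \<beta> * (tsum g t)\<^sup>2 / len l t"
      using l \<alpha>\<beta> f g less.prems(2) L
      by (intro haar_form_stops) (auto simp: L_def[symmetric] ts)
    also have "\<dots> \<le> (\<Sum>P\<leftarrow>?S. haar_form l f g P) + 3 * \<beta> * tsum F t + 3 * \<alpha> * tsum G t"
    proof -
      have "0 \<le> \<beta> / \<alpha> * (tsum f t)\<^sup>2 / len l t" "0 \<le> \<alpha> / \<beta> * (tsum g t)\<^sup>2 / len l t"
        using \<alpha>\<beta> L by (auto simp: L_def[symmetric])
      then show ?thesis by linarith
    qed
    also have "\<dots> = (\<Sum>P\<leftarrow>?S. haar_form l f g P) + 24 * (tsum F t * tsum G t / L)"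
      by (simp add: \<alpha>_def \<beta>_def)
    finally have 1: "haar_form l f g t \<le> (\<Sum>P\<leftarrow>?S. haar_form l f g P) + 24 * (tsum F t * tsum G t / L)" .
    have "(\<Sum>P\<leftarrow>?S. len l P) \<le> tsum F t / \<alpha> + tsum G t / \<beta>"
      by (rule stops_len[OF F G \<alpha>\<beta>])
    also have "\<dots> = L / 2" using \<alpha>\<beta> by (simp add: ts)
    finally have "L / 2 \<le> ?R (\<lambda>_. l)"
      using tsum_rest[of "\<lambda>_. l" t l F G \<alpha> \<beta>] by (simp add: L_def len_def)
    also have "?R (\<lambda>_. l) \<le> \<theta> * ?R v + \<theta> powr (1 - p) * ?R w" if "0 < \<theta>" for \<theta>
      unfolding rest_linear[symmetric] using leaf[OF that] by (rule rest_mono)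
    finally have half: "L / 2 \<le> \<theta> * ?R v + \<theta> powr (1 - p) * ?R w" if "0 < \<theta>" for \<theta>
      using that by blast
    have rle: "?R v \<le> tsum v t" "?R w \<le> tsum w t"
      by (rule rest_le_tsum, use v w in \<open>simp add: less_imp_le\<close>)+
    note hm = half_mass[OF pq vt wt L A rle half]
    define y where "y = tsum F t / tsum v t"
    define z where "z = tsum G t / tsum w t"
    have yz: "0 \<le> y" "0 \<le> z" using vt wt Ft Gt by (auto simp: y_def z_def)
    have "tsum F t * tsum G t / L \<le> A powr (1 / p) * (tsum v t * y powr p + tsum w t * z powr q)"
      unfolding y_def z_def using Ft Gt by (intro product_average_le[OF pq vt wt L _ _ A]) auto
    also have "\<dots> \<le> A powr (1 / p) * ((A powr (q - 1) * 4 powr q * ?R v) * y powr p + (A * 4 powr p * ?R w) * z powr q)"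
      using hm by (intro mult_left_mono add_mono mult_right_mono) auto
    also have "\<dots> \<le> A powr (1 / p) * ((A powr (q - 1) * 4 powr q + A * 4 powr p) * (y powr p * ?R v + z powr q * ?R w))"
    proof -
      have "0 \<le> y powr p * ?R v" "0 \<le> z powr q * ?R w" 
        by (rule mult_nonneg_nonneg[OF _ rest_nonneg], use v w in \<open>simp_all add: less_imp_le\<close>)+
      then have "0 \<le> A * 4 powr p * (y powr p * ?R v)" "0 \<le> A powr (q - 1) * 4 powr q * (z powr q * ?R w)"
        using A0 by auto
      then have "(A powr (q - 1) * 4 powr q * ?R v) * y powr p + (A * 4 powr p * ?R w) * z powr q
        \<le> (A powr (q - 1) * 4 powr q + A * 4 powr p) * (y powr p * ?R v + z powr q * ?R w)"
        by (simp add: algebra_simps)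
      then show ?thesis by (intro mult_left_mono) auto
    qed
    finally have 2: "24 * (tsum F t * tsum G t / L) \<le> ?C * (y powr p * ?R v + z powr q * ?R w)"
      unfolding tree_const_def by simp
    have 3: "(\<Sum>P\<leftarrow>?S. haar_form l f g P) \<le> (\<Sum>P\<leftarrow>?S. ?C * (maximal_sum p v F P y + maximal_sum q w G P z))"
    proof (rule sum_list_mono)
      fix P assume P: "P \<in> set ?S"
      obtain j where j: "full j P" using stops_full[OF less.prems(2) P] by auto
      have "haar_form l f g P \<le> ?C * (maximal_sum p v F P 0 + maximal_sum q w G P 0)"
        using stops_size[OF nh P] stops_subtrees[OF P] less.prems(1) j by (intro less.hyps) auto
      also have "\<dots> \<le> ?C * (maximal_sum p v F P y + maximal_sum q w G P z)"
        using v w F G yz pq c(1) C[OF A0] by (intro mult_left_mono add_mono maximal_sum_mono) auto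
      finally show "haar_form l f g P \<le> \<dots>" .
    qed
    \<comment> \<open>The root average is the first value met by the running maximum, so starting
      there instead of at 0 changes nothing.\<close>
    have 4: "maximal_sum p v F t 0 = maximal_sum p v F t y" "maximal_sum q w G t 0 = maximal_sum q w G t z"
      using yz by (cases t; simp add: y_def z_def Let_def)+
    have 5: "(\<Sum>P\<leftarrow>?S. maximal_sum p v F P y) + y powr p * ?R v \<le> maximal_sum p v F t y"
      using v F pq yz by (intro maximal_sum_stops) auto
    have 6: "(\<Sum>P\<leftarrow>?S. maximal_sum q w G P z) + z powr q * ?R w \<le> maximal_sum q w G t z"
      using w G c(1) yz by (intro maximal_sum_stops) auto
    have "haar_form l f g t \<le> ?C * ((\<Sum>P\<leftarrow>?S. maximal_sum p v F P y) + (\<Sum>P\<leftarrow>?S. maximal_sum q w G P z)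
        + (y powr p * ?R v + z powr q * ?R w))"
      using 1 2 3 by (simp add: sum_list_const_mult sum_list_addf algebra_simps)
    also have "\<dots> \<le> ?C * (maximal_sum p v F t y + maximal_sum q w G t z)"
      using 5 6 C[OF A0] by (intro mult_left_mono) auto
    finally show ?thesis unfolding 4 .
  qed
qed

lemma haar_form_bound:
  assumes pq: "1 < p" "1 / p + 1 / q = 1" and l: "0 < l"
    and f: "\<And>i. \<bar>f i\<bar> \<le> F i" and g: "\<And>i. \<bar>g i\<bar> \<le> G i"
    and v: "\<And>i. 0 < v i" and w: "\<And>i. 0 < w i"
    and leaf: "\<And>i \<theta>. 0 < \<theta> \<Longrightarrow> l \<le> \<theta> * v i + \<theta> powr (1 - p) * w i"
    and Ap: "\<And>u. u \<in> subtrees t \<Longrightarrow> tsum w u * tsum v u powr (p - 1) \<le> A * len l u powr p"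
    and "full k t"
  shows "haar_form l f g t \<le> tree_const p q A * (q / p * 2 powr p + p / q * 2 powr q) *
    (tsum (\<lambda>i. v i * (F i / v i) powr p) t + tsum (\<lambda>i. w i * (G i / w i) powr q) t)"
proof -
  note c = conj_exp[OF pq]
  have F: "0 \<le> F i" for i using f[of i] by linarith
  have G: "0 \<le> G i" for i using g[of i] by linarith
  have vt: "0 < tsum v t" and wt: "0 < tsum w t" using v w by (auto intro: tsum_pos)
  have "tsum w t * tsum v t powr (p - 1) \<le> A * len l t powr p" by (rule Ap) simp
  then have A0: "0 < A" using len_pos[OF l, of t] vt wt by (smt (verit) mult_pos_pos powr_gt_zero zero_less_mult_pos2)
  have C: "0 \<le> tree_const p q A" unfolding tree_const_def using A0 by simp
  let ?a = "tsum (\<lambda>i. v i * (F i / v i) powr p) t" and ?b = "tsum (\<lambda>i. w i * (G i / w i) powr q) t"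
  have n: "0 \<le> ?a" "0 \<le> ?b"
    by (rule tsum_nonneg, use v w in \<open>simp add: less_imp_le\<close>)+
  have qp: "1 / q + 1 / p = 1" using pq by simp
  have "haar_form l f g t \<le> tree_const p q A * (maximal_sum p v F t 0 + maximal_sum q w G t 0)"
    by (rule haar_form_le_maximal_sum[OF assms])
  also have "\<dots> \<le> tree_const p q A * (q / p * 2 powr p * ?a + p / q * 2 powr q * ?b)"
    using C maximal_sum_le[where v = v and F = F, OF v F pq, of t] maximal_sum_le[where v = w and F = G, OF w G c(1) qp, of t]
    by (intro mult_left_mono add_mono) auto
  also have "\<dots> \<le> tree_const p q A * ((q / p * 2 powr p + p / q * 2 powr q) * (?a + ?b))"
  proof (rule mult_left_mono[OF _ C])
    have "0 \<le> q / p * 2 powr p * ?b" "0 \<le> p / q * 2 powr q * ?a" using n pq c(1) by auto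
    then show "q / p * 2 powr p * ?a + p / q * 2 powr q * ?b \<le> (q / p * 2 powr p + p / q * 2 powr q) * (?a + ?b)"
      by (simp add: algebra_simps)
  qed
  finally show ?thesis by (simp add: mult.assoc)
qed

section \<open>Averaging over triadic grids\<close>

text \<open>Half-open intervals tile without overlap, so windows add up exactly over the leaves of a
  grid.\<close>

definition window :: "(real \<Rightarrow> real) \<Rightarrow> real \<Rightarrow> real \<Rightarrow> real" where
  "window f a s = (LINT x|lborel. indicator {a..<a + s} x * f x)"

text \<open>A leaf stores the left endpoint of its cell; a function on the line thus acts on leaves
  through \<open>\<lambda>a. window f a s\<close>.\<close>

primrec grid :: "real \<Rightarrow> nat \<Rightarrow> real \<Rightarrow> real tree" where
  "grid s 0 a = Leaf a"
| "grid s (Suc k) a = Node (grid s k a) (grid s k (a + s * 3 ^ k)) (grid s k (a + 2 * (s * 3 ^ k)))"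

definition locally_int :: "(real \<Rightarrow> real) \<Rightarrow> bool" where
  "locally_int f \<longleftrightarrow> (\<forall>a b. integrable lborel (\<lambda>x. indicator {a..<b} x * f x))"

lemma locally_intD: "locally_int f \<Longrightarrow> integrable lborel (\<lambda>x. indicator {a..<b} x * f x)"
  by (simp add: locally_int_def)

lemma integrable_locally_int: "integrable lborel f \<Longrightarrow> locally_int f"
  unfolding locally_int_def
  using integrable_mult_indicator[of _ lborel f] by (simp add: real_scaleR_def)

lemma window_split:
  assumes "locally_int f" "0 \<le> s" "0 \<le> t"
  shows "window f a (s + t) = window f a s + window f (a + s) t"
proof -
  have "(\<lambda>x. indicator {a..<a + (s + t)} x * f x)
      = (\<lambda>x. indicator {a..<a + s} x * f x + indicator {a + s..<a + s + t} x * f x)"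
    using assms by (auto simp: fun_eq_iff indicator_def)
  then show ?thesis using assms(1) unfolding window_def
    by (simp add: locally_intD)
qed

lemma window_mono:
  assumes "locally_int f" "locally_int g" "\<And>x. f x \<le> g x"
  shows "window f a s \<le> window g a s"
  unfolding window_def using assms
  by (intro integral_mono locally_intD) (auto intro: mult_left_mono)

lemma window_nonneg: "(\<And>x. 0 \<le> f x) \<Longrightarrow> 0 \<le> window f a s"
  unfolding window_def by (intro integral_nonneg_AE) auto

lemma window_const: "0 \<le> s \<Longrightarrow> window (\<lambda>x. c) a s = c * s"
  unfolding window_def by simp

lemma locally_int_const: "locally_int (\<lambda>x. c)"
proof -
  have "emeasure lborel {a..<b::real} < \<infinity>" for a b by (cases "a \<le> b") auto
  then show ?thesis unfolding locally_int_def by (auto intro!: integrable_mult_left)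
qed

lemma locally_int_add: "locally_int f \<Longrightarrow> locally_int g \<Longrightarrow> locally_int (\<lambda>x. f x + g x)"
  unfolding locally_int_def by (auto simp: distrib_left)

lemma locally_int_cmult: "locally_int f \<Longrightarrow> locally_int (\<lambda>x. c * f x)"
  unfolding locally_int_def by (auto simp: mult.left_commute)

lemma window_add: "locally_int f \<Longrightarrow> locally_int g \<Longrightarrow> window (\<lambda>x. f x + g x) a s = window f a s + window g a s"
  unfolding window_def by (simp add: distrib_left locally_intD)

lemma window_cmult: "window (\<lambda>x. c * f x) a s = c * window f a s"
  unfolding window_def by (simp add: mult.left_commute)

lemma window_abs: "\<bar>window f a s\<bar> \<le> window (\<lambda>x. \<bar>f x\<bar>) a s"
  unfolding window_def using integral_abs_bound[of lborel "\<lambda>x. indicator {a..<a + s} x * f x"]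
  by (simp add: abs_mult)

lemma window_pos:
  assumes "locally_int f" "\<And>x. 0 < f x" "0 < s"
  shows "0 < window f a s"
proof -
  have "0 \<le> window f a s" using assms by (intro window_nonneg) (simp add: less_imp_le)
  moreover have "window f a s \<noteq> 0"
  proof
    assume "window f a s = 0"
    then have "AE x in lborel. indicator {a..<a + s} x * f x = 0"
      unfolding window_def using assms
      by (subst (asm) integral_nonneg_eq_0_iff_AE) (auto simp: locally_intD less_imp_le)
    then have "AE x in lborel. x \<notin> {a..<a + s}"
    proof eventually_elim
      case (elim x)
      then show ?case using assms(2)[of x] by (auto simp: indicator_def)
    qed
    then have "emeasure lborel {a..<a + s} = 0"
      by (subst (asm) AE_iff_measurable[where N = "{a..<a + s}"]) auto
    then show False using assms(3) by simp
  qed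
  ultimately show ?thesis by simp
qed

lemma tsum_grid:
  assumes "locally_int f" "0 \<le> s"
  shows "tsum (\<lambda>a. window f a s) (grid s k a) = window f a (s * 3 ^ k)"
proof (induction k arbitrary: a)
  case (Suc k)
  define d where "d = s * 3 ^ k"
  have d: "0 \<le> d" using assms by (simp add: d_def)
  have "window f a (d + (d + d)) = window f a d + (window f (a + d) d + window f (a + d + d) d)"
    using window_split[OF assms(1) d add_nonneg_nonneg[OF d d], of a] window_split[OF assms(1) d d, of "a + d"] by simp
  moreover have "s * 3 ^ Suc k = d + (d + d)" "a + 2 * d = a + d + d" by (simp_all add: d_def)
  ultimately show ?case using Suc.IH by (simp only: grid.simps tsum.simps d_def[symmetric] add.assoc)
qed simp

lemma full_grid: "full k (grid s k a)"
  by (induction k arbitrary: a) auto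

lemma len_grid: "len s (grid s k a) = s * 3 ^ k"
  using len_full[OF full_grid] .

lemma subtrees_grid: "u \<in> subtrees (grid s k a) \<Longrightarrow> \<exists>j b. u = grid s j b"
proof (induction k arbitrary: a)
  case 0
  then show ?case by (auto intro: exI[of _ "0::nat"])
next
  case (Suc k)
  show ?case
  proof (cases "u = grid s (Suc k) a")
    case False
    then show ?thesis using Suc by auto
  qed blast
qed

lemma window_measurable [measurable]:
  assumes [measurable]: "f \<in> borel_measurable borel" "u \<in> borel_measurable M" "s \<in> borel_measurable M"
  shows "(\<lambda>z. window f (u z) (s z)) \<in> borel_measurable M"
proof -
  have "(\<lambda>z. LINT x|lborel. (if u z \<le> x \<and> x < u z + s z then f x else 0)) \<in> borel_measurable M"
    by measurable
  moreover have "window f (u z) (s z) = (LINT x|lborel. (if u z \<le> x \<and> x < u z + s z then f x else 0))" for z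
    unfolding window_def by (intro Bochner_Integration.integral_cong) (auto simp: indicator_def)
  ultimately show ?thesis by simp
qed

lemma nn_integral_shift:
  fixes f :: "real \<Rightarrow> ennreal"
  assumes "f \<in> borel_measurable borel"
  shows "(\<integral>\<^sup>+x. f (x + c) \<partial>lborel) = (\<integral>\<^sup>+x. f x \<partial>lborel)"
  using nn_integral_real_affine[OF assms, of 1 c] by (simp add: add.commute)

lemma nn_integral_exhaust:
  fixes f :: "'a \<Rightarrow> ennreal" and S :: "nat \<Rightarrow> 'a set"
  assumes [measurable]: "f \<in> borel_measurable M" "\<And>n. S n \<in> sets M"
    and S: "incseq S" "\<And>x. \<exists>n. x \<in> S n"
    and le: "\<And>n. (\<integral>\<^sup>+x. f x * indicator (S n) x \<partial>M) \<le> C"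
  shows "(\<integral>\<^sup>+x. f x \<partial>M) \<le> C"
proof -
  have "(\<integral>\<^sup>+x. f x \<partial>M) = (\<integral>\<^sup>+x. (SUP n. f x * indicator (S n) x) \<partial>M)"
  proof (intro nn_integral_cong antisym)
    fix x
    obtain n where "x \<in> S n" using S(2) by blast
    then have "f x \<le> f x * indicator (S n) x" by simp
    then show "f x \<le> (SUP n. f x * indicator (S n) x)" by (rule SUP_upper2[OF UNIV_I])
    show "(SUP n. f x * indicator (S n) x) \<le> f x"
      by (intro SUP_least) (auto simp: indicator_def)
  qed
  also have "\<dots> = (SUP n. \<integral>\<^sup>+x. f x * indicator (S n) x \<partial>M)"
    using incseq_SucD[OF S(1)]
    by (intro nn_integral_monotone_convergence_SUP incseq_SucI le_funI mult_left_mono) (auto simp: indicator_def)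
  also have "\<dots> \<le> C" using le by (rule SUP_least)
  finally show ?thesis .
qed

lemma exhaust_line: "incseq (\<lambda>n. {- real n..<real n})" "\<exists>n. x \<in> {- real n..<real n}"
proof -
  show "incseq (\<lambda>n. {- real n..<real n})" by (intro incseq_SucI) auto
  obtain n where "\<bar>x\<bar> < real n" using reals_Archimedean2 by blast
  then show "\<exists>n. x \<in> {- real n..<real n}" by (intro exI[of _ n]) auto
qed

text \<open>Tonelli's theorem: a point \<open>x\<close> lies in exactly those windows that start in
  \<open>{x - s<..x}\<close>.\<close>

lemma nn_integral_window:
  assumes f: "integrable lborel f" "\<And>x. 0 \<le> f x" and s: "0 \<le> s"
  shows "(\<integral>\<^sup>+a. ennreal (window f a s) \<partial>lborel) = ennreal (s * (LINT x|lborel. f x))"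
proof -
  have [measurable]: "f \<in> borel_measurable borel" using f(1) by simp
  have "(\<integral>\<^sup>+a. ennreal (window f a s) \<partial>lborel)
      = (\<integral>\<^sup>+a. (\<integral>\<^sup>+x. (if a \<le> x \<and> x < a + s then ennreal (f x) else 0) \<partial>lborel) \<partial>lborel)"
  proof (intro nn_integral_cong)
    fix a
    have "ennreal (window f a s) = (\<integral>\<^sup>+x. ennreal (indicator {a..<a + s} x * f x) \<partial>lborel)"
      unfolding window_def using f integrable_locally_int[OF f(1)]
      by (intro nn_integral_eq_integral[symmetric]) (auto simp: locally_intD)
    also have "\<dots> = (\<integral>\<^sup>+x. (if a \<le> x \<and> x < a + s then ennreal (f x) else 0) \<partial>lborel)"
      by (intro nn_integral_cong) (auto simp: indicator_def)
    finally show "ennreal (window f a s) = \<dots>" .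
  qed
  also have "\<dots> = (\<integral>\<^sup>+x. (\<integral>\<^sup>+a. (if a \<le> x \<and> x < a + s then ennreal (f x) else 0) \<partial>lborel) \<partial>lborel)"
    by (rule lborel_pair.Fubini') measurable
  also have "\<dots> = (\<integral>\<^sup>+x. ennreal s * ennreal (f x) \<partial>lborel)"
  proof (intro nn_integral_cong)
    fix x
    have "(\<integral>\<^sup>+a. (if a \<le> x \<and> x < a + s then ennreal (f x) else 0) \<partial>lborel)
        = (\<integral>\<^sup>+a. ennreal (f x) * indicator {x - s<..x} a \<partial>lborel)"
      by (intro nn_integral_cong) (auto simp: indicator_def)
    also have "\<dots> = ennreal (f x) * ennreal s"
      using s by (simp add: nn_integral_cmult_indicator)
    finally show "(\<integral>\<^sup>+a. (if a \<le> x \<and> x < a + s then ennreal (f x) else 0) \<partial>lborel) = ennreal s * ennreal (f x)"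
      by (simp add: mult.commute)
  qed
  also have "\<dots> = ennreal s * (\<integral>\<^sup>+x. ennreal (f x) \<partial>lborel)" by (intro nn_integral_cmult) measurable
  also have "\<dots> = ennreal (s * (LINT x|lborel. f x))"
    using f s by (simp add: nn_integral_eq_integral ennreal_mult)
  finally show ?thesis .
qed

text \<open>A Young inequality that is linear in \<open>v\<close> and in
  \<open>x powr p * w\<close>: it survives integration over any set, and \<open>\<theta>\<close> may
  be chosen afterwards. Either \<open>\<theta> * v\<close> alone suffices, or
  \<open>x > \<theta> * v\<close> and the decreasing power \<open>1 - p\<close> gives the second
  term.\<close>

lemma tangent_bound:
  fixes p x v w \<theta> :: real
  assumes p: "1 < p" and x: "0 \<le> x" and v: "0 < v" and w: "w = v powr (1 - p)" and \<theta>: "0 < \<theta>"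
  shows "x \<le> \<theta> * v + \<theta> powr (1 - p) * (x powr p * w)"
proof (cases "x \<le> \<theta> * v")
  case True
  have "0 \<le> \<theta> powr (1 - p) * (x powr p * w)" by (simp add: w)
  then show ?thesis using True by linarith
next
  case False
  have \<theta>v: "0 < \<theta> * v" using v \<theta> by simp
  then have x0: "0 < x" using False by linarith
  have "x = x powr p * x powr (1 - p)" using x0 by (simp add: powr_add[symmetric])
  also have "\<dots> \<le> x powr p * (\<theta> * v) powr (1 - p)"
    using False \<theta>v p by (intro mult_left_mono powr_mono2') auto
  also have "\<dots> = \<theta> powr (1 - p) * (x powr p * w)"
    using v \<theta> by (simp add: powr_mult w)
  finally show ?thesis using \<theta>v by linarith
qed

lemma window_tangent:
  assumes p: "1 < p" and loc: "locally_int f" "locally_int (\<lambda>x. f x powr p * w x)" "locally_int v"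
    and f: "\<And>x. 0 \<le> f x" and v: "\<And>x. 0 < v x" and w: "\<And>x. w x = v x powr (1 - p)" and "0 < \<theta>"
  shows "window f a s \<le> \<theta> * window v a s + \<theta> powr (1 - p) * window (\<lambda>x. f x powr p * w x) a s"
proof -
  have "f x \<le> \<theta> * v x + \<theta> powr (1 - p) * (f x powr p * w x)" for x
    using p f v w \<open>0 < \<theta>\<close> by (rule tangent_bound)
  then have "window f a s \<le> window (\<lambda>x. \<theta> * v x + \<theta> powr (1 - p) * (f x powr p * w x)) a s"
    using loc by (intro window_mono locally_int_add locally_int_cmult)
  then show ?thesis using loc by (simp add: window_add window_cmult locally_int_cmult)
qed

text \<open>Taking for \<open>\<theta>\<close> half the ratio of the integrals of \<open>f\<close>
  and \<open>v\<close> absorbs half of the left-hand side. The result is Hoelder's inequality up to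
  the factor \<open>2 powr p\<close>.\<close>

lemma window_holder:
  assumes p: "1 < p" and loc: "locally_int f" "locally_int (\<lambda>x. f x powr p * w x)" "locally_int v"
    and f: "\<And>x. 0 \<le> f x" and v: "\<And>x. 0 < v x" and w: "\<And>x. w x = v x powr (1 - p)" and s: "0 < s"
  shows "window v a s * (window f a s / window v a s) powr p \<le> 2 powr p * window (\<lambda>x. f x powr p * w x) a s"
proof -
  let ?N = "window (\<lambda>x. f x powr p * w x) a s"
  define F where "F = window f a s"
  define V where "V = window v a s"
  have V: "0 < V" unfolding V_def using loc(3) v s by (rule window_pos)
  have F: "0 \<le> F" unfolding F_def using f by (rule window_nonneg)
  show ?thesis
  proof (cases "F = 0")
    case True
    have "0 \<le> ?N" by (rule window_nonneg) (simp add: w)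
    then show ?thesis using True p by (simp add: F_def)
  next
    case False
    then have F: "0 < F" using F by simp
    define \<theta> where "\<theta> = F / (2 * V)"
    have \<theta>: "0 < \<theta>" using F V by (simp add: \<theta>_def)
    have "F \<le> \<theta> * V + \<theta> powr (1 - p) * ?N"
      unfolding F_def V_def by (rule window_tangent[OF p loc f v w \<theta>])
    then have "F / 2 \<le> \<theta> powr (1 - p) * ?N" using V by (simp add: \<theta>_def)
    then have "\<theta> powr (p - 1) * (F / 2) \<le> \<theta> powr (p - 1) * (\<theta> powr (1 - p) * ?N)"
      by (intro mult_left_mono) auto
    also have "\<dots> = ?N" using \<theta> by (simp add: mult.assoc[symmetric] powr_add[symmetric])
    also have "\<theta> powr (p - 1) * (F / 2) = V * (F / V) powr p / 2 powr p"
      unfolding \<theta>_def using F V by (simp add: powr_divide powr_mult powr_diff mult_ac)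
    finally show ?thesis by (simp add: F_def V_def pos_divide_le_eq mult.commute)
  qed
qed

text \<open>Here \<open>w\<close> is a Borel representative, positive at every point, so no null
  sets are carried along. Local integrability is assumed of \<open>w\<close> alone: for the dual
  weight \<open>v\<close>, the power \<open>- 1 / (p - 1)\<close> of \<open>w\<close>, it is derived
  from the A_{p,1} condition in one direction and from boundedness of the operator in the
  other.\<close>

locale dual_weights =
  fixes p q :: real and w v :: "real \<Rightarrow> real"
  assumes pq: "1 < p" "1 / p + 1 / q = 1"
    and w_meas [measurable]: "w \<in> borel_measurable borel"
    and w_pos: "\<And>x. 0 < w x"
    and v_eq: "\<And>x. v x = w x powr (1 - q)"
    and w_loc: "locally_int w"
begin

lemma v_meas [measurable]: "v \<in> borel_measurable borel"
  unfolding v_eq[abs_def] by measurable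

lemma q: "1 < q" "1 / q + 1 / p = 1"
  using conj_exp(1)[OF pq] pq by auto

lemma v_pos: "0 < v x"
  using w_pos[of x] by (simp add: v_eq)

lemma w_eq: "w x = v x powr (1 - p)"
proof -
  have "(1 - q) * (1 - p) = 1" using conj_exp(4)[OF pq] by (simp add: algebra_simps)
  then show ?thesis using w_pos[of x] by (simp add: v_eq powr_powr)
qed

end

locale large_scale_Ap = dual_weights p q w v
  for p q A :: real and w v :: "real \<Rightarrow> real" +
  assumes v_loc: "locally_int v"
    and Ap: "\<And>a s. 1 \<le> s \<Longrightarrow> window w a s * window v a s powr (p - 1) \<le> A * s powr p"
begin

lemmas loc = w_loc v_loc

lemma A_pos: "0 < A"
proof -
  have "0 < window w 0 1" "0 < window v 0 1" using loc w_pos v_pos by (auto intro: window_pos)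
  then have "0 < window w 0 1 * window v 0 1 powr (p - 1)" by simp
  then show ?thesis using Ap[of 1 0] by simp
qed

definition haar_const :: real where
  "haar_const = tree_const p q A * (q / p * 2 powr p + p / q * 2 powr q) * (2 powr p + 2 powr q)"

lemma haar_const_nonneg: "0 \<le> haar_const"
  unfolding haar_const_def tree_const_def using A_pos pq q by simp

text \<open>The 12 is twice the window length 6 used near the diagonal.\<close>

definition near_const :: real where
  "near_const = 12 * (A powr (1 / p) * (2 powr p + 2 powr q))"

lemma near_const_nonneg: "0 \<le> near_const"
  by (simp add: near_const_def)

text \<open>The 36 is 2 * 9 * 2: two modulated Haar forms, each multiplied by 9 and bounded with a
  factor 2. The 10 bounds the kernel that is left near the diagonal.\<close>

definition sinc_const :: real where
  "sinc_const = 36 * haar_const + 10 * near_const"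

lemma sinc_const_nonneg: "0 \<le> sinc_const"
  unfolding sinc_const_def using haar_const_nonneg near_const_nonneg by simp

end

text \<open>Integrability of \<open>f\<close> and \<open>g\<close> makes the double integrals below
  converge absolutely. It is secured by truncation, and the truncation is removed in the
  end.\<close>

locale Ap_pair = large_scale_Ap +
  fixes f g :: "real \<Rightarrow> real"
  assumes f_int: "integrable lborel f" and g_int: "integrable lborel g"
    and fp_int: "integrable lborel (\<lambda>x. \<bar>f x\<bar> powr p * w x)"
    and gq_int: "integrable lborel (\<lambda>x. \<bar>g x\<bar> powr q * v x)"
begin

lemma fg_meas [measurable]: "f \<in> borel_measurable borel" "g \<in> borel_measurable borel"
  using f_int g_int by auto

definition energy :: "real \<Rightarrow> real" where
  "energy x = \<bar>f x\<bar> powr p * w x + \<bar>g x\<bar> powr q * v x"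

definition total_energy :: real where
  "total_energy = (LINT x|lborel. energy x)"

lemma energy_int: "integrable lborel energy"
  unfolding energy_def using fp_int gq_int by simp

lemma energy_nonneg: "0 \<le> energy x"
  unfolding energy_def using w_pos[of x] v_pos[of x] by simp

lemma total_energy_nonneg: "0 \<le> total_energy"
  unfolding total_energy_def using energy_nonneg by simp

lemma total_energy_eq: "total_energy = (LINT x|lborel. \<bar>f x\<bar> powr p * w x) + (LINT x|lborel. \<bar>g x\<bar> powr q * v x)"
  unfolding total_energy_def energy_def using fp_int gq_int by simp

lemma locs:
  "locally_int f" "locally_int g" "locally_int (\<lambda>x. \<bar>f x\<bar>)" "locally_int (\<lambda>x. \<bar>g x\<bar>)"
  "locally_int (\<lambda>x. \<bar>f x\<bar> powr p * w x)" "locally_int (\<lambda>x. \<bar>g x\<bar> powr q * v x)" "locally_int energy"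
  using f_int g_int fp_int gq_int energy_int by (auto intro!: integrable_locally_int)

lemma window_energy:
  assumes s: "0 < s"
  shows "window v a s * (window (\<lambda>x. \<bar>f x\<bar>) a s / window v a s) powr p
    + window w a s * (window (\<lambda>x. \<bar>g x\<bar>) a s / window w a s) powr q \<le> (2 powr p + 2 powr q) * window energy a s"
proof -
  let ?f = "window (\<lambda>x. \<bar>f x\<bar> powr p * w x) a s" and ?g = "window (\<lambda>x. \<bar>g x\<bar> powr q * v x) a s"
  have "window v a s * (window (\<lambda>x. \<bar>f x\<bar>) a s / window v a s) powr p \<le> 2 powr p * ?f"
    by (rule window_holder[OF pq(1) locs(3,5) loc(2) abs_ge_zero v_pos w_eq s])
  moreover have "window w a s * (window (\<lambda>x. \<bar>g x\<bar>) a s / window w a s) powr q \<le> 2 powr q * ?g"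
    by (rule window_holder[OF q(1) locs(4,6) loc(1) abs_ge_zero w_pos v_eq s])
  moreover have "window energy a s = ?f + ?g"
    unfolding energy_def using locs by (intro window_add)
  moreover have "0 \<le> ?f" "0 \<le> ?g"
    using w_pos v_pos by (auto intro!: window_nonneg mult_nonneg_nonneg simp: less_imp_le)
  then have "0 \<le> 2 powr q * ?f" "0 \<le> 2 powr p * ?g" by auto
  ultimately show ?thesis by (simp add: algebra_simps)
qed

lemma haar_form_grid:
  assumes s: "1 \<le> s"
  shows "haar_form s (\<lambda>a. window f a s) (\<lambda>a. window g a s) (grid s k a) \<le> haar_const * window energy a (s * 3 ^ k)"
proof -
  let ?t = "grid s k a"
  have s0: "0 < s" using s by simp
  \<comment> \<open>The tangent inequality for the constant function 1, whose integral over a cell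
    is the length.\<close>
  have leaf: "s \<le> \<theta> * window v b s + \<theta> powr (1 - p) * window w b s" if "0 < \<theta>" for b \<theta>
    using window_tangent[OF pq(1) locally_int_const[of 1] _ loc(2) _ v_pos w_eq that, of b s] loc(1) s0
    by (simp add: window_const)
  have Ap': "tsum (\<lambda>a. window w a s) u * tsum (\<lambda>a. window v a s) u powr (p - 1) \<le> A * len s u powr p"
    if sub: "u \<in> subtrees ?t" for u
  proof -
    obtain j b where u: "u = grid s j b" using subtrees_grid[OF sub] by blast
    \<comment> \<open>Every cell of the grid has length at least \<open>s \<ge> 1\<close>, so the
      large-scale condition applies to all subtrees.\<close>
    have "1 * 1 \<le> s * 3 ^ j" using s by (intro mult_mono) auto
    then show ?thesis unfolding u using loc s0 Ap[of "s * 3 ^ j" b] by (simp add: tsum_grid len_grid)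
  qed
  have "haar_form s (\<lambda>a. window f a s) (\<lambda>a. window g a s) ?t
    \<le> tree_const p q A * (q / p * 2 powr p + p / q * 2 powr q) *
    (tsum (\<lambda>i. window v i s * (window (\<lambda>x. \<bar>f x\<bar>) i s / window v i s) powr p) ?t
     + tsum (\<lambda>i. window w i s * (window (\<lambda>x. \<bar>g x\<bar>) i s / window w i s) powr q) ?t)"
    using loc w_pos v_pos s0
    by (intro haar_form_bound[OF pq s0 window_abs window_abs _ _ leaf Ap' full_grid] window_pos) auto
  also have "\<dots> \<le> tree_const p q A * (q / p * 2 powr p + p / q * 2 powr q) *
    ((2 powr p + 2 powr q) * window energy a (s * 3 ^ k))"
  proof (intro mult_left_mono)
    have "tsum (\<lambda>i. window v i s * (window (\<lambda>x. \<bar>f x\<bar>) i s / window v i s) powr p) ?t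
     + tsum (\<lambda>i. window w i s * (window (\<lambda>x. \<bar>g x\<bar>) i s / window w i s) powr q) ?t
      \<le> tsum (\<lambda>i. (2 powr p + 2 powr q) * window energy i s) ?t"
      unfolding tsum_add[symmetric] using window_energy[OF s0] by (rule tsum_mono)
    then show "tsum (\<lambda>i. window v i s * (window (\<lambda>x. \<bar>f x\<bar>) i s / window v i s) powr p) ?t
     + tsum (\<lambda>i. window w i s * (window (\<lambda>x. \<bar>g x\<bar>) i s / window w i s) powr q) ?t
      \<le> (2 powr p + 2 powr q) * window energy a (s * 3 ^ k)"
      using locs s0 by (simp add: tsum_cmult tsum_grid)
    show "0 \<le> tree_const p q A * (q / p * 2 powr p + p / q * 2 powr q)"
      unfolding tree_const_def using A_pos pq q by simp
  qed
  finally show ?thesis by (simp add: haar_const_def mult.assoc)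
qed

section \<open>Haar coefficients integrated over all positions and scales\<close>

definition fhaar :: "real \<Rightarrow> real \<Rightarrow> real" where
  "fhaar s b = window f (b + 2 * (s / 3)) (s / 3) - window f b (s / 3)"

definition ghaar :: "real \<Rightarrow> real \<Rightarrow> real" where
  "ghaar s b = window g b (s / 3) + window g (b + 2 * (s / 3)) (s / 3) - 2 * window g (b + s / 3) (s / 3)"

definition scale_form :: "real \<Rightarrow> ennreal" where
  "scale_form s = (\<integral>\<^sup>+b. ennreal \<bar>fhaar s b * ghaar s b\<bar> \<partial>lborel)"

lemma haar_measurable [measurable]:
  assumes [measurable]: "s \<in> borel_measurable M" "b \<in> borel_measurable M"
  shows "(\<lambda>z. fhaar (s z) (b z)) \<in> borel_measurable M" "(\<lambda>z. ghaar (s z) (b z)) \<in> borel_measurable M"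
  unfolding fhaar_def ghaar_def by measurable

lemma scale_form_measurable [measurable]: "scale_form \<in> borel_measurable borel"
  unfolding scale_form_def[abs_def] by measurable

text \<open>Letting the root range over the whole line averages over all translated grids without any
  periodisation; each scale then contributes through its number of cells only.\<close>

lemma nn_integral_haar_form_grid:
  assumes s: "1 \<le> s"
  defines "H \<equiv> \<lambda>k a. haar_form s (\<lambda>a. window f a s) (\<lambda>a. window g a s) (grid s k a)"
  shows "H k \<in> borel_measurable borel" "\<And>a. 0 \<le> H k a"
    "(\<integral>\<^sup>+a. ennreal (H k a) \<partial>lborel)
      = ennreal (s * 3 ^ k) * (\<Sum>j=1..k. ennreal (1 / (s * 3 ^ j)\<^sup>2) * scale_form (s * 3 ^ j))"
proof (induction k)
  case 0
  show "H 0 \<in> borel_measurable borel" "\<And>a. 0 \<le> H 0 a" by (simp_all add: H_def)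
  show "(\<integral>\<^sup>+a. ennreal (H 0 a) \<partial>lborel)
      = ennreal (s * 3 ^ 0) * (\<Sum>j=1..0. ennreal (1 / (s * 3 ^ j)\<^sup>2) * scale_form (s * 3 ^ j))"
    by (simp add: H_def)
next
  case (Suc k)
  let ?d = "s * 3 ^ k" and ?S = "s * 3 ^ Suc k"
  have S: "0 < ?S" "0 \<le> s" using s by auto
  note [measurable] = Suc.IH(1)
  have eq: "H (Suc k) a = 1 / ?S * \<bar>fhaar ?S a * ghaar ?S a\<bar> + (H k a + H k (a + ?d) + H k (a + 2 * ?d))" for a
  proof -
    have "?S / 3 = ?d" by simp
    moreover have "len s (grid s (Suc k) a) = ?S" by (rule len_grid)
    ultimately show ?thesis
      using locs S(2) by (simp only: H_def grid.simps haar_form.simps fhaar_def ghaar_def tsum_grid abs_mult) simp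
  qed
  show "H (Suc k) \<in> borel_measurable borel" unfolding eq[abs_def] by measurable
  show nn: "\<And>a. 0 \<le> H (Suc k) a" unfolding eq using Suc.IH(2) S by (intro add_nonneg_nonneg) auto
  have "(\<integral>\<^sup>+a. ennreal (H (Suc k) a) \<partial>lborel)
      = (\<integral>\<^sup>+a. ennreal (1 / ?S) * ennreal \<bar>fhaar ?S a * ghaar ?S a\<bar>
          + (ennreal (H k a) + ennreal (H k (a + ?d)) + ennreal (H k (a + 2 * ?d))) \<partial>lborel)"
    unfolding eq using Suc.IH(2) S
    by (intro nn_integral_cong) (simp add: ennreal_plus[symmetric] ennreal_mult[symmetric] del: ennreal_plus)
  also have "\<dots> = ennreal (1 / ?S) * scale_form ?S
      + ((\<integral>\<^sup>+a. ennreal (H k a) \<partial>lborel) + (\<integral>\<^sup>+a. ennreal (H k (a + ?d)) \<partial>lborel)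
        + (\<integral>\<^sup>+a. ennreal (H k (a + 2 * ?d)) \<partial>lborel))"
    unfolding scale_form_def by (simp add: nn_integral_add nn_integral_cmult)
  also have "\<dots> = ennreal (1 / ?S) * scale_form ?S + 3 * (\<integral>\<^sup>+a. ennreal (H k a) \<partial>lborel)"
  proof -
    have "x + x + x = 3 * x" for x :: ennreal
      by (metis (no_types, lifting) distrib_right mult_1 numeral_Bit1 one_add_one numeral_One)
    then show ?thesis
      using nn_integral_shift[of "\<lambda>a. ennreal (H k a)" ?d] nn_integral_shift[of "\<lambda>a. ennreal (H k a)" "2 * ?d"]
      by simp
  qed
  also have "\<dots> = ennreal ?S * (ennreal (1 / ?S\<^sup>2) * scale_form ?S)
      + ennreal ?S * (\<Sum>j=1..k. ennreal (1 / (s * 3 ^ j)\<^sup>2) * scale_form (s * 3 ^ j))"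
  proof -
    have "ennreal (1 / ?S) = ennreal ?S * ennreal (1 / ?S\<^sup>2)"
      using S by (subst ennreal_mult[symmetric]) (auto simp: power2_eq_square)
    moreover have "3 * ennreal ?d = ennreal ?S"
      using S by (subst ennreal_numeral[symmetric], subst ennreal_mult[symmetric]) (auto simp: mult_ac)
    ultimately show ?thesis unfolding Suc.IH(3) by (simp add: mult.assoc[symmetric])
  qed
  finally show "(\<integral>\<^sup>+a. ennreal (H (Suc k) a) \<partial>lborel)
      = ennreal ?S * (\<Sum>j=1..Suc k. ennreal (1 / (s * 3 ^ j)\<^sup>2) * scale_form (s * 3 ^ j))"
    by (simp add: distrib_left add.commute)
qed

text \<open>The integral of the Haar form over all roots and that of the energy windows both grow
  like the root length \<open>s * 3 ^ k\<close>. Dividing by it leaves a bound independent of the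
  number of generations.\<close>

lemma scale_form_sum:
  assumes s: "1 \<le> s"
  shows "(\<Sum>j=1..k. ennreal (1 / (s * 3 ^ j)\<^sup>2) * scale_form (s * 3 ^ j)) \<le> ennreal (haar_const * total_energy)"
proof -
  let ?d = "s * 3 ^ k"
  have d: "0 < ?d" using s by simp
  have "ennreal ?d * (\<Sum>j=1..k. ennreal (1 / (s * 3 ^ j)\<^sup>2) * scale_form (s * 3 ^ j))
     = (\<integral>\<^sup>+a. ennreal (haar_form s (\<lambda>a. window f a s) (\<lambda>a. window g a s) (grid s k a)) \<partial>lborel)"
    using nn_integral_haar_form_grid(3)[OF s] by simp
  also have "\<dots> \<le> (\<integral>\<^sup>+a. ennreal haar_const * ennreal (window energy a ?d) \<partial>lborel)"
    using haar_form_grid[OF s] haar_const_nonneg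
    by (intro nn_integral_mono) (auto simp: ennreal_mult[symmetric] window_nonneg energy_nonneg intro!: ennreal_leI)
  also have "\<dots> = ennreal haar_const * ennreal (?d * total_energy)"
    using energy_int energy_nonneg d
    by (subst nn_integral_cmult) (auto simp: nn_integral_window total_energy_def)
  also have "\<dots> = ennreal ?d * ennreal (haar_const * total_energy)"
    using haar_const_nonneg total_energy_nonneg d s by (subst (1 2) ennreal_mult[symmetric]) (auto simp: mult_ac)
  finally show ?thesis using d by (subst (asm) ennreal_mult_le_mult_iff) auto
qed

text \<open>The dilates of \<open>{1..<3}\<close> by \<open>3 ^ j\<close>, \<open>j \<ge> 1\<close>,
  tile the scales from 3 on, and \<open>s \<in> {1..<3}\<close> serves as atom length. Integrating
  the bound for fixed \<open>s\<close> over this set produces the factor 2.\<close>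

lemma scale_form_integral_upto:
  "(\<integral>\<^sup>+s. indicator {3..<3 * 3 ^ k} s * (ennreal (1 / s ^ 3) * scale_form s) \<partial>lborel) \<le> ennreal (2 * (haar_const * total_energy))"
proof -
  let ?h = "\<lambda>s. ennreal (1 / s ^ 3) * scale_form s"
  have step: "(\<integral>\<^sup>+s. indicator {3 ^ j..<3 * 3 ^ j} s * ?h s \<partial>lborel)
     \<le> (\<integral>\<^sup>+s. indicator {1..<3} s * (ennreal (1 / (s * 3 ^ j)\<^sup>2) * scale_form (s * 3 ^ j)) \<partial>lborel)" for j :: nat
  proof -
    have c: "(0::real) < 3 ^ j" by simp
    have "(\<integral>\<^sup>+s. indicator {3 ^ j..<3 * 3 ^ j} s * ?h s \<partial>lborel)
      = ennreal (3 ^ j) * (\<integral>\<^sup>+s. indicator {3 ^ j..<3 * 3 ^ j} (3 ^ j * s) * ?h (3 ^ j * s) \<partial>lborel)"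
      using c by (subst nn_integral_real_affine[where c = "3 ^ j" and t = 0]) auto
    also have "\<dots> = (\<integral>\<^sup>+s. ennreal (3 ^ j) * (indicator {3 ^ j..<3 * 3 ^ j} (3 ^ j * s) * ?h (3 ^ j * s)) \<partial>lborel)"
      by (intro nn_integral_cmult[symmetric]) measurable
    also have "\<dots> \<le> (\<integral>\<^sup>+s. indicator {1..<3} s * (ennreal (1 / (s * 3 ^ j)\<^sup>2) * scale_form (s * 3 ^ j)) \<partial>lborel)"
    proof (intro nn_integral_mono)
      fix s :: real
      show "ennreal (3 ^ j) * (indicator {3 ^ j..<3 * 3 ^ j} (3 ^ j * s) * ?h (3 ^ j * s))
        \<le> indicator {1..<3} s * (ennreal (1 / (s * 3 ^ j)\<^sup>2) * scale_form (s * 3 ^ j))"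
      proof (cases "s \<in> {1..<3}")
        case True
        \<comment> \<open>The Jacobian \<open>3 ^ j\<close> turns the inverse cube of the scale into
          the inverse square times \<open>1 / s\<close>, and \<open>1 / s \<le> 1\<close> is given
          away.\<close>
        have "3 ^ j * (1 / (3 ^ j * s) ^ 3) = 1 / (s * 3 ^ j)\<^sup>2 / s"
          using True c by (simp add: power2_eq_square power3_eq_cube)
        also have "\<dots> \<le> 1 / (s * 3 ^ j)\<^sup>2 / 1" using True by (intro divide_left_mono) auto
        finally have "ennreal (3 ^ j) * ennreal (1 / (3 ^ j * s) ^ 3) \<le> ennreal (1 / (s * 3 ^ j)\<^sup>2)"
          using True c by (subst ennreal_mult[symmetric]) (auto intro!: ennreal_leI)
        then have "ennreal (3 ^ j) * ennreal (1 / (3 ^ j * s) ^ 3) * scale_form (s * 3 ^ j) \<le> ennreal (1 / (s * 3 ^ j)\<^sup>2) * scale_form (s * 3 ^ j)"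
          by (intro mult_right_mono) auto
        then show ?thesis using True by (simp add: mult.assoc mult.commute[of s])
      next
        case False
        then have "3 ^ j * s \<notin> {3 ^ j..<3 * 3 ^ j}" using c by (auto simp: mult.commute[of 3])
        then show ?thesis by simp
      qed
    qed
    finally show ?thesis .
  qed
  have "(\<integral>\<^sup>+s. indicator {3..<3 * 3 ^ k} s * ?h s \<partial>lborel) = (\<Sum>j=1..k. \<integral>\<^sup>+s. indicator {3 ^ j..<3 * 3 ^ j} s * ?h s \<partial>lborel)"
  proof (induction k)
    case (Suc k)
    have "(3::real) \<le> 3 * 3 ^ k" by simp
    have "(\<integral>\<^sup>+s. indicator {3..<3 * 3 ^ Suc k} s * ?h s \<partial>lborel)
      = (\<integral>\<^sup>+s. indicator {3..<3 * 3 ^ k} s * ?h s + indicator {3 ^ Suc k..<3 * 3 ^ Suc k} s * ?h s \<partial>lborel)"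
    proof (intro nn_integral_cong)
      fix s :: real
      have "(3::real) ^ k \<ge> 1" by simp
      then have "3 \<le> s" if "3 * 3 ^ k \<le> s" using that by linarith
      moreover have "s < 3 * 3 ^ Suc k" if "s < 3 * 3 ^ k" 
        using that \<open>(3::real) ^ k \<ge> 1\<close> unfolding power_Suc by linarith
      ultimately show "indicator {3..<3 * 3 ^ Suc k} s * ?h s = indicator {3..<3 * 3 ^ k} s * ?h s + indicator {3 ^ Suc k..<3 * 3 ^ Suc k} s * ?h s"
        by (cases "s < 3"; cases "s < 3 * 3 ^ k"; cases "s < 3 * 3 ^ Suc k") (auto simp: indicator_def)
    qed
    also have "\<dots> = (\<integral>\<^sup>+s. indicator {3..<3 * 3 ^ k} s * ?h s \<partial>lborel) + (\<integral>\<^sup>+s. indicator {3 ^ Suc k..<3 * 3 ^ Suc k} s * ?h s \<partial>lborel)"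
      by (intro nn_integral_add) measurable
    finally show ?case using Suc by simp
  qed simp
  also have "\<dots> \<le> (\<Sum>j=1..k. \<integral>\<^sup>+s. indicator {1..<3} s * (ennreal (1 / (s * 3 ^ j)\<^sup>2) * scale_form (s * 3 ^ j)) \<partial>lborel)"
    by (intro sum_mono step)
  also have "\<dots> = (\<integral>\<^sup>+s. (\<Sum>j=1..k. indicator {1..<3} s * (ennreal (1 / (s * 3 ^ j)\<^sup>2) * scale_form (s * 3 ^ j))) \<partial>lborel)"
    by (intro nn_integral_sum[symmetric]) measurable
  also have "\<dots> \<le> (\<integral>\<^sup>+s. ennreal (haar_const * total_energy) * indicator {1..<3::real} s \<partial>lborel)"
  proof (intro nn_integral_mono)
    fix s :: real
    show "(\<Sum>j=1..k. indicator {1..<3} s * (ennreal (1 / (s * 3 ^ j)\<^sup>2) * scale_form (s * 3 ^ j)))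
      \<le> ennreal (haar_const * total_energy) * indicator {1..<3::real} s"
      using scale_form_sum[of s k] by (auto simp: indicator_def)
  qed
  also have "\<dots> = ennreal (2 * (haar_const * total_energy))"
    using haar_const_nonneg total_energy_nonneg
    by (subst nn_integral_cmult_indicator) (auto simp: mult.commute ennreal_mult[symmetric] simp flip: ennreal_numeral)
  finally show ?thesis .
qed

lemma scale_form_integral:
  "(\<integral>\<^sup>+s. indicator {3..} s * (ennreal (1 / s ^ 3) * scale_form s) \<partial>lborel) \<le> ennreal (2 * (haar_const * total_energy))"
proof (rule nn_integral_exhaust[where S = "\<lambda>k. {..<3 * 3 ^ k}"])
  show "incseq (\<lambda>k. {..<3 * 3 ^ k :: real})"
    by (intro incseq_SucI lessThan_subset_iff[THEN iffD2]) simp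
  fix x :: real
  obtain k where "x < 3 ^ k" using real_arch_pow[of 3 x] by auto
  then show "\<exists>k. x \<in> {..<3 * 3 ^ k}" by (intro exI[of _ k]) (simp, smt (verit) zero_less_power)
next
  fix k
  have "indicator {3..} s * y * indicator {..<3 * 3 ^ k} s = indicator {3..<3 * 3 ^ k} s * y" for s :: real and y :: ennreal
    by (auto simp: indicator_def)
  then show "(\<integral>\<^sup>+s. indicator {3..} s * (ennreal (1 / s ^ 3) * scale_form s) * indicator {..<3 * 3 ^ k} s \<partial>lborel)
      \<le> ennreal (2 * (haar_const * total_energy))"
    using scale_form_integral_upto by simp
qed measurable

end

section \<open>The kernel of the averaged forms\<close>

definition haar :: "real \<Rightarrow> real \<Rightarrow> real" where
  "haar s t = indicator {2 * (s / 3)..<s} t - indicator {0..<s / 3} t"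

definition cohaar :: "real \<Rightarrow> real \<Rightarrow> real" where
  "cohaar s t = indicator {0..<s / 3} t + indicator {2 * (s / 3)..<s} t - 2 * indicator {s / 3..<2 * (s / 3)} t"

text \<open>The correlation of the patterns \<open>(-1, 0, 1)\<close> and \<open>(1, -2, 1)\<close>: it is odd with nonzero integral
  over the half-line, so averaging over all scales produces a nonzero multiple of \<open>1 / t\<close>.\<close>

definition haar_corr :: "real \<Rightarrow> real \<Rightarrow> real" where
  "haar_corr s t =
     (let T = (\<lambda>u. max 0 (s / 3 - \<bar>u\<bar>)) in
      T (t - 2 * (s / 3)) - 2 * T (t - s / 3) + 2 * T (t + s / 3) - T (t + 2 * (s / 3)))"

text \<open>The weight \<open>1 / s ^ 3\<close> makes the kernel homogeneous of degree -1 apart from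
  the cut-off. Scales start at 3 because the smallest cell that has a coefficient consists of three
  atoms of length at least 1.\<close>

definition haar_kernel :: "real \<Rightarrow> real" where
  "haar_kernel t = (LINT s|lborel. indicator {3..} s / s ^ 3 * haar_corr s t)"

abbreviation plane :: "(real \<times> real) measure" where
  "plane \<equiv> lborel \<Otimes>\<^sub>M lborel"

interpretation plane_pair: pair_sigma_finite plane plane
  unfolding lborel_prod ..

lemma integral_indicator_Int:
  assumes "0 \<le> d"
  shows "integrable lborel (\<lambda>b. indicator {x<..x + d} b * (indicator {y<..y + d} b :: real))"
    "(LINT b|lborel. indicator {x<..x + d} b * (indicator {y<..y + d} b :: real)) = max 0 (d - \<bar>x - y\<bar>)"
proof -
  have eq: "(\<lambda>b. indicator {x<..x + d} b * (indicator {y<..y + d} b :: real)) = indicator {max x y<..min x y + d}"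
    by (auto simp: fun_eq_iff indicator_def)
  have "emeasure lborel {max x y<..min x y + d} < \<infinity>"
    by (cases "max x y \<le> min x y + d") auto
  then show "integrable lborel (\<lambda>b. indicator {x<..x + d} b * (indicator {y<..y + d} b :: real))"
    unfolding eq by simp
  have "measure lborel {max x y<..min x y + d} = max 0 (d - \<bar>x - y\<bar>)"
    by (cases "max x y \<le> min x y + d") (auto simp: abs_real_def max_def min_def split: if_splits)
  then show "(LINT b|lborel. indicator {x<..x + d} b * (indicator {y<..y + d} b :: real)) = max 0 (d - \<bar>x - y\<bar>)"
    unfolding eq by simp
qed

lemma integral_haar_cohaar:
  assumes s: "0 < s"
  shows "(LINT b|lborel. haar s (x - b) * cohaar s (y - b)) = haar_corr s (x - y)"
proof -
  define d where "d = s / 3"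
  have d: "0 \<le> d" "s = 3 * d" using s by (auto simp: d_def)
  \<comment> \<open>As functions of the position \<open>b\<close> the cells become left-open:
    \<open>x - b \<in> {0..<d}\<close> means \<open>b \<in> {x - d<..x}\<close>.\<close>
  define J where "J = (\<lambda>x b. indicator {x<..x + d} b :: real)"
  have h: "haar s (x - b) = J (x - 3 * d) b - J (x - d) b" for b
    unfolding haar_def d(2) J_def by (auto simp: indicator_def)
  have g: "cohaar s (y - b) = J (y - d) b + J (y - 3 * d) b - 2 * J (y - 2 * d) b" for b
    unfolding cohaar_def d(2) J_def by (auto simp: indicator_def)
  have J: "integrable lborel (\<lambda>b. J x b * J y b)" "(LINT b|lborel. J x b * J y b) = max 0 (d - \<bar>x - y\<bar>)" for x y
    unfolding J_def using integral_indicator_Int[OF d(1)] by auto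
  have "(LINT b|lborel. haar s (x - b) * cohaar s (y - b))
    = (LINT b|lborel. J (x - 3 * d) b * J (y - d) b + J (x - 3 * d) b * J (y - 3 * d) b
        - 2 * (J (x - 3 * d) b * J (y - 2 * d) b)
        - (J (x - d) b * J (y - d) b + J (x - d) b * J (y - 3 * d) b
        - 2 * (J (x - d) b * J (y - 2 * d) b)))"
    unfolding h g by (intro Bochner_Integration.integral_cong) (auto simp: algebra_simps)
  also have "\<dots> = max 0 (d - \<bar>x - 3 * d - (y - d)\<bar>) + max 0 (d - \<bar>x - 3 * d - (y - 3 * d)\<bar>)
      - 2 * max 0 (d - \<bar>x - 3 * d - (y - 2 * d)\<bar>)
      - (max 0 (d - \<bar>x - d - (y - d)\<bar>) + max 0 (d - \<bar>x - d - (y - 3 * d)\<bar>)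
      - 2 * max 0 (d - \<bar>x - d - (y - 2 * d)\<bar>))"
    by (simp only: Bochner_Integration.integral_diff Bochner_Integration.integral_add integral_mult_right_zero
        Bochner_Integration.integrable_diff Bochner_Integration.integrable_add integrable_mult_right J)
  also have "\<dots> = haar_corr s (x - y)"
    unfolding haar_corr_def Let_def d_def[symmetric] by (simp add: algebra_simps)
  finally show ?thesis .
qed

text \<open>For fixed \<open>t > 0\<close> the correlation is piecewise linear in \<open>s\<close>
  with breaks at \<open>t\<close>, \<open>3 / 2 * t\<close> and \<open>3 * t\<close>. The
  coefficients are the jumps of its slope, which runs through 0, 1, -5/3 and 0.\<close>

lemma haar_corr_ramps:
  assumes "0 < s" "0 < t"
  shows "haar_corr s t = max 0 (s - t) - 8 / 3 * max 0 (s - 3 / 2 * t) + 5 / 3 * max 0 (s - 3 * t)"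
  using assms unfolding haar_corr_def Let_def
  by (auto simp: max_def abs_real_def field_simps split: if_splits)

lemma haar_corr_minus: "haar_corr s (- t) = - haar_corr s t"
proof -
  have "\<bar>- t - u\<bar> = \<bar>t + u\<bar>" "\<bar>- t + u\<bar> = \<bar>t - u\<bar>" for u by auto
  then show ?thesis unfolding haar_corr_def Let_def by simp
qed

lemma abs_haar_corr: "0 < s \<Longrightarrow> \<bar>haar_corr s t\<bar> \<le> 2 * s"
proof -
  assume s: "0 < s"
  define T where "T = (\<lambda>u. max 0 (s / 3 - \<bar>u\<bar>))"
  have "0 \<le> T u" "T u \<le> s / 3" for u using s by (auto simp: T_def max_def)
  from this[of "t - 2 * (s / 3)"] this[of "t - s / 3"] this[of "t + s / 3"] this[of "t + 2 * (s / 3)"]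
  have "\<bar>T (t - 2 * (s / 3)) - 2 * T (t - s / 3) + 2 * T (t + s / 3) - T (t + 2 * (s / 3))\<bar> \<le> 2 * s"
    by linarith
  then show ?thesis unfolding haar_corr_def Let_def T_def .
qed

lemma haar_corr_measurable [measurable]:
  assumes [measurable]: "s \<in> borel_measurable M" "t \<in> borel_measurable M"
  shows "(\<lambda>z. haar_corr (s z) (t z)) \<in> borel_measurable M"
  unfolding haar_corr_def Let_def by measurable

lemma haar_kernel_measurable [measurable]: "haar_kernel \<in> borel_measurable borel"
  unfolding haar_kernel_def[abs_def] by measurable

lemma nn_integral_inverse_square: "(\<integral>\<^sup>+s. ennreal (1 / s\<^sup>2) * indicator {3..} s \<partial>lborel) = ennreal (1 / 3)"
proof -
  have "(\<integral>\<^sup>+s. ennreal (1 / s\<^sup>2) * indicator {3..} s \<partial>lborel) = ennreal (0 - (- 1 / 3))"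
  proof (rule nn_integral_FTC_atLeast)
    show "DERIV (\<lambda>s. - 1 / s) x :> 1 / x\<^sup>2" if "3 \<le> x" for x :: real
      using that by (auto intro!: derivative_eq_intros simp: power2_eq_square)
    show "((\<lambda>s::real. - 1 / s) \<longlongrightarrow> 0) at_top"
      by (rule tendsto_divide_0[OF tendsto_const]) (simp add: filterlim_at_top_imp_at_infinity filterlim_ident)
  qed auto
  then show ?thesis by simp
qed

lemma abs_haar_kernel: "\<bar>haar_kernel t\<bar> \<le> 1"
proof -
  let ?f = "\<lambda>s. indicator {3..} s / s ^ 3 * haar_corr s t"
  have le: "ennreal (norm (?f s)) \<le> 2 * (ennreal (1 / s\<^sup>2) * indicator {3..} s)" for s
  proof (cases "3 \<le> s")
    case True
    have "norm (?f s) \<le> 1 / s ^ 3 * (2 * s)"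
      using True abs_haar_corr[of s t] by (auto simp: abs_mult intro!: mult_left_mono divide_right_mono)
    also have "\<dots> = 2 * (1 / s\<^sup>2)" using True by (simp add: power2_eq_square power3_eq_cube)
    finally have "ennreal (norm (?f s)) \<le> ennreal (2 * (1 / s\<^sup>2))" by (rule ennreal_leI)
    also have "\<dots> = 2 * ennreal (1 / s\<^sup>2)" by (subst ennreal_mult) auto
    finally show ?thesis using True by simp
  qed simp
  have "(\<integral>\<^sup>+s. ennreal (norm (?f s)) \<partial>lborel) \<le> (\<integral>\<^sup>+s. 2 * (ennreal (1 / s\<^sup>2) * indicator {3..} s) \<partial>lborel)"
    using le by (intro nn_integral_mono)
  also have "\<dots> = 2 * (\<integral>\<^sup>+s. ennreal (1 / s\<^sup>2) * indicator {3..} s \<partial>lborel)"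
    by (intro nn_integral_cmult) measurable
  also have "\<dots> = ennreal (2 * (1 / 3))"
    unfolding nn_integral_inverse_square by (subst ennreal_mult) auto
  finally have *: "(\<integral>\<^sup>+s. ennreal (norm (?f s)) \<partial>lborel) \<le> ennreal (2 / 3)" by simp
  also have "\<dots> < \<infinity>" by simp
  finally have int: "integrable lborel ?f" by (intro integrableI_bounded) auto
  have "ennreal (norm (haar_kernel t)) \<le> ennreal (2 / 3)"
    unfolding haar_kernel_def using integral_norm_bound_ennreal[OF int] * by (rule order_trans)
  then have "norm (haar_kernel t) \<le> 2 / 3" by (subst (asm) ennreal_le_iff) auto
  then show "\<bar>haar_kernel t\<bar> \<le> 1" by simp
qed

text \<open>A ramp that starts at \<open>c \<ge> 3\<close> does not see the cut-off at 3, hence the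
  pure multiple of \<open>1 / c\<close>. This is what restricts the exact formula for the kernel to
  distances of at least 3.\<close>

lemma integral_ramp:
  fixes c :: real
  assumes c: "3 \<le> c"
  shows "has_bochner_integral lborel (\<lambda>s. indicator {3..} s / s ^ 3 * max 0 (s - c)) (1 / (2 * c))"
proof -
  have nn: "(\<integral>\<^sup>+s. ennreal ((s - c) / s ^ 3) * indicator {c..} s \<partial>lborel) = ennreal (0 - (- 1 / c + c / (2 * c\<^sup>2)))"
  proof (rule nn_integral_FTC_atLeast[where F = "\<lambda>s. - 1 / s + c / (2 * s\<^sup>2)"])
    show "DERIV (\<lambda>s. - 1 / s + c / (2 * s\<^sup>2)) x :> (x - c) / x ^ 3" if "c \<le> x" for x :: real
      using that c by (auto intro!: derivative_eq_intros simp: power2_eq_square power3_eq_cube field_simps)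
    have "((\<lambda>s::real. - 1 / s) \<longlongrightarrow> 0) at_top"
      by (rule tendsto_divide_0[OF tendsto_const]) (simp add: filterlim_at_top_imp_at_infinity filterlim_ident)
    moreover have "((\<lambda>s::real. (c / 2) / s\<^sup>2) \<longlongrightarrow> 0) at_top"
      by (rule tendsto_divide_0[OF tendsto_const])
        (intro filterlim_at_top_imp_at_infinity filterlim_pow_at_top filterlim_ident, simp)
    ultimately have "((\<lambda>s::real. - 1 / s + (c / 2) / s\<^sup>2) \<longlongrightarrow> 0 + 0) at_top" by (rule tendsto_add)
    then show "((\<lambda>s::real. - 1 / s + c / (2 * s\<^sup>2)) \<longlongrightarrow> 0) at_top" by simp
    show "0 \<le> (x - c) / x ^ 3" if "c \<le> x" for x using that c by simp
  qed measurable
  have "(\<integral>\<^sup>+s. ennreal (indicator {3..} s / s ^ 3 * max 0 (s - c)) \<partial>lborel) = (\<integral>\<^sup>+s. ennreal ((s - c) / s ^ 3) * indicator {c..} s \<partial>lborel)"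
    using c by (intro nn_integral_cong) (auto simp: indicator_def max_def)
  also have "\<dots> = ennreal (1 / (2 * c))" unfolding nn using c by (simp add: power2_eq_square)
  finally show ?thesis
    using c by (intro has_bochner_integral_nn_integral) (auto simp: indicator_def)
qed

text \<open>Over the common denominator \<open>18 * t\<close> the three ramps contribute 9, -16 and
  5, which do not cancel.\<close>

lemma haar_kernel_pos: "3 \<le> t \<Longrightarrow> haar_kernel t = - 1 / (9 * t)"
proof -
  assume t: "3 \<le> t"
  have "has_bochner_integral lborel (\<lambda>s. indicator {3..} s / s ^ 3 * max 0 (s - t)
      - 8 / 3 * (indicator {3..} s / s ^ 3 * max 0 (s - 3 / 2 * t))
      + 5 / 3 * (indicator {3..} s / s ^ 3 * max 0 (s - 3 * t)))
    (1 / (2 * t) - 8 / 3 * (1 / (2 * (3 / 2 * t))) + 5 / 3 * (1 / (2 * (3 * t))))"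
    using t by (intro has_bochner_integral_add has_bochner_integral_diff has_bochner_integral_mult_right integral_ramp) auto
  then have "has_bochner_integral lborel (\<lambda>s. indicator {3..} s / s ^ 3 * haar_corr s t)
    (1 / (2 * t) - 8 / 3 * (1 / (2 * (3 / 2 * t))) + 5 / 3 * (1 / (2 * (3 * t))))"
    using t by (subst (asm) has_bochner_integral_cong[OF refl _ refl, where g = "\<lambda>s. indicator {3..} s / s ^ 3 * haar_corr s t"])
      (auto simp: indicator_def haar_corr_ramps add_divide_distrib diff_divide_distrib)
  then have "haar_kernel t = 1 / (2 * t) - 8 / 3 * (1 / (2 * (3 / 2 * t))) + 5 / 3 * (1 / (2 * (3 * t)))"
    unfolding haar_kernel_def by (rule has_bochner_integral_integral_eq)
  also have "\<dots> = - 1 / (9 * t)" using t by (simp add: field_simps)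
  finally show ?thesis .
qed

lemma haar_kernel_far: "3 \<le> \<bar>t\<bar> \<Longrightarrow> haar_kernel t = - 1 / (9 * t)"
proof (cases "0 \<le> t")
  case False
  assume "3 \<le> \<bar>t\<bar>"
  have "haar_kernel (- t) = - haar_kernel t"
    unfolding haar_kernel_def haar_corr_minus by simp
  then show ?thesis using haar_kernel_pos[of "- t"] False \<open>3 \<le> \<bar>t\<bar>\<close> by simp
qed (simp add: haar_kernel_pos)

lemma haar_cohaar_measurable [measurable]:
  assumes [measurable]: "s \<in> borel_measurable M" "t \<in> borel_measurable M"
  shows "(\<lambda>z. haar (s z) (t z)) \<in> borel_measurable M" "(\<lambda>z. cohaar (s z) (t z)) \<in> borel_measurable M"
proof -
  have "(\<lambda>z. (if 2 * (s z / 3) \<le> t z \<and> t z < s z then 1 else 0) - (if 0 \<le> t z \<and> t z < s z / 3 then 1 else 0) :: real) \<in> borel_measurable M"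
    by measurable
  then show "(\<lambda>z. haar (s z) (t z)) \<in> borel_measurable M"
    unfolding haar_def indicator_def of_bool_def by simp
  have "(\<lambda>z. (if 0 \<le> t z \<and> t z < s z / 3 then 1 else 0) + (if 2 * (s z / 3) \<le> t z \<and> t z < s z then 1 else 0)
      - 2 * (if s z / 3 \<le> t z \<and> t z < 2 * (s z / 3) then 1 else 0) :: real) \<in> borel_measurable M"
    by measurable
  then show "(\<lambda>z. cohaar (s z) (t z)) \<in> borel_measurable M"
    unfolding cohaar_def indicator_def of_bool_def by simp
qed

lemma abs_haar_cohaar: "0 < s \<Longrightarrow> \<bar>haar s (x - b) * cohaar s (y - b)\<bar> \<le> 2 * indicator {x - s<..x} b"
  unfolding haar_def cohaar_def by (auto simp: indicator_def)

text \<open>Here \<open>z\<close> is the pair of scale and position and \<open>u\<close> the pair of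
  space variables. With both as points of the plane, the exchange of four integrals is one use of
  Fubini's theorem.\<close>

definition haar_density :: "real \<times> real \<Rightarrow> real \<times> real \<Rightarrow> real" where
  "haar_density z u = indicator {3..} (fst z) / fst z ^ 3 * (haar (fst z) (fst u - snd z) * cohaar (fst z) (snd u - snd z))"

lemma haar_density_measurable [measurable]:
  assumes z: "z \<in> M \<rightarrow>\<^sub>M plane" and u: "u \<in> M \<rightarrow>\<^sub>M plane"
  shows "(\<lambda>y. haar_density (z y) (u y)) \<in> borel_measurable M"
proof -
  have [measurable]: "(\<lambda>y. fst (z y)) \<in> borel_measurable M" "(\<lambda>y. snd (z y)) \<in> borel_measurable M"
    "(\<lambda>y. fst (u y)) \<in> borel_measurable M" "(\<lambda>y. snd (u y)) \<in> borel_measurable M"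
    using measurable_compose[OF z measurable_fst] measurable_compose[OF z measurable_snd]
      measurable_compose[OF u measurable_fst] measurable_compose[OF u measurable_snd] by simp_all
  show ?thesis unfolding haar_density_def by measurable
qed

lemma space_plane [simp]: "u \<in> space plane"
  by (cases u) (simp add: space_pair_measure)

text \<open>At scale \<open>s\<close> only positions in an interval of length \<open>s\<close>
  contribute, which leaves \<open>2 / s\<^sup>2\<close> on \<open>{3..}\<close>. The bound is
  uniform in \<open>u\<close>, so integrating against \<open>f\<close> and \<open>g\<close>
  converges absolutely.\<close>

lemma nn_integral_haar_density: "(\<integral>\<^sup>+z. ennreal \<bar>haar_density z u\<bar> \<partial>plane) \<le> ennreal (2 / 3)"
proof -
  obtain x y where u: "u = (x, y)" by (cases u)
  have "(\<integral>\<^sup>+z. ennreal \<bar>haar_density z u\<bar> \<partial>plane) = (\<integral>\<^sup>+s. \<integral>\<^sup>+b. ennreal \<bar>haar_density (s, b) u\<bar> \<partial>lborel \<partial>lborel)"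
    by (rule lborel.nn_integral_fst[symmetric]) measurable
  also have "\<dots> \<le> (\<integral>\<^sup>+s. 2 * (ennreal (1 / s\<^sup>2) * indicator {3..} s) \<partial>lborel)"
  proof (intro nn_integral_mono)
    fix s :: real
    show "(\<integral>\<^sup>+b. ennreal \<bar>haar_density (s, b) u\<bar> \<partial>lborel) \<le> 2 * (ennreal (1 / s\<^sup>2) * indicator {3..} s)"
    proof (cases "3 \<le> s")
      case True
      have "\<bar>haar_density (s, b) u\<bar> \<le> 1 / s ^ 3 * (2 * indicator {x - s<..x} b)" for b
        using True abs_haar_cohaar[of s x b y] unfolding haar_density_def u
        by (simp add: abs_mult mult_left_mono divide_right_mono)
      then have "(\<integral>\<^sup>+b. ennreal \<bar>haar_density (s, b) u\<bar> \<partial>lborel) \<le> (\<integral>\<^sup>+b. ennreal (2 / s ^ 3) * indicator {x - s<..x} b \<partial>lborel)"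
      proof (intro nn_integral_mono)
        fix b
        have "ennreal \<bar>haar_density (s, b) u\<bar> \<le> ennreal (1 / s ^ 3 * (2 * indicator {x - s<..x} b))"
          using \<open>\<And>b. \<bar>haar_density (s, b) u\<bar> \<le> 1 / s ^ 3 * (2 * indicator {x - s<..x} b)\<close> by (rule ennreal_leI)
        then show "ennreal \<bar>haar_density (s, b) u\<bar> \<le> ennreal (2 / s ^ 3) * indicator {x - s<..x} b"
          by (auto simp: indicator_def)
      qed
      also have "\<dots> = ennreal (2 / s ^ 3) * ennreal s" using True by (simp add: nn_integral_cmult_indicator)
      also have "\<dots> = ennreal (2 * (1 / s\<^sup>2))"
        using True by (subst ennreal_mult[symmetric]) (auto simp: power2_eq_square power3_eq_cube)
      also have "\<dots> = 2 * ennreal (1 / s\<^sup>2)" by (subst ennreal_mult) auto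
      also have "\<dots> = 2 * (ennreal (1 / s\<^sup>2) * indicator {3..} s)" using True by simp
      finally show ?thesis .
    qed (simp add: haar_density_def)
  qed
  also have "\<dots> = 2 * (\<integral>\<^sup>+s. ennreal (1 / s\<^sup>2) * indicator {3..} s \<partial>lborel)"
    by (intro nn_integral_cmult) measurable
  also have "\<dots> = ennreal (2 * (1 / 3))"
    unfolding nn_integral_inverse_square by (subst ennreal_mult) auto
  finally show ?thesis by simp
qed

lemma integral_haar_density:
  shows "integrable plane (\<lambda>z. haar_density z u)"
    and "(LINT z|plane. haar_density z u) = haar_kernel (fst u - snd u)"
proof -
  have "(\<integral>\<^sup>+z. ennreal (norm (haar_density z u)) \<partial>plane) < \<infinity>"
    using nn_integral_haar_density[of u] by (simp add: le_less_trans[OF _ ennreal_less_top])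
  then show int: "integrable plane (\<lambda>z. haar_density z u)" by (intro integrableI_bounded) auto
  have "(LINT z|plane. haar_density z u) = (LINT s|lborel. LINT b|lborel. haar_density (s, b) u)"
    by (rule lborel_pair.integral_fst'[symmetric, OF int])
  also have "\<dots> = (LINT s|lborel. indicator {3..} s / s ^ 3 * haar_corr s (fst u - snd u))"
    by (intro Bochner_Integration.integral_cong refl) (auto simp: haar_density_def integral_haar_cohaar indicator_def)
  finally show "(LINT z|plane. haar_density z u) = haar_kernel (fst u - snd u)"
    unfolding haar_kernel_def .
qed

lemma integrable_plane_mult:
  fixes f g :: "real \<Rightarrow> real"
  assumes f: "integrable lborel f" and g: "integrable lborel g"
  shows "integrable plane (\<lambda>u. f (fst u) * g (snd u))"
    and "(LINT u|plane. f (fst u) * g (snd u)) = (LINT x|lborel. f x) * (LINT y|lborel. g y)"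
    and "(\<integral>\<^sup>+u. ennreal \<bar>f (fst u) * g (snd u)\<bar> \<partial>plane) < \<infinity>"
proof -
  have [measurable]: "f \<in> borel_measurable borel" "g \<in> borel_measurable borel" using f g by auto
  have "(\<integral>\<^sup>+u. ennreal \<bar>f (fst u) * g (snd u)\<bar> \<partial>plane) = (\<integral>\<^sup>+x. \<integral>\<^sup>+y. ennreal \<bar>f x\<bar> * ennreal \<bar>g y\<bar> \<partial>lborel \<partial>lborel)"
    by (subst lborel.nn_integral_fst[symmetric]) (auto simp: abs_mult ennreal_mult)
  also have "\<dots> = (\<integral>\<^sup>+x. ennreal \<bar>f x\<bar> * (\<integral>\<^sup>+y. ennreal \<bar>g y\<bar> \<partial>lborel) \<partial>lborel)"
    by (intro nn_integral_cong nn_integral_cmult) auto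
  also have "\<dots> = (\<integral>\<^sup>+x. ennreal \<bar>f x\<bar> \<partial>lborel) * (\<integral>\<^sup>+y. ennreal \<bar>g y\<bar> \<partial>lborel)"
    by (intro nn_integral_multc) auto
  also have "\<dots> < \<infinity>"
    using f g by (auto simp: integrable_iff_bounded ennreal_mult_less_top)
  finally show fin: "(\<integral>\<^sup>+u. ennreal \<bar>f (fst u) * g (snd u)\<bar> \<partial>plane) < \<infinity>" .
  then show int: "integrable plane (\<lambda>u. f (fst u) * g (snd u))"
    by (intro integrableI_bounded) auto
  show "(LINT u|plane. f (fst u) * g (snd u)) = (LINT x|lborel. f x) * (LINT y|lborel. g y)"
    by (subst lborel_pair.integral_fst'[symmetric, OF int]) simp
qed

lemma integrable_plane_kernel:
  fixes f g :: "real \<Rightarrow> real" and k :: "real \<times> real \<Rightarrow> real"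
  assumes f: "integrable lborel f" and g: "integrable lborel g"
    and [measurable]: "k \<in> borel_measurable plane" and B: "\<And>u. \<bar>k u\<bar> \<le> B"
  shows "integrable plane (\<lambda>u. f (fst u) * g (snd u) * k u)"
proof (rule Bochner_Integration.integrable_bound)
  show "integrable plane (\<lambda>u. B * (f (fst u) * g (snd u)))"
    using integrable_plane_mult(1)[OF f g] by simp
  have [measurable]: "f \<in> borel_measurable borel" "g \<in> borel_measurable borel" using f g by auto
  show "(\<lambda>u. f (fst u) * g (snd u) * k u) \<in> borel_measurable plane" by measurable
  have "0 \<le> B" using B[of "(0,0)"] by linarith
  then show "AE u in plane. norm (f (fst u) * g (snd u) * k u) \<le> norm (B * (f (fst u) * g (snd u)))"
    using B by (auto simp: abs_mult mult.commute intro!: AE_I2 mult_right_mono)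
qed

context Ap_pair
begin

lemma fhaar_eq: "fhaar s b = (LINT x|lborel. f x * haar s (x - b))"
proof -
  have "fhaar s b = (LINT x|lborel. indicator {b + 2 * (s / 3)..<b + 2 * (s / 3) + s / 3} x * f x - indicator {b..<b + s / 3} x * f x)"
    unfolding fhaar_def window_def using locs(1) by (simp add: locally_intD)
  also have "\<dots> = (LINT x|lborel. f x * haar s (x - b))"
    by (intro Bochner_Integration.integral_cong refl) (auto simp: haar_def indicator_def field_simps)
  finally show ?thesis .
qed

lemma ghaar_eq: "ghaar s b = (LINT x|lborel. g x * cohaar s (x - b))"
proof -
  have "ghaar s b = (LINT x|lborel. indicator {b..<b + s / 3} x * g x
      + indicator {b + 2 * (s / 3)..<b + 2 * (s / 3) + s / 3} x * g x - 2 * (indicator {b + s / 3..<b + s / 3 + s / 3} x * g x))"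
    unfolding ghaar_def window_def using locs(2) by (simp add: locally_intD)
  also have "\<dots> = (LINT x|lborel. g x * cohaar s (x - b))"
    by (intro Bochner_Integration.integral_cong refl) (auto simp: cohaar_def indicator_def field_simps)
  finally show ?thesis .
qed

text \<open>Fubini's theorem turns the pairing with the averaged kernel into an integral of products
  of Haar coefficients, whose absolute value \<open>scale_form_integral\<close> bounds.\<close>

lemma haar_kernel_form:
  "\<bar>LINT u|plane. f (fst u) * g (snd u) * haar_kernel (fst u - snd u)\<bar> \<le> 2 * (haar_const * total_energy)"
proof -
  let ?D = "\<lambda>z. indicator {3..} (fst z) / fst z ^ 3 * (fhaar (fst z) (snd z) * ghaar (fst z) (snd z))"
  let ?\<Phi> = "\<lambda>z u. f (fst u) * g (snd u) * haar_density z u"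
  have fin: "(\<integral>\<^sup>+u. ennreal \<bar>f (fst u) * g (snd u)\<bar> \<partial>plane) < \<infinity>"
    by (rule integrable_plane_mult(3)[OF f_int g_int])
  have int: "integrable (plane \<Otimes>\<^sub>M plane) (\<lambda>(z, u). ?\<Phi> z u)"
  proof (rule integrableI_bounded)
    show "(\<lambda>(z, u). ?\<Phi> z u) \<in> borel_measurable (plane \<Otimes>\<^sub>M plane)" by measurable
    have "(\<integral>\<^sup>+y. ennreal (norm (case y of (z, u) \<Rightarrow> ?\<Phi> z u)) \<partial>(plane \<Otimes>\<^sub>M plane))
      = (\<integral>\<^sup>+u. \<integral>\<^sup>+z. ennreal (norm (?\<Phi> z u)) \<partial>plane \<partial>plane)"
      by (subst plane_pair.nn_integral_snd[symmetric]) auto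
    also have "\<dots> \<le> (\<integral>\<^sup>+u. ennreal \<bar>f (fst u) * g (snd u)\<bar> * ennreal (2 / 3) \<partial>plane)"
    proof (intro nn_integral_mono)
      fix u :: "real \<times> real"
      have "(\<integral>\<^sup>+z. ennreal (norm (?\<Phi> z u)) \<partial>plane)
        = (\<integral>\<^sup>+z. ennreal \<bar>f (fst u) * g (snd u)\<bar> * ennreal \<bar>haar_density z u\<bar> \<partial>plane)"
        by (intro nn_integral_cong) (simp add: abs_mult ennreal_mult)
      also have "\<dots> = ennreal \<bar>f (fst u) * g (snd u)\<bar> * (\<integral>\<^sup>+z. ennreal \<bar>haar_density z u\<bar> \<partial>plane)"
        by (intro nn_integral_cmult) measurable
      also have "\<dots> \<le> ennreal \<bar>f (fst u) * g (snd u)\<bar> * ennreal (2 / 3)"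
        using nn_integral_haar_density by (intro mult_left_mono) auto
      finally show "(\<integral>\<^sup>+z. ennreal (norm (?\<Phi> z u)) \<partial>plane) \<le> \<dots>" .
    qed
    also have "\<dots> = (\<integral>\<^sup>+u. ennreal \<bar>f (fst u) * g (snd u)\<bar> \<partial>plane) * ennreal (2 / 3)"
      by (intro nn_integral_multc) measurable
    also have "\<dots> < \<infinity>" using fin by (simp add: ennreal_mult_less_top)
    finally show "(\<integral>\<^sup>+y. ennreal (norm (case y of (z, u) \<Rightarrow> ?\<Phi> z u)) \<partial>(plane \<Otimes>\<^sub>M plane)) < \<infinity>" .
  qed
  have "(LINT u|plane. f (fst u) * g (snd u) * haar_kernel (fst u - snd u)) = (LINT u|plane. LINT z|plane. ?\<Phi> z u)"
    using integral_haar_density by simp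
  also have "\<dots> = (LINT z|plane. LINT u|plane. ?\<Phi> z u)"
    by (rule plane_pair.Fubini_integral[OF int])
  also have "\<dots> = (LINT z|plane. ?D z)"
  proof (intro Bochner_Integration.integral_cong refl)
    fix z :: "real \<times> real"
    let ?c = "indicator {3..} (fst z) / fst z ^ 3 :: real"
    have fi: "integrable lborel (\<lambda>x. f x * haar (fst z) (x - snd z))"
    proof (rule Bochner_Integration.integrable_bound[OF f_int])
      show "AE x in lborel. norm (f x * haar (fst z) (x - snd z)) \<le> norm (f x)"
        by (auto simp: haar_def indicator_def)
    qed measurable
    have gi: "integrable lborel (\<lambda>x. g x * cohaar (fst z) (x - snd z))"
    proof (rule Bochner_Integration.integrable_bound[where f = "\<lambda>x. 3 * g x"])
      show "AE x in lborel. norm (g x * cohaar (fst z) (x - snd z)) \<le> norm (3 * g x)"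
        by (auto simp: cohaar_def indicator_def abs_mult)
    qed (use g_int in auto)
    have "(LINT u|plane. ?\<Phi> z u)
      = (LINT u|plane. ?c * ((f (fst u) * haar (fst z) (fst u - snd z)) * (g (snd u) * cohaar (fst z) (snd u - snd z))))"
      by (intro Bochner_Integration.integral_cong refl) (simp add: haar_density_def)
    also have "\<dots> = ?c * (fhaar (fst z) (snd z) * ghaar (fst z) (snd z))"
      using integrable_plane_mult(2)[OF fi gi] by (simp add: fhaar_eq ghaar_eq)
    finally show "(LINT u|plane. ?\<Phi> z u) = \<dots>" .
  qed
  finally have eq: "(LINT u|plane. f (fst u) * g (snd u) * haar_kernel (fst u - snd u))
    = (LINT z|plane. ?D z)" .
  \<comment> \<open>A non-integrable \<open>?D\<close> would have integral 0 by convention, so the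
    bound holds in either case.\<close>
  have "ennreal \<bar>LINT z|plane. ?D z\<bar>
    \<le> (\<integral>\<^sup>+z. ennreal \<bar>?D z\<bar> \<partial>plane)"
    by (cases "integrable plane ?D")
      (auto dest: integral_norm_bound_ennreal simp: not_integrable_integral_eq)
  also have "\<dots> = (\<integral>\<^sup>+s. \<integral>\<^sup>+b. ennreal \<bar>indicator {3..} s / s ^ 3 * (fhaar s b * ghaar s b)\<bar> \<partial>lborel \<partial>lborel)"
    by (subst lborel.nn_integral_fst[symmetric]) auto
  also have "\<dots> = (\<integral>\<^sup>+s. indicator {3..} s * (ennreal (1 / s ^ 3) * scale_form s) \<partial>lborel)"
  proof (intro nn_integral_cong)
    fix s :: real
    show "(\<integral>\<^sup>+b. ennreal \<bar>indicator {3..} s / s ^ 3 * (fhaar s b * ghaar s b)\<bar> \<partial>lborel)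
      = indicator {3..} s * (ennreal (1 / s ^ 3) * scale_form s)"
    proof (cases "3 \<le> s")
      case True
      have "(\<integral>\<^sup>+b. ennreal \<bar>indicator {3..} s / s ^ 3 * (fhaar s b * ghaar s b)\<bar> \<partial>lborel)
        = (\<integral>\<^sup>+b. ennreal (1 / s ^ 3) * ennreal \<bar>fhaar s b * ghaar s b\<bar> \<partial>lborel)"
        using True by (intro nn_integral_cong) (simp add: abs_mult ennreal_mult[symmetric])
      also have "\<dots> = ennreal (1 / s ^ 3) * scale_form s"
        unfolding scale_form_def by (intro nn_integral_cmult) measurable
      finally show ?thesis using True by simp
    qed simp
  qed
  also have "\<dots> \<le> ennreal (2 * (haar_const * total_energy))" by (rule scale_form_integral)
  finally show ?thesis unfolding eq
    using haar_const_nonneg total_energy_nonneg by (subst (asm) ennreal_le_iff) auto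
qed

lemma window_product: "window (\<lambda>x. \<bar>f x\<bar>) b 6 * window (\<lambda>x. \<bar>g x\<bar>) b 6 \<le> near_const / 2 * window energy b 6"
proof -
  have "window (\<lambda>x. \<bar>f x\<bar>) b 6 * window (\<lambda>x. \<bar>g x\<bar>) b 6 / 6 \<le> A powr (1 / p) *
    (window v b 6 * (window (\<lambda>x. \<bar>f x\<bar>) b 6 / window v b 6) powr p
    + window w b 6 * (window (\<lambda>x. \<bar>g x\<bar>) b 6 / window w b 6) powr q)"
    using Ap[of 6 b] loc w_pos v_pos by (intro product_average_le[OF pq] window_pos window_nonneg) auto
  also have "\<dots> \<le> A powr (1 / p) * ((2 powr p + 2 powr q) * window energy b 6)"
    using window_energy[of 6 b] by (intro mult_left_mono) auto
  finally show ?thesis by (simp add: near_const_def)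
qed

text \<open>Two points at distance less than 3 lie together in a window of length 6 for a set of
  starting points of length at least 3. Integrating over starting points reduces the near part to
  \<open>window_product\<close>.\<close>

lemma near_form:
  "(\<integral>\<^sup>+u. ennreal (\<bar>f (fst u)\<bar> * \<bar>g (snd u)\<bar> * (if \<bar>fst u - snd u\<bar> < 3 then 1 else 0)) \<partial>plane) \<le> ennreal (near_const * total_energy)"
proof -
  let ?I = "\<lambda>u b. \<bar>f (fst u)\<bar> * \<bar>g (snd u)\<bar> * (if b \<le> fst u \<and> fst u < b + 6 \<and> b \<le> snd u \<and> snd u < b + 6 then 1 else 0)"
  let ?n = "\<lambda>u. \<bar>f (fst u)\<bar> * \<bar>g (snd u)\<bar> * (if \<bar>fst u - snd u\<bar> < 3 then 1 else 0)"
  interpret P: pair_sigma_finite plane "lborel :: real measure" unfolding lborel_prod ..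
  note N0 = near_const_nonneg
  have "(\<integral>\<^sup>+u. ennreal (3 * ?n u) \<partial>plane) \<le> (\<integral>\<^sup>+u. \<integral>\<^sup>+b. ennreal (?I u b) \<partial>lborel \<partial>plane)"
  proof (intro nn_integral_mono)
    fix u :: "real \<times> real"
    show "ennreal (3 * ?n u) \<le> (\<integral>\<^sup>+b. ennreal (?I u b) \<partial>lborel)"
    proof (cases "\<bar>fst u - snd u\<bar> < 3")
      case True
      let ?S = "{max (fst u) (snd u) - 6<..min (fst u) (snd u)}"
      have "ennreal (3 * ?n u) \<le> ennreal (\<bar>f (fst u)\<bar> * \<bar>g (snd u)\<bar> * (min (fst u) (snd u) - (max (fst u) (snd u) - 6)))"
        using True by (auto intro!: ennreal_leI mult_left_mono simp: mult.commute[of 3])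
      also have "\<dots> = (\<integral>\<^sup>+b. ennreal (\<bar>f (fst u)\<bar> * \<bar>g (snd u)\<bar>) * indicator ?S b \<partial>lborel)"
      proof (subst nn_integral_cmult_indicator)
        have "max (fst u) (snd u) - 6 \<le> min (fst u) (snd u)" using True by linarith
        then show "ennreal (\<bar>f (fst u)\<bar> * \<bar>g (snd u)\<bar> * (min (fst u) (snd u) - (max (fst u) (snd u) - 6)))
          = ennreal (\<bar>f (fst u)\<bar> * \<bar>g (snd u)\<bar>) * emeasure lborel ?S"
          by (subst emeasure_lborel_Ioc) (auto intro!: ennreal_mult)
      qed simp
      also have "\<dots> = (\<integral>\<^sup>+b. ennreal (?I u b) \<partial>lborel)"
        by (intro nn_integral_cong) (auto simp: indicator_def)
      finally show ?thesis .
    qed simp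
  qed
  also have "\<dots> = (\<integral>\<^sup>+b. \<integral>\<^sup>+u. ennreal (?I u b) \<partial>plane \<partial>lborel)"
    by (rule P.Fubini'[symmetric]) measurable
  also have "\<dots> = (\<integral>\<^sup>+b. ennreal (window (\<lambda>x. \<bar>f x\<bar>) b 6 * window (\<lambda>x. \<bar>g x\<bar>) b 6) \<partial>lborel)"
  proof (intro nn_integral_cong)
    fix b :: real
    let ?f = "\<lambda>x. indicator {b..<b + 6} x * \<bar>f x\<bar>" and ?g = "\<lambda>x. indicator {b..<b + 6} x * \<bar>g x\<bar>"
    have fi: "integrable lborel ?f" "integrable lborel ?g" using locs by (auto intro: locally_intD)
    have "(\<integral>\<^sup>+u. ennreal (?I u b) \<partial>plane) = (\<integral>\<^sup>+u. ennreal (?f (fst u) * ?g (snd u)) \<partial>plane)"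
      by (intro nn_integral_cong) (auto simp: indicator_def)
    also have "\<dots> = ennreal (LINT u|plane. ?f (fst u) * ?g (snd u))"
      by (intro nn_integral_eq_integral integrable_plane_mult(1) fi) auto
    also have "\<dots> = ennreal (window (\<lambda>x. \<bar>f x\<bar>) b 6 * window (\<lambda>x. \<bar>g x\<bar>) b 6)"
      unfolding window_def by (subst integrable_plane_mult(2)[OF fi]) simp
    finally show "(\<integral>\<^sup>+u. ennreal (?I u b) \<partial>plane) = \<dots>" .
  qed
  also have "\<dots> \<le> (\<integral>\<^sup>+b. ennreal (near_const / 2) * ennreal (window energy b 6) \<partial>lborel)"
    using window_product N0
    by (intro nn_integral_mono) (auto simp: ennreal_mult[symmetric] window_nonneg energy_nonneg intro!: ennreal_leI)
  also have "\<dots> = ennreal (near_const / 2) * ennreal (6 * total_energy)"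
    using energy_int energy_nonneg by (subst nn_integral_cmult) (auto simp: nn_integral_window total_energy_def)
  also have "\<dots> = 3 * ennreal (near_const * total_energy)"
    using N0 total_energy_nonneg by (subst (1) ennreal_mult[symmetric]) (auto simp: ennreal_mult[symmetric] simp flip: ennreal_numeral)
  finally have "(\<integral>\<^sup>+u. ennreal (3 * ?n u) \<partial>plane) \<le> 3 * ennreal (near_const * total_energy)" .
  moreover have "(\<integral>\<^sup>+u. ennreal (3 * ?n u) \<partial>plane) = 3 * (\<integral>\<^sup>+u. ennreal (?n u) \<partial>plane)"
    by (subst nn_integral_cmult[symmetric]) (auto simp: ennreal_mult)
  ultimately have "3 * (\<integral>\<^sup>+u. ennreal (?n u) \<partial>plane) \<le> 3 * ennreal (near_const * total_energy)" by simp
  then show ?thesis by (subst (asm) ennreal_mult_le_mult_iff) auto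
qed

end

section \<open>Weighted bounds for convolution with sinc\<close>

definition sinc_conv :: "(real \<Rightarrow> real) \<Rightarrow> real \<Rightarrow> real" where
  "sinc_conv f y = (LINT x|lborel. f x * sinc (y - x))"

lemma abs_sinc_le_1: "\<bar>sinc t\<bar> \<le> 1"
  using abs_sin_x_le_abs_x[of t] by (auto simp: divide_le_eq)

lemma abs_sinc_le: "\<bar>sinc t\<bar> \<le> 1 / \<bar>t\<bar> \<or> t = 0"
  by (auto intro!: divide_right_mono abs_sin_le_one)

lemma sinc_commute: "sinc (x - y) = sinc (y - x)"
  using sin_minus[of "y - x"] minus_divide_divide[of "sin (y - x)" "y - x"] by auto

lemma sinc_conv_measurable [measurable]:
  assumes [measurable]: "f \<in> borel_measurable borel"
  shows "sinc_conv f \<in> borel_measurable borel"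
  unfolding sinc_conv_def[abs_def] by measurable

text \<open>From distance 3 on the factor 9 makes the two terms cancel exactly. Closer in, the
  bounds 1 and 9 of the terms add up to 10.\<close>

lemma sinc_haar_kernel: "\<bar>sinc t + 9 * sin t * haar_kernel t\<bar> \<le> 10 * (if \<bar>t\<bar> < 3 then 1 else 0)"
proof (cases "\<bar>t\<bar> < 3")
  case True
  have "\<bar>sin t * haar_kernel t\<bar> \<le> 1 * 1"
    unfolding abs_mult using abs_haar_kernel[of t] by (intro mult_mono) auto
  then have "\<bar>9 * sin t * haar_kernel t\<bar> \<le> 9" by (simp add: abs_mult)
  then show ?thesis using abs_sinc_le_1[of t] True by simp
next
  case False
  then have "haar_kernel t = - 1 / (9 * t)" "t \<noteq> 0" using haar_kernel_far[of t] by auto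
  then show ?thesis by simp
qed

context Ap_pair
begin

text \<open>Lets the sines and cosines of the addition formula be absorbed into \<open>f\<close> and
  \<open>g\<close> without raising the energy.\<close>

lemma bounded_mult:
  assumes [measurable]: "a \<in> borel_measurable borel" "b \<in> borel_measurable borel"
    and a: "\<And>x. \<bar>a x\<bar> \<le> 1" and b: "\<And>x. \<bar>b x\<bar> \<le> 1"
  shows "Ap_pair p q A w v (\<lambda>x. f x * a x) (\<lambda>x. g x * b x)"
    and "Ap_pair.total_energy p q w v (\<lambda>x. f x * a x) (\<lambda>x. g x * b x) \<le> total_energy"
proof -
  have le: "\<bar>x * y\<bar> \<le> \<bar>x\<bar>" if "\<bar>y\<bar> \<le> 1" for x y :: real
    using that by (simp add: abs_mult mult_left_le)
  have lp: "\<bar>f x * a x\<bar> powr p * w x \<le> \<bar>f x\<bar> powr p * w x" for x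
    using le[OF a] w_pos[of x] pq(1) by (intro mult_right_mono powr_mono2) auto
  have lq: "\<bar>g x * b x\<bar> powr q * v x \<le> \<bar>g x\<bar> powr q * v x" for x
    using le[OF b] v_pos[of x] q(1) by (intro mult_right_mono powr_mono2) auto
  have 1: "integrable lborel (\<lambda>x. f x * a x)"
    using le[OF a] by (intro Bochner_Integration.integrable_bound[OF f_int]) auto
  have 2: "integrable lborel (\<lambda>x. g x * b x)"
    using le[OF b] by (intro Bochner_Integration.integrable_bound[OF g_int]) auto
  have 3: "integrable lborel (\<lambda>x. \<bar>f x * a x\<bar> powr p * w x)"
    using lp w_pos by (intro Bochner_Integration.integrable_bound[OF fp_int]) (auto simp: less_imp_le abs_mult abs_of_pos)
  have 4: "integrable lborel (\<lambda>x. \<bar>g x * b x\<bar> powr q * v x)"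
    using lq v_pos by (intro Bochner_Integration.integrable_bound[OF gq_int]) (auto simp: less_imp_le abs_mult abs_of_pos)
  show P: "Ap_pair p q A w v (\<lambda>x. f x * a x) (\<lambda>x. g x * b x)"
    using 1 2 3 4 by unfold_locales
  interpret P: Ap_pair p q A w v "\<lambda>x. f x * a x" "\<lambda>x. g x * b x" by fact
  show "P.total_energy \<le> total_energy"
    unfolding P.total_energy_eq total_energy_eq using fp_int gq_int 3 4 lp lq by (intro add_mono integral_mono)
qed

lemma sinc_form:
  "\<bar>LINT u|plane. f (fst u) * g (snd u) * sinc (fst u - snd u)\<bar> \<le> sinc_const * total_energy"
proof -
  note B1 = bounded_mult[of sin cos] note B2 = bounded_mult[of cos sin]
  interpret P1: Ap_pair p q A w v "\<lambda>x. f x * sin x" "\<lambda>x. g x * cos x" by (rule B1) auto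
  interpret P2: Ap_pair p q A w v "\<lambda>x. f x * cos x" "\<lambda>x. g x * sin x" by (rule B2) auto
  have t: "P1.total_energy \<le> total_energy" "P2.total_energy \<le> total_energy" using B1(2) B2(2) by auto
  let ?k = "\<lambda>u. haar_kernel (fst u - snd u)"
  let ?F1 = "\<lambda>u. f (fst u) * sin (fst u) * (g (snd u) * cos (snd u)) * ?k u"
  let ?F2 = "\<lambda>u. f (fst u) * cos (fst u) * (g (snd u) * sin (snd u)) * ?k u"
  let ?r = "\<lambda>u. sinc (fst u - snd u) + 9 * sin (fst u - snd u) * ?k u"
  let ?R = "\<lambda>u. f (fst u) * g (snd u) * ?r u"
  have rb: "\<bar>?r u\<bar> \<le> 10" for u :: "real \<times> real"
    using sinc_haar_kernel[of "fst u - snd u"] by (auto split: if_splits)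
  have i1: "integrable plane ?F1"
    by (rule integrable_plane_kernel[OF P1.f_int P1.g_int _ abs_haar_kernel]) measurable
  have i2: "integrable plane ?F2"
    by (rule integrable_plane_kernel[OF P2.f_int P2.g_int _ abs_haar_kernel]) measurable
  have i3: "integrable plane ?R"
    by (rule integrable_plane_kernel[OF f_int g_int _ rb]) measurable
  note i = i1 i2 i3
  have "(LINT u|plane. f (fst u) * g (snd u) * sinc (fst u - snd u)) = (LINT u|plane. ?R u - 9 * (?F1 u - ?F2 u))"
    by (intro Bochner_Integration.integral_cong refl) (simp only: sin_diff, simp only: algebra_simps)
  also have "\<dots> = (LINT u|plane. ?R u) - 9 * ((LINT u|plane. ?F1 u) - (LINT u|plane. ?F2 u))"
    using i by simp
  finally have eq: "(LINT u|plane. f (fst u) * g (snd u) * sinc (fst u - snd u)) = \<dots>" .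
  have 1: "\<bar>LINT u|plane. ?F1 u\<bar> \<le> 2 * (haar_const * total_energy)"
    using P1.haar_kernel_form mult_left_mono[OF t(1) haar_const_nonneg] by linarith
  have 2: "\<bar>LINT u|plane. ?F2 u\<bar> \<le> 2 * (haar_const * total_energy)"
    using P2.haar_kernel_form mult_left_mono[OF t(2) haar_const_nonneg] by linarith
  have 3: "\<bar>LINT u|plane. ?R u\<bar> \<le> 10 * (near_const * total_energy)"
  proof -
    have "ennreal \<bar>LINT u|plane. ?R u\<bar> \<le> (\<integral>\<^sup>+u. ennreal \<bar>?R u\<bar> \<partial>plane)"
      using integral_norm_bound_ennreal[OF i(3)] by simp
    also have "\<dots> \<le> (\<integral>\<^sup>+u. ennreal 10 * ennreal (\<bar>f (fst u)\<bar> * \<bar>g (snd u)\<bar> * (if \<bar>fst u - snd u\<bar> < 3 then 1 else 0)) \<partial>plane)"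
    proof (intro nn_integral_mono)
      fix u :: "real \<times> real"
      have "\<bar>?R u\<bar> \<le> \<bar>f (fst u)\<bar> * \<bar>g (snd u)\<bar> * (10 * (if \<bar>fst u - snd u\<bar> < 3 then 1 else 0))"
        unfolding abs_mult by (intro mult_left_mono sinc_haar_kernel) auto
      also have "\<dots> = 10 * (\<bar>f (fst u)\<bar> * \<bar>g (snd u)\<bar> * (if \<bar>fst u - snd u\<bar> < 3 then 1 else 0))" by simp
      finally have "ennreal \<bar>?R u\<bar> \<le> ennreal \<dots>" by (rule ennreal_leI)
      also have "\<dots> = ennreal 10 * ennreal (\<bar>f (fst u)\<bar> * \<bar>g (snd u)\<bar> * (if \<bar>fst u - snd u\<bar> < 3 then 1 else 0))"
        by (rule ennreal_mult) auto
      finally show "ennreal \<bar>?R u\<bar> \<le> \<dots>" .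
    qed
    also have "\<dots> = ennreal 10 * (\<integral>\<^sup>+u. ennreal (\<bar>f (fst u)\<bar> * \<bar>g (snd u)\<bar> * (if \<bar>fst u - snd u\<bar> < 3 then 1 else 0)) \<partial>plane)"
      by (intro nn_integral_cmult) measurable
    also have "\<dots> \<le> ennreal 10 * ennreal (near_const * total_energy)"
      using near_form by (intro mult_left_mono) auto
    also have "\<dots> = ennreal (10 * (near_const * total_energy))"
      by (rule ennreal_mult[symmetric]) (auto simp: near_const_def total_energy_nonneg)
    finally show ?thesis by (subst (asm) ennreal_le_iff) (auto simp: near_const_def total_energy_nonneg)
  qed
  have "\<bar>c - 9 * (a - b)\<bar> \<le> 9 * s + 9 * s + t" if "\<bar>a\<bar> \<le> s" "\<bar>b\<bar> \<le> s" "\<bar>c\<bar> \<le> t" for a b c s t :: real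
    using that by (auto simp: abs_le_iff)
  from this[OF 1 2 3] show ?thesis unfolding eq sinc_const_def by (simp add: algebra_simps)
qed

lemma sinc_dual: "\<bar>LINT y|lborel. g y * sinc_conv f y\<bar> \<le> sinc_const * total_energy"
proof -
  have i: "integrable plane (\<lambda>(x, y). f x * g y * sinc (x - y))"
    unfolding case_prod_beta' by (rule integrable_plane_kernel[OF f_int g_int _ abs_sinc_le_1]) measurable
  have "(LINT y|lborel. g y * sinc_conv f y) = (LINT y|lborel. LINT x|lborel. f x * g y * sinc (x - y))"
  proof (intro Bochner_Integration.integral_cong refl)
    fix y
    have "g y * sinc_conv f y = (LINT x|lborel. g y * (f x * sinc (y - x)))"
      unfolding sinc_conv_def by (rule integral_mult_right_zero[symmetric])
    also have "\<dots> = (LINT x|lborel. f x * g y * sinc (x - y))"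
      unfolding sinc_commute[of _ y] by (intro Bochner_Integration.integral_cong refl) (simp only: mult_ac)
    finally show "g y * sinc_conv f y = (LINT x|lborel. f x * g y * sinc (x - y))" .
  qed
  also have "\<dots> = (LINT u|plane. f (fst u) * g (snd u) * sinc (fst u - snd u))"
    using lborel_pair.integral_snd[OF i] by (simp add: case_prod_beta')
  finally show ?thesis using sinc_form by simp
qed

end

section \<open>The strong bound and its extension to the whole weighted space\<close>

context large_scale_Ap
begin

text \<open>The tangent inequality at \<open>\<theta> = 1\<close> bounds \<bar>f\<bar> by
  \<open>\<bar>f x\<bar> powr p * w x + v x\<close>, and \<open>v\<close> is locally
  integrable.\<close>

lemma Lp_locally_int:
  assumes [measurable]: "f \<in> borel_measurable borel" and fp: "integrable lborel (\<lambda>x. \<bar>f x\<bar> powr p * w x)"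
  shows "integrable lborel (\<lambda>x. f x * indicator {a..<b} x)"
proof (rule Bochner_Integration.integrable_bound)
  show "integrable lborel (\<lambda>x. \<bar>f x\<bar> powr p * w x + indicator {a..<b} x * v x)"
    using fp loc(2) by (auto simp: locally_intD)
  have "\<bar>f x\<bar> \<le> \<bar>f x\<bar> powr p * w x + v x" for x
    using tangent_bound[OF pq(1) abs_ge_zero v_pos w_eq zero_less_one, of "f x" x] by simp
  then show "AE x in lborel. norm (f x * indicator {a..<b} x) \<le> norm (\<bar>f x\<bar> powr p * w x + indicator {a..<b} x * v x)"
    using w_pos by (auto simp: indicator_def less_imp_le intro!: AE_I2 order_trans[OF _ abs_ge_self])
qed measurable

text \<open>The solution \<open>e\<close> of \<open>C * e powr q = e / 2\<close> for
  \<open>C = sinc_const + 1\<close>; the added 1 keeps \<open>C\<close> positive.\<close>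

definition dual_scale :: real where
  "dual_scale = (1 / (2 * (sinc_const + 1))) powr (1 / (q - 1))"

definition strong_const :: real where
  "strong_const = 2 * (sinc_const + 1) / dual_scale"

lemma strong_const_nonneg: "0 \<le> strong_const"
  unfolding strong_const_def dual_scale_def using sinc_const_nonneg by simp

text \<open>Duality with the extremal function: for \<open>g\<close> proportional to
  \<open>sgn S * \<bar>S\<bar> powr (p - 1) * w\<close>, both \<open>g * S\<close> and
  \<open>\<bar>g\<bar> powr q * v\<close> are multiples of \<open>\<bar>S\<bar> powr p * w\<close>.
  Cutting \<open>g\<close> off to a bounded interval, where \<open>S\<close> is bounded and
  \<open>w\<close> integrable, makes the integral \<open>X\<close> finite before part of it is
  absorbed.\<close>

lemma sinc_conv_strong:
  assumes f: "integrable lborel f" and fp: "integrable lborel (\<lambda>x. \<bar>f x\<bar> powr p * w x)"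
  shows "(\<integral>\<^sup>+y. ennreal (\<bar>sinc_conv f y\<bar> powr p * w y) \<partial>lborel)
    \<le> ennreal (strong_const * (LINT x|lborel. \<bar>f x\<bar> powr p * w x))"
proof -
  have [measurable]: "f \<in> borel_measurable borel" using f by auto
  let ?N = "LINT x|lborel. \<bar>f x\<bar> powr p * w x"
  let ?S = "sinc_conv f"
  define B where "B = (LINT x|lborel. \<bar>f x\<bar>)"
  have B: "\<bar>?S y\<bar> \<le> B" for y
  proof -
    have "\<bar>?S y\<bar> \<le> (LINT x|lborel. \<bar>f x * sinc (y - x)\<bar>)" unfolding sinc_conv_def by (rule integral_abs_bound)
    also have "\<dots> \<le> B" unfolding B_def
    proof (rule integral_mono')
      show "\<bar>f x * sinc (y - x)\<bar> \<le> \<bar>f x\<bar>" for x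
        using abs_sinc_le_1[of "y - x"] by (simp only: abs_mult mult_left_le abs_ge_zero)
    qed (use f in auto)
    finally show ?thesis .
  qed
  have B0: "0 \<le> B" using B[of 0] by linarith
  define C where "C = sinc_const + 1"
  have C: "0 < C" unfolding C_def using sinc_const_nonneg by linarith
  have q1: "0 < q - 1" using q(1) by simp
  define e where "e = dual_scale"
  have e0: "0 < e" unfolding e_def dual_scale_def C_def[symmetric] using C by simp
  have ee: "C * e powr q = e / 2"
  proof -
    have "e powr (q - 1) = 1 / (2 * C)"
      unfolding e_def dual_scale_def C_def[symmetric] using C q1 by (simp add: powr_powr)
    then have "e powr q = e * (1 / (2 * C))" using e0 by (simp add: powr_diff field_simps)
    then show ?thesis using C by simp
  qed
  have N0: "0 \<le> ?N" using w_pos by (intro integral_nonneg_AE) (auto simp: less_imp_le)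
  have piece: "(\<integral>\<^sup>+y. ennreal (\<bar>?S y\<bar> powr p * w y) * indicator {- real n..<real n} y \<partial>lborel) \<le> ennreal (strong_const * ?N)" for n
  proof -
    let ?I = "\<lambda>y. indicator {- real n..<real n} y :: real"
    define g where "g = (\<lambda>y. e * (sgn (?S y) * \<bar>?S y\<bar> powr (p - 1) * (?I y * w y)))"
    have X_int: "integrable lborel (\<lambda>y. \<bar>?S y\<bar> powr p * (?I y * w y))"
    proof (rule Bochner_Integration.integrable_bound)
      show "integrable lborel (\<lambda>y. B powr p * (?I y * w y))" using loc(1) by (auto simp: locally_intD)
      show "AE y in lborel. norm (\<bar>?S y\<bar> powr p * (?I y * w y)) \<le> norm (B powr p * (?I y * w y))"
        using B pq(1) w_pos by (auto simp: abs_mult indicator_def intro!: AE_I2 mult_right_mono powr_mono2)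
    qed measurable
    define X where "X = (LINT y|lborel. \<bar>?S y\<bar> powr p * (?I y * w y))"
    have X0: "0 \<le> X" unfolding X_def using w_pos by (intro integral_nonneg_AE) (auto simp: less_imp_le)
    have g_int: "integrable lborel g"
    proof (rule Bochner_Integration.integrable_bound)
      show "integrable lborel (\<lambda>y. e * (B powr (p - 1) * (?I y * w y)))" using loc(1) by (auto simp: locally_intD)
      show "AE y in lborel. norm (g y) \<le> norm (e * (B powr (p - 1) * (?I y * w y)))"
      proof (intro AE_I2)
        fix y
        have "\<bar>sgn (?S y) * \<bar>?S y\<bar> powr (p - 1)\<bar> \<le> 1 * B powr (p - 1)"
          unfolding abs_mult using B pq(1) by (intro mult_mono) (auto simp: sgn_if intro!: powr_mono2)
        then have "e * (\<bar>sgn (?S y) * \<bar>?S y\<bar> powr (p - 1)\<bar> * (?I y * w y)) \<le> e * (B powr (p - 1) * (?I y * w y))"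
          using e0 w_pos[of y] by (intro mult_left_mono mult_right_mono) auto
        then show "norm (g y) \<le> norm (e * (B powr (p - 1) * (?I y * w y)))"
          unfolding g_def using e0 w_pos[of y] by (simp add: abs_mult)
      qed
    qed (simp add: g_def)
    have gq: "\<bar>g y\<bar> powr q * v y = e powr q * (\<bar>?S y\<bar> powr p * (?I y * w y))" for y
    proof (cases "?S y = 0 \<or> y \<notin> {- real n..<real n}")
      case True
      then show ?thesis using pq(1) q(1) by (auto simp: g_def)
    next
      case False
      then have "\<bar>g y\<bar> = e * (\<bar>?S y\<bar> powr (p - 1) * w y)"
        using e0 w_pos[of y] by (auto simp: g_def abs_mult sgn_if)
      then have "\<bar>g y\<bar> powr q * v y = e powr q * (\<bar>?S y\<bar> powr ((p - 1) * q) * (w y powr q * w y powr (1 - q)))"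
        using e0 w_pos[of y] by (simp add: powr_mult powr_powr v_eq)
      also have "(p - 1) * q = p" using conj_exp[OF pq] by simp
      also have "w y powr q * w y powr (1 - q) = w y" using w_pos[of y] by (simp add: powr_add[symmetric])
      finally show ?thesis using False by simp
    qed
    have gS: "g y * ?S y = e * (\<bar>?S y\<bar> powr p * (?I y * w y))" for y
    proof (cases "?S y = 0")
      case False
      have "sgn (?S y) * \<bar>?S y\<bar> powr (p - 1) * ?S y = \<bar>?S y\<bar> powr (p - 1) * \<bar>?S y\<bar>"
        by (simp add: sgn_if abs_real_def)
      also have "\<dots> = \<bar>?S y\<bar> powr p" using False by (simp add: powr_diff)
      finally have *: "sgn (?S y) * \<bar>?S y\<bar> powr (p - 1) * ?S y = \<bar>?S y\<bar> powr p" .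
      have "g y * ?S y = e * ((sgn (?S y) * \<bar>?S y\<bar> powr (p - 1) * ?S y) * (?I y * w y))"
        unfolding g_def by (simp only: mult_ac)
      then show ?thesis unfolding * .
    qed (use pq(1) in simp)
    \<comment> \<open>The factor \<open>e\<close> in \<open>g\<close> is so small that the contribution of \<open>g\<close> to the energy is absorbed.\<close>
    interpret P: Ap_pair p q A w v f g
      using f g_int fp X_int by unfold_locales (auto simp: gq)
    have "P.total_energy = ?N + e powr q * X"
      unfolding P.total_energy_eq X_def by (simp only: gq integral_mult_right_zero)
    moreover have "sinc_const = C - 1"
      by (simp add: C_def)
    ultimately have "\<bar>LINT y|lborel. g y * ?S y\<bar> \<le> (C - 1) * (?N + e powr q * X)"
      using P.sinc_dual by simp
    also have "(LINT y|lborel. g y * ?S y) = e * X"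
      unfolding gS X_def by simp
    finally have "e * X \<le> (C - 1) * (?N + e powr q * X)" using e0 X0 by simp
    also have "\<dots> \<le> C * (?N + e powr q * X)" using N0 X0 by (intro mult_right_mono) auto
    also have "\<dots> = C * ?N + e / 2 * X" unfolding distrib_left mult.assoc[symmetric] ee ..
    finally have "e * X / 2 \<le> C * ?N" by simp
    then have "X \<le> strong_const * ?N"
      unfolding strong_const_def C_def[symmetric] e_def[symmetric] using e0 by (simp add: field_simps)
    moreover have "(\<integral>\<^sup>+y. ennreal (\<bar>?S y\<bar> powr p * w y) * indicator {- real n..<real n} y \<partial>lborel) = ennreal X"
    proof -
      have "(\<integral>\<^sup>+y. ennreal (\<bar>?S y\<bar> powr p * w y) * indicator {- real n..<real n} y \<partial>lborel)
        = (\<integral>\<^sup>+y. ennreal (\<bar>?S y\<bar> powr p * (?I y * w y)) \<partial>lborel)"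
        by (intro nn_integral_cong) (auto simp: indicator_def)
      also have "\<dots> = ennreal X"
        unfolding X_def using X_int w_pos by (intro nn_integral_eq_integral) (auto simp: less_imp_le)
      finally show ?thesis .
    qed
    ultimately show ?thesis by (simp add: ennreal_leI)
  qed
  show ?thesis by (rule nn_integral_exhaust[OF _ _ exhaust_line piece]) measurable
qed

text \<open>Supplies the absolute convergence at infinity of the integral that defines the operator.
  Pairing \<open>sgn x * \<bar>f x\<bar>\<close> with the indicator of \<open>{0..<1}\<close> under
  the Haar kernel leaves no cancellation: after a change of sign, the integrand is at least \<bar>f
  x\<bar> / (18 \<bar>x\<bar>) for \<bar>x\<bar> \<ge> 4.\<close>

lemma Lp_decay:
  assumes [measurable]: "f \<in> borel_measurable borel" and fp: "integrable lborel (\<lambda>x. \<bar>f x\<bar> powr p * w x)"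
  shows "integrable lborel (\<lambda>x. f x / \<bar>x\<bar> * indicator {x. 4 \<le> \<bar>x\<bar>} x)"
proof (rule integrableI_bounded)
  let ?F = "\<lambda>x. \<bar>f x\<bar> / \<bar>x\<bar> * indicator {x. 4 \<le> \<bar>x\<bar>} x"
  define M where "M = 36 * (haar_const * ((LINT x|lborel. \<bar>f x\<bar> powr p * w x) + window v 0 1))"
  have piece: "(\<integral>\<^sup>+x. ennreal (?F x) * indicator {- real n..<real n} x \<partial>lborel) \<le> ennreal M" for n
  proof -
    let ?I = "\<lambda>x. indicator {- real n..<real n} x * indicator {x. 4 \<le> \<bar>x\<bar>} x :: real"
    define f' where "f' = (\<lambda>x. sgn x * (\<bar>f x\<bar> * ?I x))"
    define g :: "real \<Rightarrow> real" where "g = indicator {0..<1}"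
    have [measurable]: "f' \<in> borel_measurable borel" unfolding f'_def by measurable
    have f'_le: "\<bar>f' x\<bar> \<le> \<bar>f x * indicator {- real n..<real n} x\<bar>" for x
      unfolding f'_def by (auto simp: indicator_def sgn_if abs_mult)
    have f'_int: "integrable lborel f'"
      using f'_le by (intro Bochner_Integration.integrable_bound[OF Lp_locally_int[OF _ fp, of "- real n" "real n"]]) auto
    have f'p_le: "\<bar>f' x\<bar> powr p * w x \<le> \<bar>f x\<bar> powr p * w x" for x
    proof -
      have "\<bar>f' x\<bar> \<le> \<bar>f x\<bar>" using f'_le[of x] by (cases "x \<in> {- real n..<real n}") auto
      then show ?thesis using w_pos[of x] pq(1) by (intro mult_right_mono powr_mono2) auto
    qed
    have f'p: "integrable lborel (\<lambda>x. \<bar>f' x\<bar> powr p * w x)"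
      using f'p_le w_pos by (intro Bochner_Integration.integrable_bound[OF fp]) (auto simp: abs_mult abs_of_pos less_imp_le)
    have g_eq: "\<bar>g x\<bar> powr q * v x = indicator {0..<0 + 1} x * v x" for x :: real
      unfolding g_def using q(1) by (auto simp: indicator_def)
    interpret P: Ap_pair p q A w v f' g
      using f'_int f'p locally_intD[OF loc(2), of 0 1]
      by unfold_locales (auto simp: g_eq, auto simp: g_def)
    have tot: "P.total_energy \<le> (LINT x|lborel. \<bar>f x\<bar> powr p * w x) + window v 0 1"
      unfolding P.total_energy_eq g_eq window_def using f'p fp f'p_le by (intro add_right_mono integral_mono)
    let ?k = "\<lambda>u. - (f' (fst u) * g (snd u) * haar_kernel (fst u - snd u))"
    let ?G = "\<lambda>u. ?F (fst u) * indicator {- real n..<real n} (fst u) * g (snd u) / 18"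
    have pw: "?G u \<le> ?k u" for u :: "real \<times> real"
    proof (cases "4 \<le> \<bar>fst u\<bar> \<and> fst u \<in> {- real n..<real n} \<and> snd u \<in> {0..<1}")
      case True
      obtain x y where u: "u = (x, y)" by (cases u)
      \<comment> \<open>For \<bar>x\<bar> \<ge> 4 and \<open>0 \<le> y < 1\<close> the kernel is
        given by its exact formula and has the sign of \<open>- x\<close>. The distance is at most
        twice \<bar>x\<bar>, which with the 9 of the kernel makes 18.\<close>
      have xy: "3 \<le> \<bar>x - y\<bar>" "\<bar>x - y\<bar> \<le> 2 * \<bar>x\<bar>" "sgn (x - y) = sgn x" "x \<noteq> 0"
        using True unfolding u by (auto simp: sgn_if abs_real_def split: if_splits)
      have "?k u = \<bar>f x\<bar> * (sgn x / (9 * (x - y)))"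
        using True haar_kernel_far[OF xy(1)] unfolding u f'_def g_def by simp
      also have "sgn x / (9 * (x - y)) = 1 / (9 * \<bar>x - y\<bar>)"
        using xy(1) unfolding xy(3)[symmetric] by (auto simp: sgn_if abs_real_def divide_simps)
      also have "\<bar>f x\<bar> * (1 / (9 * (2 * \<bar>x\<bar>))) \<le> \<bar>f x\<bar> * (1 / (9 * \<bar>x - y\<bar>))"
        using xy by (intro mult_left_mono divide_left_mono) auto
      moreover have "?G u = \<bar>f x\<bar> * (1 / (9 * (2 * \<bar>x\<bar>)))"
        using True unfolding u g_def by simp
      ultimately show ?thesis by simp
    next
      case False
      then show ?thesis by (auto simp: f'_def g_def)
    qed
    have G0: "0 \<le> ?G u" for u :: "real \<times> real" unfolding g_def by simp
    have k_int: "integrable plane ?k"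
      using integrable_plane_kernel[OF P.f_int P.g_int, of "\<lambda>u. haar_kernel (fst u - snd u)" 1] abs_haar_kernel by simp
    have g1: "(\<integral>\<^sup>+y. ennreal (g y) \<partial>lborel) = 1"
    proof -
      have "(\<integral>\<^sup>+y. ennreal (g y) \<partial>lborel) = (\<integral>\<^sup>+y. indicator {0..<1::real} y \<partial>lborel)"
        by (intro nn_integral_cong) (auto simp: g_def indicator_def)
      then show ?thesis by simp
    qed
    have gm [measurable]: "g \<in> borel_measurable borel" unfolding g_def by measurable
    have "(\<integral>\<^sup>+x. ennreal (?F x * indicator {- real n..<real n} x / 18) \<partial>lborel)
      = (\<integral>\<^sup>+x. ennreal (?F x * indicator {- real n..<real n} x / 18) * (\<integral>\<^sup>+y. ennreal (g y) \<partial>lborel) \<partial>lborel)"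
      unfolding g1 by simp
    also have "\<dots> = (\<integral>\<^sup>+x. \<integral>\<^sup>+y. ennreal (?F x * indicator {- real n..<real n} x / 18) * ennreal (g y) \<partial>lborel \<partial>lborel)"
      by (intro nn_integral_cong nn_integral_cmult[symmetric]) measurable
    also have "\<dots> = (\<integral>\<^sup>+u. ennreal (?F (fst u) * indicator {- real n..<real n} (fst u) / 18) * ennreal (g (snd u)) \<partial>plane)"
      by (subst lborel.nn_integral_fst[symmetric]) auto
    also have "\<dots> \<le> (\<integral>\<^sup>+u. ennreal (?k u) \<partial>plane)"
    proof (intro nn_integral_mono)
      fix u :: "real \<times> real"
      have "ennreal (?F (fst u) * indicator {- real n..<real n} (fst u) / 18) * ennreal (g (snd u)) = ennreal (?G u)"
        by (subst ennreal_mult[symmetric]) (auto simp: g_def)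
      then show "ennreal (?F (fst u) * indicator {- real n..<real n} (fst u) / 18) * ennreal (g (snd u)) \<le> ennreal (?k u)"
        using pw by (simp only: ennreal_leI)
    qed
    also have "\<dots> = ennreal (LINT u|plane. ?k u)"
      using k_int order_trans[OF G0 pw] by (intro nn_integral_eq_integral) auto
    also have "\<dots> \<le> ennreal (2 * (haar_const * P.total_energy))"
      using P.haar_kernel_form by (intro ennreal_leI) (simp add: abs_le_iff)
    also have "\<dots> \<le> ennreal (M / 18)"
      unfolding M_def using mult_left_mono[OF tot haar_const_nonneg] by (intro ennreal_leI) simp
    finally have "ennreal 18 * (\<integral>\<^sup>+x. ennreal (?F x * indicator {- real n..<real n} x / 18) \<partial>lborel) \<le> ennreal 18 * ennreal (M / 18)"
      by (intro mult_left_mono) auto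
    also have "\<dots> = ennreal M" by (subst ennreal_mult'[symmetric]) auto
    also have "ennreal 18 * (\<integral>\<^sup>+x. ennreal (?F x * indicator {- real n..<real n} x / 18) \<partial>lborel)
      = (\<integral>\<^sup>+x. ennreal 18 * ennreal (?F x * indicator {- real n..<real n} x / 18) \<partial>lborel)"
      by (intro nn_integral_cmult[symmetric]) measurable
    also have "\<dots> = (\<integral>\<^sup>+x. ennreal (?F x) * indicator {- real n..<real n} x \<partial>lborel)"
      by (intro nn_integral_cong) (auto simp: indicator_def ennreal_mult'[symmetric] simp flip: ennreal_numeral)
    finally show ?thesis .
  qed
  have "(\<integral>\<^sup>+x. ennreal (?F x) \<partial>lborel) \<le> ennreal M"
    by (rule nn_integral_exhaust[OF _ _ exhaust_line piece]) measurable
  also have "\<dots> < \<infinity>" by simp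
  finally show "(\<integral>\<^sup>+x. ennreal (norm (f x / \<bar>x\<bar> * indicator {x. 4 \<le> \<bar>x\<bar>} x)) \<partial>lborel) < \<infinity>"
    by (simp add: abs_mult)
qed measurable

lemma abs_sinc_shift:
  assumes "4 \<le> \<bar>x\<bar>"
  shows "\<bar>sinc (y - x)\<bar> \<le> (2 + 2 * \<bar>y\<bar>) / \<bar>x\<bar>"
proof (cases "2 * \<bar>y\<bar> \<le> \<bar>x\<bar>")
  case True
  then have "\<bar>x\<bar> / 2 \<le> \<bar>y - x\<bar>" by linarith
  then have "y - x \<noteq> 0" using assms by linarith
  then have "\<bar>sinc (y - x)\<bar> \<le> 1 / \<bar>y - x\<bar>" using abs_sinc_le[of "y - x"] by blast
  also have "\<dots> \<le> 1 / (\<bar>x\<bar> / 2)" using \<open>\<bar>x\<bar> / 2 \<le> \<bar>y - x\<bar>\<close> assms by (intro frac_le) auto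
  also have "\<dots> \<le> (2 + 2 * \<bar>y\<bar>) / \<bar>x\<bar>" using assms by (simp add: divide_right_mono)
  finally show ?thesis .
next
  case False
  have "\<bar>sinc (y - x)\<bar> \<le> 1" by (rule abs_sinc_le_1)
  also have "\<dots> \<le> (2 + 2 * \<bar>y\<bar>) / \<bar>x\<bar>" using False assms by (simp add: field_simps)
  finally show ?thesis .
qed

text \<open>Local integrability covers \<bar>x\<bar> < 4 and the decay lemma the rest. The point
  \<open>y\<close> enters the majorant only through a finite factor, so convergence holds at every
  \<open>y\<close>.\<close>

lemma sinc_conv_integrable:
  assumes [measurable]: "f \<in> borel_measurable borel" and fp: "integrable lborel (\<lambda>x. \<bar>f x\<bar> powr p * w x)"
  defines "D \<equiv> \<lambda>y x. \<bar>f x * indicator {-4..<4} x\<bar> + (2 + 2 * \<bar>y\<bar>) * \<bar>f x / \<bar>x\<bar> * indicator {x. 4 \<le> \<bar>x\<bar>} x\<bar>"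
  shows "integrable lborel (\<lambda>x. f x * sinc (y - x))"
proof -
  have D_int: "integrable lborel (D y)"
    unfolding D_def using Lp_locally_int[OF assms(1) fp, of "-4" 4] Lp_decay[OF assms(1) fp]
    by (intro Bochner_Integration.integrable_add integrable_abs integrable_mult_right) auto
  have fin: "\<bar>f x * sinc (y - x)\<bar> = \<bar>f x\<bar> * \<bar>sinc (y - x)\<bar>" for x by (rule abs_mult)
  have le: "\<bar>f x * sinc (y - x)\<bar> \<le> D y x" for x
  proof (cases "4 \<le> \<bar>x\<bar>")
    case True
    have "\<bar>f x\<bar> * \<bar>sinc (y - x)\<bar> \<le> \<bar>f x\<bar> * ((2 + 2 * \<bar>y\<bar>) / \<bar>x\<bar>)"
      using abs_sinc_shift[OF True] by (rule mult_left_mono) simp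
    also have "\<dots> = (2 + 2 * \<bar>y\<bar>) * \<bar>f x / \<bar>x\<bar> * indicator {x. 4 \<le> \<bar>x\<bar>} x\<bar>"
      using True by (simp add: abs_mult)
    also have "\<dots> \<le> D y x" unfolding D_def by simp
    finally show ?thesis unfolding fin .
  next
    case False
    have "\<bar>f x\<bar> * \<bar>sinc (y - x)\<bar> \<le> \<bar>f x\<bar> * 1" using abs_sinc_le_1 by (rule mult_left_mono) simp
    also have "\<dots> \<le> D y x"
    proof -
      have "x \<in> {-4..<4}" using False by auto
      then show ?thesis unfolding D_def by simp
    qed
    finally show ?thesis unfolding fin .
  qed
  have "norm (f x * sinc (y - x)) \<le> norm (D y x)" for x
    unfolding real_norm_def by (rule order_trans[OF le abs_ge_self])
  then show ?thesis by (intro Bochner_Integration.integrable_bound[OF D_int] AE_I2) measurable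
qed

text \<open>The truncations of \<open>f\<close> are integrable and obey the strong bound uniformly.
  Their convolutions converge pointwise by dominated convergence, and Fatou's lemma passes the bound
  to the limit.\<close>

lemma sinc_conv_bounded:
  assumes [measurable]: "f \<in> borel_measurable borel" and fp: "integrable lborel (\<lambda>x. \<bar>f x\<bar> powr p * w x)"
  shows "integrable lborel (\<lambda>x. f x * sinc (y - x))"
    and "(\<integral>\<^sup>+y. ennreal (\<bar>sinc_conv f y\<bar> powr p * w y) \<partial>lborel)
      \<le> ennreal (strong_const * (LINT x|lborel. \<bar>f x\<bar> powr p * w x))"
proof -
  show "integrable lborel (\<lambda>x. f x * sinc (y - x))" by (rule sinc_conv_integrable[OF assms])
  let ?N = "LINT x|lborel. \<bar>f x\<bar> powr p * w x"
  define F where "F = (\<lambda>n x. f x * indicator {- real n..<real n} x)"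
  have [measurable]: "F n \<in> borel_measurable borel" for n unfolding F_def by measurable
  have F_int: "integrable lborel (F n)" for n unfolding F_def by (rule Lp_locally_int[OF assms])
  have Fp_le: "\<bar>F n x\<bar> powr p * w x \<le> \<bar>f x\<bar> powr p * w x" for n x
    using w_pos[of x] pq(1) by (auto simp: F_def indicator_def)
  have Fp: "integrable lborel (\<lambda>x. \<bar>F n x\<bar> powr p * w x)" for n
    using Fp_le w_pos by (intro Bochner_Integration.integrable_bound[OF fp]) (auto simp: abs_mult abs_of_pos less_imp_le)
  have lim: "(\<lambda>n. sinc_conv (F n) y) \<longlonglongrightarrow> sinc_conv f y" for y
    unfolding sinc_conv_def
  proof (rule integral_dominated_convergence[where w = "\<lambda>x. \<bar>f x * sinc (y - x)\<bar>"])
    show "integrable lborel (\<lambda>x. \<bar>f x * sinc (y - x)\<bar>)"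
      by (rule integrable_abs[OF sinc_conv_integrable[OF assms]])
    show "AE x in lborel. (\<lambda>n. F n x * sinc (y - x)) \<longlonglongrightarrow> f x * sinc (y - x)"
    proof (intro AE_I2 tendsto_mult_right)
      fix x
      obtain n0 where "\<bar>x\<bar> < real n0" using reals_Archimedean2 by blast
      then have "\<forall>\<^sub>F n in sequentially. F n x = f x"
        by (intro eventually_sequentiallyI[of n0]) (auto simp: F_def indicator_def)
      then show "(\<lambda>n. F n x) \<longlonglongrightarrow> f x" by (rule tendsto_eventually)
    qed
    show "AE x in lborel. norm (F n x * sinc (y - x)) \<le> \<bar>f x * sinc (y - x)\<bar>" for n
      by (auto simp: F_def indicator_def)
  qed measurable
  have "(\<integral>\<^sup>+y. ennreal (\<bar>sinc_conv f y\<bar> powr p * w y) \<partial>lborel)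
    = (\<integral>\<^sup>+y. liminf (\<lambda>n. ennreal (\<bar>sinc_conv (F n) y\<bar> powr p * w y)) \<partial>lborel)"
  proof (intro nn_integral_cong)
    fix y
    have "(\<lambda>n. ennreal (\<bar>sinc_conv (F n) y\<bar> powr p * w y)) \<longlonglongrightarrow> ennreal (\<bar>sinc_conv f y\<bar> powr p * w y)"
      using pq(1) by (intro tendsto_ennrealI tendsto_mult_right tendsto_powr' tendsto_rabs lim tendsto_const) auto
    then show "ennreal (\<bar>sinc_conv f y\<bar> powr p * w y) = liminf (\<lambda>n. ennreal (\<bar>sinc_conv (F n) y\<bar> powr p * w y))"
      by (rule lim_imp_Liminf[OF sequentially_bot, symmetric])
  qed
  also have "\<dots> \<le> liminf (\<lambda>n. \<integral>\<^sup>+y. ennreal (\<bar>sinc_conv (F n) y\<bar> powr p * w y) \<partial>lborel)"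
    by (rule nn_integral_liminf) measurable
  also have "\<dots> \<le> ennreal (strong_const * ?N)"
  proof (rule Liminf_le[OF sequentially_bot], rule always_eventually, rule allI)
    fix n
    have "(\<integral>\<^sup>+y. ennreal (\<bar>sinc_conv (F n) y\<bar> powr p * w y) \<partial>lborel) \<le> ennreal (strong_const * (LINT x|lborel. \<bar>F n x\<bar> powr p * w x))"
      by (rule sinc_conv_strong[OF F_int Fp])
    also have "\<dots> \<le> ennreal (strong_const * ?N)"
      using strong_const_nonneg Fp fp Fp_le by (intro ennreal_leI mult_left_mono integral_mono)
    finally show "(\<integral>\<^sup>+y. ennreal (\<bar>sinc_conv (F n) y\<bar> powr p * w y) \<partial>lborel) \<le> ennreal (strong_const * ?N)" .
  qed
  finally show "(\<integral>\<^sup>+y. ennreal (\<bar>sinc_conv f y\<bar> powr p * w y) \<partial>lborel) \<le> ennreal (strong_const * ?N)" .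
qed

end

section \<open>Necessity of the large-scale condition\<close>

text \<open>The cubic Taylor remainder keeps \<open>sin t / t\<close> within
  \<open>t\<^sup>2 / 6\<close> of 1, and this is at most 2/3 here.\<close>

lemma sinc_ge_third:
  assumes "\<bar>t\<bar> \<le> 2"
  shows "1 / 3 \<le> sinc t"
proof (cases "t = 0")
  case False
  have "(\<Sum>m<3. sin_coeff m * t ^ m) = t"
    by (simp add: numeral_3_eq_3 sin_coeff_def)
  then have "\<bar>sin t - t\<bar> \<le> inverse (fact 3) * \<bar>t\<bar> ^ 3"
    using Maclaurin_sin_bound[of t 3] by simp
  also have "\<dots> = \<bar>t\<bar> * (\<bar>t\<bar>\<^sup>2 / 6)" by (simp add: fact_numeral power2_eq_square power3_eq_cube)
  also have "\<dots> \<le> \<bar>t\<bar> * (2\<^sup>2 / 6)"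
    using assms by (intro mult_left_mono divide_right_mono power_mono) auto
  finally have "\<bar>sin t - t\<bar> \<le> \<bar>t\<bar> * (2 / 3)" by simp
  then have "\<bar>sin t - t\<bar> / \<bar>t\<bar> \<le> 2 / 3" using False by (simp add: divide_le_eq mult.commute)
  moreover have "\<bar>sin t - t\<bar> / \<bar>t\<bar> = \<bar>sin t / t - 1\<bar>"
    using False by (simp add: abs_divide[symmetric] diff_divide_distrib)
  ultimately have "1 / 3 \<le> sin t / t" by linarith
  then show ?thesis using False by simp
qed simp

text \<open>The mean 1/2 of the squared sine contributes 1 over a length of 2; the oscillating part
  takes away at most 1/2.\<close>

lemma integral_sin_square: "1 / 2 \<le> window (\<lambda>y. (sin (x - y))\<^sup>2) a 2"
proof -
  let ?F = "\<lambda>y. y / 2 + sin (2 * (x - y)) / 4"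
  have "(LINT y|lborel. (sin (x - y))\<^sup>2 * indicator {a..a + 2} y) = ?F (a + 2) - ?F a"
  proof (rule integral_FTC_Icc_real)
    show "DERIV ?F y :> (sin (x - y))\<^sup>2" for y
    proof -
      have "(cos (2 * (x - y))) = 1 - 2 * (sin (x - y))\<^sup>2" by (rule cos_double_sin)
      then show ?thesis by (auto intro!: derivative_eq_intros simp: diff_divide_distrib)
    qed
    show "isCont (\<lambda>y. (sin (x - y))\<^sup>2) y" for y by (intro continuous_intros)
  qed simp
  also have "(LINT y|lborel. (sin (x - y))\<^sup>2 * indicator {a..a + 2} y) = window (\<lambda>y. (sin (x - y))\<^sup>2) a 2"
  proof -
    have "AE y in lborel. y \<noteq> a + 2" by (rule AE_lborel_singleton)
    then have "AE y in lborel. (sin (x - y))\<^sup>2 * indicator {a..a + 2} y = indicator {a..<a + 2} y * (sin (x - y))\<^sup>2"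
      by eventually_elim (auto simp: indicator_def)
    then show ?thesis unfolding window_def by (intro integral_cong_AE) auto
  qed
  finally have eq: "window (\<lambda>y. (sin (x - y))\<^sup>2) a 2 = ?F (a + 2) - ?F a" .
  have "1 / 2 \<le> (a + 2) / 2 + s / 4 - (a / 2 + t / 4)" if "t \<le> 1" "- 1 \<le> s" for s t :: real
    using that by (simp add: field_simps)
  from this[OF sin_le_one sin_ge_minus_one] show ?thesis unfolding eq .
qed

lemma locally_int_bounded_mult:
  assumes h: "locally_int h" and [measurable]: "u \<in> borel_measurable borel" "h \<in> borel_measurable borel"
    and u: "\<And>x. \<bar>u x\<bar> \<le> 1"
  shows "locally_int (\<lambda>x. u x * h x)"
  unfolding locally_int_def
proof (intro allI)
  fix a b
  show "integrable lborel (\<lambda>x. indicator {a..<b} x * (u x * h x))"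
  proof (rule Bochner_Integration.integrable_bound[OF locally_intD[OF h, of a b]])
    have "\<bar>u x * h x\<bar> \<le> 1 * \<bar>h x\<bar>" for x unfolding abs_mult using u by (intro mult_right_mono) auto
    then show "AE x in lborel. norm (indicator {a..<b} x * (u x * h x)) \<le> norm (indicator {a..<b} x * h x)"
      by (auto simp: indicator_def)
  qed measurable
qed

lemma window_mono_length:
  assumes "locally_int f" "\<And>x. 0 \<le> f x" "s \<le> t"
  shows "window f a s \<le> window f a t"
  unfolding window_def using assms
  by (intro integral_mono locally_intD) (auto simp: indicator_def)

text \<open>The constant \<open>C\<close> is the p-th power of a bound for the operator norm. With a
  nonnegative integral on the left, finiteness is part of the bound.\<close>

locale bounded_multiplier = dual_weights p q w v
  for p q C :: real and w v :: "real \<Rightarrow> real" +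
  assumes C: "0 \<le> C"
    and bounded: "\<And>f. f \<in> borel_measurable borel \<Longrightarrow> integrable lborel (\<lambda>x. norm (f x) powr p * w x) \<Longrightarrow>
      (\<integral>\<^sup>+x. ennreal (norm (LINT y|lborel. complex_of_real (sinc (x - y)) * f y) powr p * w x) \<partial>lborel)
        \<le> ennreal (C * (LINT x|lborel. norm (f x) powr p * w x))"
begin

section \<open>The condition on intervals of length 2\<close>

lemma vp_w: "v x powr p * w x = v x"
  unfolding w_eq using v_pos[of x] by (simp add: powr_add[symmetric])

lemma test_function:
  assumes f: "f \<in> borel_measurable borel" "integrable lborel (\<lambda>x. norm (f x) powr p * w x)" and k: "0 \<le> k"
    and le: "\<And>x. x \<in> {b..<b + t} \<Longrightarrow> k \<le> norm (LINT y|lborel. complex_of_real (sinc (x - y)) * f y)"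
  shows "k powr p * window w b t \<le> C * (LINT x|lborel. norm (f x) powr p * w x)"
proof -
  have "ennreal (k powr p * window w b t) = (\<integral>\<^sup>+x. ennreal (k powr p * (indicator {b..<b + t} x * w x)) \<partial>lborel)"
    unfolding window_def using w_loc w_pos
    by (subst nn_integral_eq_integral) (auto simp: locally_intD less_imp_le)
  also have "\<dots> \<le> (\<integral>\<^sup>+x. ennreal (norm (LINT y|lborel. complex_of_real (sinc (x - y)) * f y) powr p * w x) \<partial>lborel)"
  proof (intro nn_integral_mono ennreal_leI)
    fix x
    show "k powr p * (indicator {b..<b + t} x * w x) \<le> norm (LINT y|lborel. complex_of_real (sinc (x - y)) * f y) powr p * w x"
    proof (cases "x \<in> {b..<b + t}")
      case True
      have "k powr p * w x \<le> norm (LINT y|lborel. complex_of_real (sinc (x - y)) * f y) powr p * w x"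
        using le[OF True] k pq(1) w_pos[of x] by (intro mult_right_mono powr_mono2) auto
      then show ?thesis using True by simp
    qed (use w_pos[of x] in simp)
  qed
  also have "\<dots> \<le> ennreal (C * (LINT x|lborel. norm (f x) powr p * w x))" by (rule bounded[OF f])
  finally have "ennreal (k powr p * window w b t) \<le> ennreal (C * (LINT x|lborel. norm (f x) powr p * w x))" .
  moreover have "0 \<le> C * (LINT x|lborel. norm (f x) powr p * w x)"
    using C w_pos by (intro mult_nonneg_nonneg integral_nonneg_AE) (auto simp: less_imp_le)
  ultimately show ?thesis by (simp add: ennreal_le_iff)
qed

text \<open>Within an interval of length 2 the kernel is at least 1/3, so nothing cancels for
  nonnegative \<open>h\<close>.\<close>

lemma local_test:
  assumes [measurable]: "h \<in> borel_measurable borel" and h: "\<And>x. 0 \<le> h x"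
    and hi: "integrable lborel (\<lambda>x. indicator {a..<a + 2} x * h x)"
    and hp: "integrable lborel (\<lambda>x. indicator {a..<a + 2} x * (h x powr p * w x))"
  shows "(window h a 2 / 3) powr p * window w a 2 \<le> C * window (\<lambda>x. h x powr p * w x) a 2"
proof -
  let ?I = "indicator {a..<a + 2} :: real \<Rightarrow> real"
  let ?f = "\<lambda>x. complex_of_real (?I x * h x)"
  have fp: "norm (?f x) powr p * w x = ?I x * (h x powr p * w x)" for x
    using h[of x] pq(1) by (auto simp: indicator_def)
  have "(window h a 2 / 3) powr p * window w a 2 \<le> C * (LINT x|lborel. norm (?f x) powr p * w x)"
  proof (rule test_function)
    show "integrable lborel (\<lambda>x. norm (?f x) powr p * w x)" unfolding fp by (rule hp)
    show "0 \<le> window h a 2 / 3" using h by (simp add: window_nonneg)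
    fix x assume x: "x \<in> {a..<a + 2}"
    have int: "integrable lborel (\<lambda>y. sinc (x - y) * (?I y * h y))"
    proof (rule Bochner_Integration.integrable_bound[OF hi])
      have "\<bar>sinc (x - y) * (?I y * h y)\<bar> \<le> 1 * \<bar>?I y * h y\<bar>" for y
        unfolding abs_mult[of "sinc (x - y)"] by (intro mult_right_mono abs_sinc_le_1) auto
      then show "AE y in lborel. norm (sinc (x - y) * (?I y * h y)) \<le> norm (?I y * h y)"
        unfolding real_norm_def mult_1 by (intro AE_I2)
    qed measurable
    have "window h a 2 / 3 = (LINT y|lborel. 1 / 3 * (?I y * h y))" unfolding window_def by simp
    also have "\<dots> \<le> (LINT y|lborel. sinc (x - y) * (?I y * h y))"
    proof (intro integral_mono int)
      show "integrable lborel (\<lambda>y. 1 / 3 * (?I y * h y))" using hi by simp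
      show "1 / 3 * (?I y * h y) \<le> sinc (x - y) * (?I y * h y)" for y
      proof (cases "y \<in> {a..<a + 2}")
        case True
        then have "\<bar>x - y\<bar> \<le> 2" using x by auto
        then show ?thesis using h[of y] by (intro mult_right_mono sinc_ge_third) auto
      qed simp
    qed
    also have "\<dots> \<le> norm (complex_of_real (LINT y|lborel. sinc (x - y) * (?I y * h y)))" by simp
    also have "complex_of_real (LINT y|lborel. sinc (x - y) * (?I y * h y)) = (LINT y|lborel. complex_of_real (sinc (x - y)) * ?f y)"
      by (subst integral_complex_of_real[symmetric]) (simp only: of_real_mult)
    finally show "window h a 2 / 3 \<le> norm (LINT y|lborel. complex_of_real (sinc (x - y)) * ?f y)" .
  qed measurable
  then show ?thesis unfolding fp window_def .
qed

definition local_const :: real where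
  "local_const = 3 powr p * C"

lemma local_bound_aux:
  assumes "0 < W" "0 \<le> F" "(F / 3) powr p * W \<le> C * F"
  shows "W * F powr (p - 1) \<le> local_const"
proof (cases "F = 0")
  case False
  then have F: "0 < F" using assms by simp
  have "F powr p * W \<le> local_const * F"
    using assms(3) F by (simp add: powr_divide local_const_def field_simps)
  moreover have "F powr p = F * F powr (p - 1)" using F by (simp add: powr_diff)
  ultimately have "F * (W * F powr (p - 1)) \<le> F * local_const" by (simp add: mult_ac)
  then show ?thesis using F by simp
qed (use C in \<open>simp add: local_const_def\<close>)

text \<open>Testing with \<open>v\<close> itself presupposes its integrability. The truncations to
  \<open>v x \<le> real n\<close> are bounded, share with \<open>v\<close> the identity
  \<open>h powr p * w = h\<close>, and have integrals below an \<open>M\<close> that does not depend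
  on \<open>n\<close>.\<close>

lemma v_local: "integrable lborel (\<lambda>x. indicator {a..<a + 2} x * v x)"
proof -
  let ?W = "window w a 2"
  have W: "0 < ?W" using w_loc w_pos by (intro window_pos) auto
  define M where "M = (local_const / ?W) powr (q - 1)"
  let ?vn = "\<lambda>n x. v x * indicator {x. v x \<le> real n} x"
  have int: "integrable lborel (\<lambda>x. indicator {a..<a + 2} x * ?vn n x)" for n
  proof (rule Bochner_Integration.integrable_bound[OF locally_intD[OF locally_int_const[of "real n"], of a "a + 2"]])
    show "AE x in lborel. norm (indicator {a..<a + 2} x * ?vn n x) \<le> norm (indicator {a..<a + 2} x * real n)"
      using v_pos by (auto simp: indicator_def less_imp_le abs_of_pos)
  qed measurable
  have vn_p: "?vn n x powr p * w x = ?vn n x" for n x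
    using vp_w[of x] pq(1) by (auto simp: indicator_def)
  have le: "window (?vn n) a 2 \<le> M" for n
  proof -
    define F where "F = window (?vn n) a 2"
    have F: "0 \<le> F" unfolding F_def using v_pos by (intro window_nonneg) (auto simp: less_imp_le)
    have "(F / 3) powr p * ?W \<le> C * window (\<lambda>x. ?vn n x powr p * w x) a 2"
      unfolding F_def using v_pos int by (intro local_test) (auto simp: less_imp_le vn_p)
    then have "?W * F powr (p - 1) \<le> local_const"
      unfolding vn_p F_def[symmetric] by (rule local_bound_aux[OF W F])
    then have "F powr (p - 1) \<le> local_const / ?W" using W by (simp add: pos_le_divide_eq mult.commute)
    then have "(F powr (p - 1)) powr (q - 1) \<le> M" unfolding M_def using q(1) by (intro powr_mono2) auto
    then show ?thesis using F conj_exp(4)[OF pq] by (simp add: powr_powr F_def)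
  qed
  have "(\<integral>\<^sup>+x. ennreal (indicator {a..<a + 2} x * v x) \<partial>lborel) \<le> ennreal M"
  proof (rule nn_integral_exhaust[where S = "\<lambda>n. {x. v x \<le> real n}"])
    show "incseq (\<lambda>n. {x. v x \<le> real n})" by (intro incseq_SucI) auto
    show "\<exists>n. x \<in> {x. v x \<le> real n}" for x using real_arch_simple by simp
    fix n
    have "(\<integral>\<^sup>+x. ennreal (indicator {a..<a + 2} x * v x) * indicator {x. v x \<le> real n} x \<partial>lborel)
      = (\<integral>\<^sup>+x. ennreal (indicator {a..<a + 2} x * ?vn n x) \<partial>lborel)"
      by (intro nn_integral_cong) (auto simp: indicator_def)
    also have "\<dots> = ennreal (window (?vn n) a 2)"
      unfolding window_def using int v_pos by (intro nn_integral_eq_integral) (auto simp: less_imp_le)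
    also have "\<dots> \<le> ennreal M" using le by (rule ennreal_leI)
    finally show "(\<integral>\<^sup>+x. ennreal (indicator {a..<a + 2} x * v x) * indicator {x. v x \<le> real n} x \<partial>lborel) \<le> ennreal M" .
  qed measurable
  also have "\<dots> < \<infinity>" by simp
  finally show ?thesis
    using v_pos by (intro integrableI_bounded) (auto simp: abs_mult abs_of_pos)
qed

lemma v_loc: "locally_int v"
  unfolding locally_int_def
proof (intro allI)
  fix a b
  have step: "integrable lborel (\<lambda>x. indicator {a..<a + 2 * real n} x * v x)" for n
  proof (induction n)
    case (Suc n)
    have "(\<lambda>x. indicator {a..<a + 2 * real (Suc n)} x * v x)
      = (\<lambda>x. indicator {a..<a + 2 * real n} x * v x + indicator {a + 2 * real n..<a + 2 * real n + 2} x * v x)"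
      by (auto simp: fun_eq_iff indicator_def)
    then show ?case using Suc v_local by simp
  qed simp
  obtain n where "b - a \<le> real n" using real_arch_simple by blast
  then have n: "b \<le> a + 2 * real n" by linarith
  show "integrable lborel (\<lambda>x. indicator {a..<b} x * v x)"
  proof (rule Bochner_Integration.integrable_bound[OF step[of n]])
    show "AE x in lborel. norm (indicator {a..<b} x * v x) \<le> norm (indicator {a..<a + 2 * real n} x * v x)"
      using n by (auto simp: indicator_def)
  qed measurable
qed

lemma local_bound: "window w a 2 * window v a 2 powr (p - 1) \<le> local_const"
proof -
  have "(window v a 2 / 3) powr p * window w a 2 \<le> C * window (\<lambda>x. v x powr p * w x) a 2"
    using v_pos v_loc by (intro local_test) (auto simp: less_imp_le vp_w locally_intD)
  then show ?thesis
    unfolding vp_w using w_loc w_pos v_loc v_pos by (intro local_bound_aux window_pos) (auto simp: less_imp_le window_nonneg)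
qed

lemma local_const_pos: "0 < local_const"
proof -
  have "0 < window w 0 2" "0 < window v 0 2" using w_loc w_pos v_loc v_pos by (auto intro!: window_pos)
  then have "0 < window w 0 2 * window v 0 2 powr (p - 1)" by simp
  then show ?thesis using local_bound[of 0] by linarith
qed

section \<open>Oscillating test functions and long intervals\<close>

definition osc_const :: real where
  "osc_const = 4 powr (- q) * local_const powr (1 - q)"

lemma osc_const_pos: "0 < osc_const"
  unfolding osc_const_def using local_const_pos by simp

lemma sin_loc: "locally_int h \<Longrightarrow> h \<in> borel_measurable borel \<Longrightarrow> locally_int (\<lambda>y. (sin (x - y))\<^sup>2 * h y)"
  by (rule locally_int_bounded_mult) (auto simp: abs_square_le_1)

text \<open>The local \<open>A\<^sub>p\<close> condition prevents the dual weight from concentrating near the zeros of the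
  oscillating factor.\<close>

lemma osc_local: "osc_const * window v a 2 \<le> window (\<lambda>y. (sin (x - y))\<^sup>2 * v y) a 2"
proof -
  let ?u = "\<lambda>y. (sin (x - y))\<^sup>2"
  define W where "W = window w a 2"
  define V where "V = window v a 2"
  have W: "0 < W" and V: "0 < V" unfolding W_def V_def using w_loc w_pos v_loc v_pos by (auto intro!: window_pos)
  \<comment> \<open>This choice makes the \<open>w\<close>-term exactly 1/4, half of the lower bound
    for the integral of the squared sine.\<close>
  define \<theta> where "\<theta> = (4 * W) powr (q - 1)"
  have \<theta>: "0 < \<theta>" using W by (simp add: \<theta>_def)
  have pw: "?u y \<le> \<theta> * (?u y * v y) + \<theta> powr (1 - p) * w y" for y
  proof -
    have "1 \<le> \<theta> * v y + \<theta> powr (1 - p) * w y"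
      using tangent_bound[OF pq(1) zero_le_one v_pos w_eq \<theta>, of y] by simp
    then have "?u y * 1 \<le> ?u y * (\<theta> * v y + \<theta> powr (1 - p) * w y)" by (rule mult_left_mono) simp
    also have "\<dots> = \<theta> * (?u y * v y) + ?u y * (\<theta> powr (1 - p) * w y)" by (simp add: algebra_simps)
    also have "?u y * (\<theta> powr (1 - p) * w y) \<le> 1 * (\<theta> powr (1 - p) * w y)"
      using w_pos[of y] by (intro mult_right_mono) (auto simp: abs_square_le_1)
    finally show ?thesis by simp
  qed
  have sl: "locally_int ?u" using sin_loc[OF locally_int_const[of 1]] by simp
  have vl: "locally_int (\<lambda>y. ?u y * v y)" by (rule sin_loc[OF v_loc]) measurable
  have "1 / 2 \<le> window ?u a 2" by (rule integral_sin_square)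
  also have "\<dots> \<le> window (\<lambda>y. \<theta> * (?u y * v y) + \<theta> powr (1 - p) * w y) a 2"
    using pw sl vl w_loc by (intro window_mono locally_int_add locally_int_cmult)
  also have "\<dots> = \<theta> * window (\<lambda>y. ?u y * v y) a 2 + \<theta> powr (1 - p) * W"
    using vl w_loc by (simp add: window_add window_cmult locally_int_cmult W_def)
  also have "\<theta> powr (1 - p) * W = 1 / 4"
  proof -
    have "(q - 1) * (1 - p) = -1" using conj_exp(4)[OF pq] by (simp add: algebra_simps)
    then have "\<theta> powr (1 - p) = (4 * W) powr (-1)" unfolding \<theta>_def powr_powr by simp
    then show ?thesis using W by (simp add: powr_minus_divide)
  qed
  finally have 1: "1 / 4 \<le> \<theta> * window (\<lambda>y. ?u y * v y) a 2" by simp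
  \<comment> \<open>In this form the length-2 condition bounds \<open>1 / W powr (q - 1)\<close>
    from below by a multiple of \<open>V\<close>, which turns the lower bound
    \<open>1 / (4 * \<theta>)\<close> into \<open>osc_const * V\<close>. The powers of 4 combine to
    \<open>4 powr (- q)\<close>.\<close>
  have "(W * V powr (p - 1)) powr (q - 1) \<le> local_const powr (q - 1)"
    unfolding W_def V_def using local_bound q(1) W V by (intro powr_mono2) (auto simp: W_def V_def)
  then have 2: "W powr (q - 1) * V \<le> local_const powr (q - 1)"
    using W V conj_exp(4)[OF pq] by (simp add: powr_mult powr_powr)
  have "osc_const * V * W powr (q - 1) \<le> osc_const * local_const powr (q - 1)"
    using 2 osc_const_pos by (simp add: mult_ac)
  also have "\<dots> = 4 powr (- q)" unfolding osc_const_def using local_const_pos by (simp add: mult.assoc powr_add[symmetric])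
  also have "\<dots> = 1 / 4 / 4 powr (q - 1)" by (simp add: powr_minus_divide powr_diff)
  also have "\<dots> \<le> \<theta> * window (\<lambda>y. ?u y * v y) a 2 / 4 powr (q - 1)" using 1 by (intro divide_right_mono) auto
  also have "\<dots> = window (\<lambda>y. ?u y * v y) a 2 * W powr (q - 1)" unfolding \<theta>_def using W by (simp add: powr_mult)
  finally show ?thesis using W unfolding V_def by simp
qed

text \<open>A long interval is tiled by intervals of length 2, each of which keeps the share
  \<open>c\<close> of its mass.\<close>

lemma osc_global:
  assumes h: "locally_int h" "h \<in> borel_measurable borel"
    and step: "\<And>a. c * window h a 2 \<le> window (\<lambda>y. (sin (x - y))\<^sup>2 * h y) a 2"
  shows "c * window h a (2 * real n) \<le> window (\<lambda>y. (sin (x - y))\<^sup>2 * h y) a (2 * real n)"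
proof (induction n)
  case (Suc n)
  have split: "window k a (2 * real (Suc n)) = window k a (2 * real n) + window k (a + 2 * real n) 2" if "locally_int k" for k
    using window_split[OF that, of "2 * real n" 2 a] by (simp add: add.commute)
  show ?case using Suc step[of "a + 2 * real n"] unfolding split[OF h(1)] split[OF sin_loc[OF h]] distrib_left
    by (rule add_mono)
qed (simp add: window_def)

text \<open>Modulation by \<^const>\<open>cis\<close> replaces the kernel by \<open>sin\<^sup>2 (x - y) / (x - y)\<close>, which has constant sign
  when source and target intervals are adjacent.\<close>

lemma modulated_test:
  assumes h: "locally_int h" "\<And>x. 0 \<le> h x" and [measurable]: "h \<in> borel_measurable borel"
    and hp: "locally_int (\<lambda>x. h x powr p * w x)"
    and c: "0 \<le> c" "\<And>x a. c * window h a 2 \<le> window (\<lambda>y. (sin (x - y))\<^sup>2 * h y) a 2"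
    and n: "0 < n" and ab: "b = a + 2 * real n \<or> a = b + 2 * real n"
  shows "(c * window h a (2 * real n) / (4 * real n)) powr p * window w b (2 * real n)
    \<le> C * window (\<lambda>x. h x powr p * w x) a (2 * real n)"
proof -
  let ?I = "indicator {a..<a + 2 * real n} :: real \<Rightarrow> real"
  let ?f = "\<lambda>x. complex_of_real (?I x * h x) * cis x"
  have fp: "norm (?f x) powr p * w x = ?I x * (h x powr p * w x)" for x
    using h(2)[of x] pq(1) by (auto simp: indicator_def norm_mult)
  \<comment> \<open>The sign of \<open>x - y\<close>, constant because the source and target
    intervals are adjacent.\<close>
  define s where "s = (if b = a + 2 * real n then 1 else - 1 :: real)"
  have "(c * window h a (2 * real n) / (4 * real n)) powr p * window w b (2 * real n) \<le> C * (LINT x|lborel. norm (?f x) powr p * w x)"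
  proof (rule test_function)
    show "?f \<in> borel_measurable borel"
    proof -
      have [measurable]: "cis \<in> borel_measurable borel"
        by (intro borel_measurable_continuous_onI continuous_intros)
      show ?thesis by measurable
    qed
    show "integrable lborel (\<lambda>x. norm (?f x) powr p * w x)" unfolding fp using hp by (rule locally_intD)
    show "0 \<le> c * window h a (2 * real n) / (4 * real n)" using h c by (simp add: window_nonneg)
    fix x assume x: "x \<in> {b..<b + 2 * real n}"
    have f_int: "integrable lborel ?f"
    proof (rule Bochner_Integration.integrable_bound[OF locally_intD[OF h(1), of a "a + 2 * real n"]])
      show "?f \<in> borel_measurable lborel"
        using \<open>?f \<in> borel_measurable borel\<close> by simp
    qed (auto simp: norm_mult)
    have int: "integrable lborel (\<lambda>y. complex_of_real (sinc (x - y)) * ?f y)"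
    proof (rule Bochner_Integration.integrable_bound[OF f_int])
      have "norm (complex_of_real (sinc (x - y)) * ?f y) \<le> 1 * norm (?f y)" for y
        unfolding norm_mult norm_of_real by (intro mult_right_mono abs_sinc_le_1) auto
      then show "AE y in lborel. norm (complex_of_real (sinc (x - y)) * ?f y) \<le> norm (?f y)" by simp
      have "(\<lambda>y. complex_of_real (sinc (x - y))) \<in> borel_measurable lborel" by measurable
      then show "(\<lambda>y. complex_of_real (sinc (x - y)) * ?f y) \<in> borel_measurable lborel"
        by (rule borel_measurable_times[OF _ borel_measurable_integrable[OF f_int]])
    qed
    let ?T = "LINT y|lborel. complex_of_real (sinc (x - y)) * ?f y"
    \<comment> \<open>The unimodular factor \<open>cis (- x)\<close> leaves the norm unchanged, and
      the imaginary part of \<open>cis (y - x)\<close> supplies the second sine.\<close>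
    have im: "Im (cis (- x) * (complex_of_real (sinc (x - y)) * ?f y)) = - (sinc (x - y) * sin (x - y)) * (?I y * h y)" for y
    proof -
      have "cis (- x) * (complex_of_real (sinc (x - y)) * ?f y) = complex_of_real (sinc (x - y) * (?I y * h y)) * cis (y - x)"
        by (simp only: of_real_mult mult_ac cis_mult) (simp add: add.commute mult_ac cis_mult)
      then show ?thesis using sin_minus[of "x - y"] by (simp del: of_real_mult sin_minus)
    qed
    have int': "integrable lborel (\<lambda>y. cis (- x) * (complex_of_real (sinc (x - y)) * ?f y))"
      using int by simp
    have "Im (cis (- x) * ?T) = (LINT y|lborel. Im (cis (- x) * (complex_of_real (sinc (x - y)) * ?f y)))"
      by (subst integral_Im[OF int']) (simp only: integral_mult_right_zero)
    then have imT: "Im (cis (- x) * ?T) = (LINT y|lborel. - (sinc (x - y) * sin (x - y)) * (?I y * h y))"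
      unfolding im .
    have int'': "integrable lborel (\<lambda>y. - (sinc (x - y) * sin (x - y)) * (?I y * h y))"
      using integrable_Im[OF int'] unfolding im .
    have "c * window h a (2 * real n) / (4 * real n) \<le> window (\<lambda>y. (sin (x - y))\<^sup>2 * h y) a (2 * real n) / (4 * real n)"
      using osc_global[OF h(1) _ c(2)] n by (intro divide_right_mono) auto
    also have "\<dots> = (LINT y|lborel. ?I y * ((sin (x - y))\<^sup>2 * h y) / (4 * real n))"
      unfolding window_def by simp
    also have "\<dots> \<le> (LINT y|lborel. - s * (- (sinc (x - y) * sin (x - y)) * (?I y * h y)))"
    proof (rule integral_mono)
      show "integrable lborel (\<lambda>y. ?I y * ((sin (x - y))\<^sup>2 * h y) / (4 * real n))"
        using sin_loc[OF h(1)] by (auto simp: locally_intD)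
      show "integrable lborel (\<lambda>y. - s * (- (sinc (x - y) * sin (x - y)) * (?I y * h y)))"
        using int'' by simp
      fix y
      show "?I y * ((sin (x - y))\<^sup>2 * h y) / (4 * real n) \<le> - s * (- (sinc (x - y) * sin (x - y)) * (?I y * h y))"
      proof (cases "y \<in> {a..<a + 2 * real n} \<and> x \<noteq> y")
        case True
        \<comment> \<open>Points of two adjacent intervals of length \<open>2 * real n\<close> are
          at most \<open>4 * real n\<close> apart.\<close>
        have sx: "0 < s * (x - y)" "s * (x - y) \<le> 4 * real n"
          using True x ab n unfolding s_def by (auto split: if_splits)
        have "s * sinc (x - y) * sin (x - y) = (sin (x - y))\<^sup>2 / (s * (x - y))"
          using True by (auto simp: power2_eq_square s_def divide_simps split: if_splits)
        moreover have "(sin (x - y))\<^sup>2 / (4 * real n) \<le> (sin (x - y))\<^sup>2 / (s * (x - y))"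
          using sx by (intro divide_left_mono) auto
        ultimately have "(sin (x - y))\<^sup>2 / (4 * real n) * h y \<le> s * sinc (x - y) * sin (x - y) * h y"
          using h(2)[of y] by (intro mult_right_mono) auto
        then show ?thesis using True by (simp add: mult_ac)
      qed auto
    qed
    also have "\<dots> = - s * Im (cis (- x) * ?T)" unfolding imT by (rule integral_mult_right_zero)
    also have "\<dots> \<le> \<bar>Im (cis (- x) * ?T)\<bar>" by (auto simp: s_def)
    also have "\<dots> \<le> norm (cis (- x) * ?T)" by (rule abs_Im_le_cmod)
    also have "\<dots> = norm ?T" by (simp add: norm_mult)
    finally show "c * window h a (2 * real n) / (4 * real n) \<le> norm ?T" .
  qed
  then show ?thesis unfolding fp window_def .
qed

definition global_const :: real where
  "global_const = 8 powr p * C * (C * (2 / osc_const) powr p) * 3 powr p"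

text \<open>Modulated tests compare adjacent intervals only. Testing with \<open>v\<close> on the
  given interval bounds the \<open>w\<close>-mass of its right neighbour; testing with the constant
  1 on that neighbour carries the bound back to the interval itself.\<close>

lemma even_length_bound:
  assumes n: "0 < n"
  shows "window w a (2 * real n) * window v a (2 * real n) powr (p - 1)
    \<le> 8 powr p * C * (C * (2 / osc_const) powr p) * (2 * real n) powr p"
proof -
  define L where "L = 2 * real n"
  have L: "0 < L" using n by (simp add: L_def)
  define b where "b = a + L"
  let ?V = "window v a L"
  have V: "0 < ?V" and Wb: "0 < window w b L" using v_loc v_pos w_loc w_pos L by (auto intro!: window_pos)
  have "(osc_const * ?V / (4 * real n)) powr p * window w b L \<le> C * window (\<lambda>x. v x powr p * w x) a L"
    unfolding L_def using v_loc v_pos n osc_const_pos osc_local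
    by (intro modulated_test) (auto simp: vp_w b_def L_def less_imp_le)
  then have "(osc_const * ?V / (2 * L)) powr p * window w b L \<le> C * ?V" unfolding vp_w L_def by simp
  moreover have "(osc_const * ?V / (2 * L)) powr p = ?V * ?V powr (p - 1) / ((2 / osc_const) powr p * L powr p)"
    using V L osc_const_pos by (simp add: powr_mult powr_divide powr_diff)
  ultimately have "?V * (?V powr (p - 1) * window w b L) / ((2 / osc_const) powr p * L powr p) \<le> ?V * C"
    by (simp add: mult_ac)
  then have "?V * (?V powr (p - 1) * window w b L) \<le> ?V * (C * ((2 / osc_const) powr p * L powr p))"
    using L osc_const_pos by (simp add: pos_divide_le_eq mult_ac)
  then have 1: "?V powr (p - 1) * window w b L \<le> C * ((2 / osc_const) powr p * L powr p)"
    using V by simp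
  \<comment> \<open>For the constant 1 the share kept by the squared sine is 1/4, namely 1/2 out of
    2. Divided by twice the interval length it becomes the 1/8 below.\<close>
  have half: "1 / 4 * window (\<lambda>x. 1) a 2 \<le> window (\<lambda>y. (sin (x - y))\<^sup>2 * 1) a 2" for x a
    using integral_sin_square[of x a] by (simp add: window_const)
  have "(1 / 4 * window (\<lambda>x. 1) b (2 * real n) / (4 * real n)) powr p * window w a (2 * real n)
    \<le> C * window (\<lambda>x. 1 powr p * w x) b (2 * real n)"
    using n half w_loc by (intro modulated_test) (auto simp: locally_int_const b_def L_def)
  then have "(1 / 8) powr p * window w a L \<le> C * window w b L"
    using n by (simp add: window_const L_def)
  then have 2: "window w a L \<le> 8 powr p * C * window w b L"
    by (simp add: powr_divide field_simps)
  have "window w a L * ?V powr (p - 1) \<le> 8 powr p * C * window w b L * ?V powr (p - 1)"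
    using 2 by (rule mult_right_mono) simp
  also have "\<dots> \<le> 8 powr p * C * (C * ((2 / osc_const) powr p * L powr p))"
    using mult_left_mono[OF 1, of "8 powr p * C"] C by (simp add: mult_ac)
  finally show ?thesis unfolding L_def by (simp add: mult_ac)
qed

text \<open>Rounding \<open>s \<ge> 1\<close> up to an even integer at most triples it, hence the
  \<open>3 powr p\<close> in \<open>global_const\<close>.\<close>

lemma large_scale_bound:
  assumes s: "1 \<le> s"
  shows "window w a s * window v a s powr (p - 1) \<le> global_const * s powr p"
proof -
  define n where "n = nat \<lceil>s / 2\<rceil>"
  have n: "0 < n" "s \<le> 2 * real n" "2 * real n \<le> 3 * s" using s unfolding n_def by linarith+
  have "window w a s * window v a s powr (p - 1) \<le> window w a (2 * real n) * window v a (2 * real n) powr (p - 1)"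
    using n w_loc w_pos v_loc v_pos pq(1)
    by (intro mult_mono powr_mono2 window_mono_length window_nonneg) (auto simp: less_imp_le intro!: window_nonneg)
  also have "\<dots> \<le> 8 powr p * C * (C * (2 / osc_const) powr p) * (2 * real n) powr p"
    by (rule even_length_bound[OF n(1)])
  also have "\<dots> \<le> 8 powr p * C * (C * (2 / osc_const) powr p) * (3 * s) powr p"
    using n C pq(1) s by (intro mult_left_mono powr_mono2) auto
  also have "\<dots> = global_const * s powr p" unfolding global_const_def using s by (simp add: powr_mult)
  finally show ?thesis .
qed

end

section \<open>Passage to Lebesgue measurable functions\<close>

lemma lebesgue_measurableI: "f \<in> borel_measurable borel \<Longrightarrow> f \<in> borel_measurable lebesgue"
  by (simp add: measurable_completion)

lemma complex_borel_version:
  fixes f :: "real \<Rightarrow> complex"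
  assumes f: "f \<in> borel_measurable lebesgue"
  obtains f' where "f' \<in> borel_measurable borel" "AE x in lborel. f x = f' x"
proof -
  have "(\<lambda>x. Re (f x)) \<in> borel_measurable lebesgue" "(\<lambda>x. Im (f x)) \<in> borel_measurable lebesgue"
    using f by (simp_all add: borel_measurable_complex_iff)
  then obtain r i where ri: "r \<in> borel_measurable lborel" "i \<in> borel_measurable lborel"
    "AE x in lborel. Re (f x) = r x" "AE x in lborel. Im (f x) = i x"
    using completion_ex_borel_measurable_real[of "\<lambda>x. Re (f x)" lborel]
      completion_ex_borel_measurable_real[of "\<lambda>x. Im (f x)" lborel] by auto
  show ?thesis
  proof
    show "(\<lambda>x. Complex (r x) (i x)) \<in> borel_measurable borel"
      using ri(1,2) by (simp add: borel_measurable_complex_iff)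
    show "AE x in lborel. f x = Complex (r x) (i x)"
      using ri(3,4) by eventually_elim (simp add: complex_eq_iff)
  qed
qed

lemma weight_measurable:
  assumes "weight w"
  shows "w \<in> borel_measurable lebesgue"
proof (rule borel_measurable_LIMSEQ_real)
  fix n :: nat
  have "set_integrable lebesgue {- real n..real n} w" using assms by (simp add: weight_def)
  then show "(\<lambda>x. indicator {- real n..real n} x * w x) \<in> borel_measurable lebesgue"
    unfolding set_integrable_def by auto
next
  fix x :: real
  obtain n0 where "\<bar>x\<bar> < real n0" using reals_Archimedean2 by blast
  then have "\<forall>\<^sub>F n in sequentially. indicator {- real n..real n} x * w x = w x"
    by (intro eventually_sequentiallyI[of n0]) (auto simp: indicator_def)
  then show "(\<lambda>n. indicator {- real n..real n} x * w x) \<longlonglongrightarrow> w x" by (rule tendsto_eventually)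
qed

lemma weight_borel_version:
  assumes "weight w"
  obtains w' where "w' \<in> borel_measurable borel" "\<And>x. 0 < w' x" "AE x in lborel. w x = w' x" "locally_int w'"
proof -
  obtain w0 where w0: "w0 \<in> borel_measurable lborel" "AE x in lborel. w x = w0 x"
    using completion_ex_borel_measurable_real[OF weight_measurable[OF assms]] by auto
  \<comment> \<open>The set where \<open>w0\<close> fails to be positive is null; the value 1 there
    makes the representative positive everywhere.\<close>
  define w' where "w' = (\<lambda>x. if 0 < w0 x then w0 x else 1)"
  have m: "w' \<in> borel_measurable borel" unfolding w'_def using w0(1) by measurable
  have pos: "AE x in lborel. 0 < w x" using assms by (simp add: weight_def AE_completion_iff)
  have ae: "AE x in lborel. w x = w' x"
    using w0(2) pos by eventually_elim (simp add: w'_def)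
  have "integrable lborel (\<lambda>x. indicator {a..<b} x * w' x)" for a b
  proof -
    have wi: "integrable lebesgue (\<lambda>x. indicator {a..b} x * w x)"
      using assms unfolding weight_def set_integrable_def by simp
    have "integrable lebesgue (\<lambda>x. indicator {a..b} x * w' x)"
    proof (rule integrable_cong_AE_imp[OF wi])
      show "(\<lambda>x. indicator {a..b} x * w' x) \<in> borel_measurable lebesgue"
        using m by (intro lebesgue_measurableI) measurable
      show "AE x in lebesgue. indicator {a..b} x * w x = indicator {a..b} x * w' x"
        unfolding AE_completion_iff using ae by eventually_elim simp
    qed
    then have "integrable lborel (\<lambda>x. indicator {a..b} x * w' x)"
      using m by (subst (asm) integrable_completion) auto
    then show ?thesis
      by (rule Bochner_Integration.integrable_bound) (use m in \<open>auto simp: indicator_def\<close>)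
  qed
  then have "locally_int w'" by (simp add: locally_int_def)
  moreover have "0 < w' x" for x by (simp add: w'_def)
  ultimately show ?thesis using that m ae by blast
qed

section \<open>Transfer between the given weight and its Borel representative\<close>

locale borel_weight = dual_weights p q w' v'
  for p q :: real and w w' v' :: "real \<Rightarrow> real" +
  assumes weight: "weight w" and w_ae: "AE x in lborel. w x = w' x"
begin

definition Ap_product :: "real set \<Rightarrow> ennreal" where
  "Ap_product I = interval_average I w * ennreal_powr (interval_average I (\<lambda>x. w x powr (- 1 / (p - 1)))) (p - 1)"

lemma exponent: "- 1 / (p - 1) = 1 - q"
  using conj_exp(5)[OF pq] by simp

lemma Lp_integral:
  fixes f f' :: "real \<Rightarrow> complex"
  assumes f: "f \<in> borel_measurable lebesgue" and [measurable]: "f' \<in> borel_measurable borel"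
    and ae: "AE x in lborel. f x = f' x"
  shows "f \<in> Lp_weighted p w \<longleftrightarrow> integrable lborel (\<lambda>x. norm (f' x) powr p * w' x)"
    and "(LINT x|lebesgue. norm (f x) powr p * w x) = (LINT x|lborel. norm (f' x) powr p * w' x)"
proof -
  have [measurable]: "f \<in> borel_measurable lebesgue" "w \<in> borel_measurable lebesgue"
    using f weight_measurable[OF weight] by auto
  have m: "(\<lambda>x. norm (f x) powr p * w x) \<in> borel_measurable lebesgue" by measurable
  have m': "(\<lambda>x. norm (f' x) powr p * w' x) \<in> borel_measurable lborel" by measurable
  have m'': "(\<lambda>x. norm (f' x) powr p * w' x) \<in> borel_measurable lebesgue"
    by (intro lebesgue_measurableI) measurable
  have eq: "AE x in lebesgue. norm (f x) powr p * w x = norm (f' x) powr p * w' x"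
    unfolding AE_completion_iff using ae w_ae by eventually_elim simp
  show "f \<in> Lp_weighted p w \<longleftrightarrow> integrable lborel (\<lambda>x. norm (f' x) powr p * w' x)"
    unfolding Lp_weighted_def using f integrable_cong_AE[OF m m'' eq] integrable_completion[OF m'] by simp
  show "(LINT x|lebesgue. norm (f x) powr p * w x) = (LINT x|lborel. norm (f' x) powr p * w' x)"
    using integral_cong_AE[OF m m'' eq] integral_completion[OF m'] by simp
qed

lemma segment_multiplier_borel:
  fixes f f' :: "real \<Rightarrow> complex"
  assumes f: "f \<in> borel_measurable lebesgue" and [measurable]: "f' \<in> borel_measurable borel"
    and ae: "AE x in lborel. f x = f' x"
  shows "integrable lebesgue (\<lambda>y. complex_of_real (sinc (x - y)) * f y)
      \<longleftrightarrow> integrable lborel (\<lambda>y. complex_of_real (sinc (x - y)) * f' y)"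
    and "segment_multiplier f x = (LINT y|lborel. complex_of_real (sinc (x - y)) * f' y)"
proof -
  have s: "(\<lambda>y. complex_of_real (sinc (x - y))) \<in> borel_measurable borel" by measurable
  have m: "(\<lambda>y. complex_of_real (sinc (x - y)) * f y) \<in> borel_measurable lebesgue"
    by (rule borel_measurable_times[OF lebesgue_measurableI[OF s] f])
  have m': "(\<lambda>y. complex_of_real (sinc (x - y)) * f' y) \<in> borel_measurable lborel" by measurable
  have m'': "(\<lambda>y. complex_of_real (sinc (x - y)) * f' y) \<in> borel_measurable lebesgue"
    by (intro lebesgue_measurableI) measurable
  have eq: "AE y in lebesgue. complex_of_real (sinc (x - y)) * f y = complex_of_real (sinc (x - y)) * f' y"
    unfolding AE_completion_iff using ae by eventually_elim simp
  show "integrable lebesgue (\<lambda>y. complex_of_real (sinc (x - y)) * f y)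
      \<longleftrightarrow> integrable lborel (\<lambda>y. complex_of_real (sinc (x - y)) * f' y)"
    using integrable_cong_AE[OF m m'' eq] integrable_completion[OF m'] by simp
  show "segment_multiplier f x = (LINT y|lborel. complex_of_real (sinc (x - y)) * f' y)"
    unfolding segment_multiplier_def using integral_cong_AE[OF m m'' eq] integral_completion[OF m'] by simp
qed

lemma interval_average_eq:
  "interval_average I w = ennreal (1 / measure lebesgue I) * (\<integral>\<^sup>+x. ennreal (w' x) * indicator I x \<partial>lborel)"
  "interval_average I (\<lambda>x. w x powr (- 1 / (p - 1)))
    = ennreal (1 / measure lebesgue I) * (\<integral>\<^sup>+x. ennreal (v' x) * indicator I x \<partial>lborel)"
proof -
  have "(\<integral>\<^sup>+x. ennreal (w x) * indicator I x \<partial>lborel) = (\<integral>\<^sup>+x. ennreal (w' x) * indicator I x \<partial>lborel)"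
    using w_ae by (intro nn_integral_cong_AE) (auto elim!: eventually_mono)
  then show "interval_average I w = ennreal (1 / measure lebesgue I) * (\<integral>\<^sup>+x. ennreal (w' x) * indicator I x \<partial>lborel)"
    unfolding interval_average_def nn_integral_completion by simp
  have "(\<integral>\<^sup>+x. ennreal (w x powr (- 1 / (p - 1))) * indicator I x \<partial>lborel) = (\<integral>\<^sup>+x. ennreal (v' x) * indicator I x \<partial>lborel)"
    unfolding exponent v_eq using w_ae by (intro nn_integral_cong_AE) (auto elim!: eventually_mono)
  then show "interval_average I (\<lambda>x. w x powr (- 1 / (p - 1)))
    = ennreal (1 / measure lebesgue I) * (\<integral>\<^sup>+x. ennreal (v' x) * indicator I x \<partial>lborel)"
    unfolding interval_average_def nn_integral_completion by simp
qed

lemma nn_integral_window_eq: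
  assumes "locally_int h" "\<And>x. 0 \<le> h x"
  shows "(\<integral>\<^sup>+x. ennreal (h x) * indicator {a..<a + s} x \<partial>lborel) = ennreal (window h a s)"
proof -
  have "(\<integral>\<^sup>+x. ennreal (h x) * indicator {a..<a + s} x \<partial>lborel) = (\<integral>\<^sup>+x. ennreal (indicator {a..<a + s} x * h x) \<partial>lborel)"
    by (intro nn_integral_cong) (auto simp: indicator_def)
  also have "\<dots> = ennreal (window h a s)"
    unfolding window_def using assms by (intro nn_integral_eq_integral locally_intD) auto
  finally show ?thesis .
qed

text \<open>The finite supremum also yields local integrability of the dual weight: an infinite
  integral of \<open>v'\<close> over one interval would make the product infinite there, since the
  average of \<open>w'\<close> is positive and \<open>ennreal_powr\<close> preserves
  infinity.\<close>

lemma A_p1_imp_large_scale: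
  assumes "w \<in> A_p1 p"
  obtains A where "large_scale_Ap p q A w' v'"
proof -
  define S where "S = (SUP I \<in> {I. is_interval I \<and> bounded I \<and> measure lebesgue I \<ge> 1}.
        Ap_product I)"
  have S: "S < \<infinity>" using assms unfolding A_p1_def S_def Ap_product_def by simp
  define K where "K = enn2real S"
  have SK: "S = ennreal K" and K0: "0 \<le> K" using S by (auto simp: K_def)
  have le: "ennreal (1 / s) * ennreal (window w' a s)
      * ennreal_powr (ennreal (1 / s) * (\<integral>\<^sup>+x. ennreal (v' x) * indicator {a..<a + s} x \<partial>lborel)) (p - 1) \<le> ennreal K"
    if s: "1 \<le> s" for a s
  proof -
    have "measure lebesgue {a..<a + s} = s" using s by simp
    moreover from this have "Ap_product {a..<a + s} \<le> S"
      unfolding S_def using s by (intro SUP_upper) (auto simp: is_interval_co)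
    ultimately show ?thesis
      unfolding Ap_product_def interval_average_eq SK using w_loc w_pos by (simp add: nn_integral_window_eq less_imp_le)
  qed
  have v_int: "integrable lborel (\<lambda>x. indicator {a..<a + s} x * v' x)" if s: "1 \<le> s" for a s
  proof (rule integrableI_bounded)
    have W: "0 < window w' a s" using w_loc w_pos s by (intro window_pos) auto
    have "(\<integral>\<^sup>+x. ennreal (v' x) * indicator {a..<a + s} x \<partial>lborel) < \<infinity>"
    proof (rule ccontr)
      assume "\<not> ?thesis"
      then have "(\<integral>\<^sup>+x. ennreal (v' x) * indicator {a..<a + s} x \<partial>lborel) = \<infinity>" by (simp add: less_top[symmetric])
      then have "ennreal (1 / s) * (\<integral>\<^sup>+x. ennreal (v' x) * indicator {a..<a + s} x \<partial>lborel) = \<infinity>"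
        using s by (simp add: ennreal_mult_top)
      moreover have "ennreal (1 / s) * ennreal (window w' a s) \<noteq> 0" using s W by simp
      ultimately show False using le[OF s, of a] by (auto simp: ennreal_powr_def ennreal_mult_eq_top_iff top_unique)
    qed
    also have "(\<integral>\<^sup>+x. ennreal (v' x) * indicator {a..<a + s} x \<partial>lborel)
        = (\<integral>\<^sup>+x. ennreal (norm (indicator {a..<a + s} x * v' x)) \<partial>lborel)"
      using v_pos by (intro nn_integral_cong) (auto simp: indicator_def less_imp_le abs_of_pos)
    finally show "(\<integral>\<^sup>+x. ennreal (norm (indicator {a..<a + s} x * v' x)) \<partial>lborel) < \<infinity>" .
  qed measurable
  have v_loc: "locally_int v'"
    unfolding locally_int_def
  proof (intro allI)
    fix a b :: real
    have "integrable lborel (\<lambda>x. indicator {a..<a + max 1 (b - a)} x * v' x)" by (rule v_int) simp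
    then show "integrable lborel (\<lambda>x. indicator {a..<b} x * v' x)"
      by (rule Bochner_Integration.integrable_bound) (auto simp: indicator_def)
  qed
  have "large_scale_Ap p q K w' v'"
  proof
    fix a s :: real assume s: "1 \<le> s"
    let ?W = "window w' a s" and ?V = "window v' a s"
    have nn: "0 \<le> ?W" "0 \<le> ?V" using w_pos v_pos by (auto intro!: window_nonneg simp: less_imp_le)
    have av: "ennreal (1 / s) * (\<integral>\<^sup>+x. ennreal (v' x) * indicator {a..<a + s} x \<partial>lborel) = ennreal (?V / s)"
      using v_loc v_pos s nn by (simp add: nn_integral_window_eq less_imp_le ennreal_mult[symmetric])
    have "ennreal (?W / s * (?V / s) powr (p - 1)) \<le> ennreal K"
      using le[OF s, of a] nn s unfolding av by (simp add: ennreal_powr_def ennreal_mult[symmetric])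
    then have "?W / s * (?V / s) powr (p - 1) \<le> K" using K0 by (simp add: ennreal_le_iff)
    also have "?W / s * (?V / s) powr (p - 1) = ?W * ?V powr (p - 1) / s powr p"
      using nn s by (simp add: powr_divide powr_diff)
    finally show "?W * ?V powr (p - 1) \<le> K * s powr p" using s by (simp add: pos_divide_le_eq)
  qed (use pq w_pos v_eq w_loc v_loc in auto)
  then show ?thesis by (rule that)
qed

lemma large_scale_imp_A_p1:
  assumes v_loc: "locally_int v'" and A: "\<And>a s. 1 \<le> s \<Longrightarrow> window w' a s * window v' a s powr (p - 1) \<le> A * s powr p"
  shows "w \<in> A_p1 p"
proof -
  have "Ap_product I \<le> ennreal (A * 2 powr p)"
    if I: "is_interval I" "bounded I" "1 \<le> measure lebesgue I" for I
  proof -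
    define s where "s = measure lebesgue I"
    have s: "1 \<le> s" using I by (simp add: s_def)
    have ne: "I \<noteq> {}" using I(3) by auto
    have Im: "I \<in> sets lebesgue" using I(3) measure_notin_sets[of I lebesgue] by force
    have bd: "bdd_above I" "bdd_below I" using I(2) by (auto simp: bounded_imp_bdd_above bounded_imp_bdd_below)
    define a where "a = Inf I"
    have sub: "{Inf I<..<Sup I} \<subseteq> I"
    proof
      fix x assume x: "x \<in> {Inf I<..<Sup I}"
      obtain y where "y \<in> I" "y < x" using x cInf_lessD[OF ne, of x] by auto
      moreover obtain z where "z \<in> I" "x < z" using x less_cSupE[of x I] ne by auto
      ultimately show "x \<in> I" using mem_is_interval_1_I[OF I(1), of y z x] by auto
    qed
    have "Inf I \<le> Sup I" by (rule cInf_le_cSup[OF ne bd])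
    then have "Sup I - Inf I = measure lebesgue {Inf I<..<Sup I}" by simp
    also have "\<dots> \<le> s"
      unfolding s_def using sub bounded_set_imp_lmeasurable[OF I(2) Im] by (intro measure_mono_fmeasurable) auto
    finally have "Sup I \<le> a + s" by (simp add: a_def)
    moreover have "a \<le> x" "x \<le> Sup I" if "x \<in> I" for x
      using that bd by (auto simp: a_def cInf_lower cSup_upper)
    \<comment> \<open>A half-open window of length \<open>s\<close> would miss a right endpoint
      belonging to \<open>I\<close>. Doubling the length leaves room and costs the factor
      \<open>2 powr p\<close>.\<close>
    ultimately have I_sub: "I \<subseteq> {a..<a + 2 * s}" using s by force
    let ?W = "window w' a (2 * s)" and ?V = "window v' a (2 * s)"
    have nn: "0 \<le> ?W" "0 \<le> ?V" using w_pos v_pos by (auto intro!: window_nonneg simp: less_imp_le)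
    have mono: "(\<integral>\<^sup>+x. ennreal (h x) * indicator I x \<partial>lborel) \<le> ennreal (window h a (2 * s))"
      if "locally_int h" "\<And>x. 0 < h x" for h
    proof -
      have "(\<integral>\<^sup>+x. ennreal (h x) * indicator I x \<partial>lborel) \<le> (\<integral>\<^sup>+x. ennreal (h x) * indicator {a..<a + 2 * s} x \<partial>lborel)"
        using I_sub by (intro nn_integral_mono mult_left_mono) (auto simp: indicator_def)
      then show ?thesis using that by (simp add: nn_integral_window_eq less_imp_le)
    qed
    have "interval_average I w \<le> ennreal (1 / s) * ennreal ?W"
      unfolding interval_average_eq s_def[symmetric] using mono[OF w_loc w_pos] by (rule mult_left_mono) simp
    then have w_le: "interval_average I w \<le> ennreal (?W / s)"
      using s nn by (simp add: ennreal_mult[symmetric])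
    have "interval_average I (\<lambda>x. w x powr (- 1 / (p - 1))) \<le> ennreal (1 / s) * ennreal ?V"
      unfolding interval_average_eq s_def[symmetric] using mono[OF v_loc v_pos] by (rule mult_left_mono) simp
    then have v_le: "interval_average I (\<lambda>x. w x powr (- 1 / (p - 1))) \<le> ennreal (?V / s)"
      using s nn by (simp add: ennreal_mult[symmetric])
    have "ennreal_powr (interval_average I (\<lambda>x. w x powr (- 1 / (p - 1)))) (p - 1) \<le> ennreal ((?V / s) powr (p - 1))"
    proof -
      let ?i = "interval_average I (\<lambda>x. w x powr (- 1 / (p - 1)))"
      have "?i \<noteq> \<infinity>" using v_le by (auto simp: top_unique)
      moreover have "enn2real ?i \<le> ?V / s"
        using v_le nn s by (intro enn2real_leI) auto
      ultimately show ?thesis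
        unfolding ennreal_powr_def using pq(1) by (auto intro!: ennreal_leI powr_mono2)
    qed
    then have "interval_average I w * ennreal_powr (interval_average I (\<lambda>x. w x powr (- 1 / (p - 1)))) (p - 1)
      \<le> ennreal (?W / s) * ennreal ((?V / s) powr (p - 1))"
      using w_le by (intro mult_mono) auto
    also have "\<dots> = ennreal (?W * ?V powr (p - 1) / s powr p)"
      using nn s by (simp add: ennreal_mult[symmetric] powr_divide powr_diff)
    also have "\<dots> \<le> ennreal (A * 2 powr p)"
    proof (rule ennreal_leI)
      have "?W * ?V powr (p - 1) \<le> A * (2 * s) powr p" using s by (intro A) simp
      then show "?W * ?V powr (p - 1) / s powr p \<le> A * 2 powr p"
        using s by (simp add: powr_mult pos_divide_le_eq mult_ac)
    qed
    finally show ?thesis unfolding Ap_product_def .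
  qed
  then have "(SUP I \<in> {I. is_interval I \<and> bounded I \<and> measure lebesgue I \<ge> 1}.
        Ap_product I) \<le> ennreal (A * 2 powr p)"
    by (intro SUP_least) auto
  also have "\<dots> < \<infinity>" by simp
  finally show ?thesis unfolding A_p1_def Ap_product_def using weight by simp
qed

lemma bounded_imp_A_p1:
  assumes "segment_multiplier_bounded p w"
  shows "w \<in> A_p1 p"
proof -
  obtain C0 where C0: "\<And>f. f \<in> Lp_weighted p w \<Longrightarrow>
      segment_multiplier f \<in> Lp_weighted p w \<and> Lp_norm p w (segment_multiplier f) \<le> C0 * Lp_norm p w f"
    using assms unfolding segment_multiplier_bounded_def by blast
  \<comment> \<open>The sign of \<open>C0\<close> is not known, so its absolute value is used; the
    power \<open>p\<close> passes from norms to integrals.\<close>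
  interpret B: bounded_multiplier p q "\<bar>C0\<bar> powr p" w' v'
  proof
    fix f :: "real \<Rightarrow> complex"
    assume f [measurable]: "f \<in> borel_measurable borel" and fp: "integrable lborel (\<lambda>x. norm (f x) powr p * w' x)"
    let ?S = "\<lambda>x. LINT y|lborel. complex_of_real (sinc (x - y)) * f y"
    have fl: "f \<in> borel_measurable lebesgue" by (rule lebesgue_measurableI[OF f])
    have ae: "AE x in lborel. f x = f x" by simp
    have S_eq: "segment_multiplier f = ?S"
      using segment_multiplier_borel(2)[OF fl f ae] by (intro ext)
    have S_meas: "?S \<in> borel_measurable borel" by measurable
    have S_meas': "?S \<in> borel_measurable lebesgue" by (rule lebesgue_measurableI[OF S_meas])
    have aeS: "AE x in lborel. ?S x = ?S x" by simp
    have "f \<in> Lp_weighted p w" using fp Lp_integral(1)[OF fl f ae] by simp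
    from C0[OF this] have S: "?S \<in> Lp_weighted p w" "Lp_norm p w ?S \<le> C0 * Lp_norm p w f"
      unfolding S_eq by auto
    define X where "X = (LINT x|lborel. norm (?S x) powr p * w' x)"
    define N where "N = (LINT x|lborel. norm (f x) powr p * w' x)"
    have Sint: "integrable lborel (\<lambda>x. norm (?S x) powr p * w' x)"
      using S(1) Lp_integral(1)[OF S_meas' S_meas aeS] by simp
    have X0: "0 \<le> X" and N0: "0 \<le> N" unfolding X_def N_def
      using w_pos by (auto intro!: integral_nonneg_AE simp: less_imp_le)
    have "X powr (1 / p) \<le> C0 * N powr (1 / p)"
      using S(2) unfolding Lp_norm_def Lp_integral(2)[OF S_meas' S_meas aeS] Lp_integral(2)[OF fl f ae] X_def N_def .
    also have "\<dots> \<le> \<bar>C0\<bar> * N powr (1 / p)" by (intro mult_right_mono) auto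
    finally have "(X powr (1 / p)) powr p \<le> (\<bar>C0\<bar> * N powr (1 / p)) powr p"
      using pq(1) by (intro powr_mono2) auto
    then have "X \<le> \<bar>C0\<bar> powr p * N" using X0 N0 pq(1) by (simp add: powr_powr powr_mult)
    moreover have "(\<integral>\<^sup>+x. ennreal (norm (?S x) powr p * w' x) \<partial>lborel) = ennreal X"
      unfolding X_def using Sint w_pos by (intro nn_integral_eq_integral) (auto simp: less_imp_le)
    ultimately show "(\<integral>\<^sup>+x. ennreal (norm (?S x) powr p * w' x) \<partial>lborel)
        \<le> ennreal (\<bar>C0\<bar> powr p * (LINT x|lborel. norm (f x) powr p * w' x))"
      unfolding N_def by (simp add: ennreal_leI)
  qed (use pq w_pos w_loc v_eq in auto)
  show ?thesis by (rule large_scale_imp_A_p1[OF B.v_loc B.large_scale_bound])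
qed

lemma A_p1_imp_bounded:
  assumes "w \<in> A_p1 p"
  shows "segment_multiplier_bounded p w"
proof -
  obtain A where "large_scale_Ap p q A w' v'" using A_p1_imp_large_scale[OF assms] .
  then interpret L: large_scale_Ap p q A w' v' .
  \<comment> \<open>The norm of a complex value is at most twice the larger of its two parts, hence
    \<open>2 powr p\<close>. The other 2 adds the strong bounds for the real and the imaginary
    part.\<close>
  define K where "K = 2 powr p * (2 * L.strong_const)"
  have K0: "0 \<le> K" unfolding K_def using L.strong_const_nonneg by simp
  have main: "(\<forall>x. integrable lebesgue (\<lambda>y. complex_of_real (sinc (x - y)) * f y)) \<and>
      segment_multiplier f \<in> Lp_weighted p w \<and>
      Lp_norm p w (segment_multiplier f) \<le> K powr (1 / p) * Lp_norm p w f"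
    if f: "f \<in> Lp_weighted p w" for f
  proof -
    have fl: "f \<in> borel_measurable lebesgue" using f by (simp add: Lp_weighted_def)
    obtain f' where f' [measurable]: "f' \<in> borel_measurable borel" and ae: "AE x in lborel. f x = f' x"
      using complex_borel_version[OF fl] .
    have fp: "integrable lborel (\<lambda>x. norm (f' x) powr p * w' x)" using f Lp_integral(1)[OF fl f' ae] by simp
    define N where "N = (LINT x|lborel. norm (f' x) powr p * w' x)"
    have N0: "0 \<le> N" unfolding N_def using w_pos by (auto intro!: integral_nonneg_AE simp: less_imp_le)
    have part: "integrable lborel (\<lambda>x. \<bar>r x\<bar> powr p * w' x)" "(LINT x|lborel. \<bar>r x\<bar> powr p * w' x) \<le> N"
      if [measurable]: "r \<in> borel_measurable borel" and r: "\<And>x. \<bar>r x\<bar> \<le> norm (f' x)" for r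
    proof -
      have le: "\<bar>r x\<bar> powr p * w' x \<le> norm (f' x) powr p * w' x" for x
        using r[of x] w_pos[of x] pq(1) by (intro mult_right_mono powr_mono2) auto
      show 1: "integrable lborel (\<lambda>x. \<bar>r x\<bar> powr p * w' x)"
        using le w_pos by (intro Bochner_Integration.integrable_bound[OF fp]) (auto simp: abs_mult abs_of_pos less_imp_le)
      show "(LINT x|lborel. \<bar>r x\<bar> powr p * w' x) \<le> N"
        unfolding N_def using 1 fp le by (rule integral_mono)
    qed
    let ?r = "\<lambda>x. Re (f' x)" and ?i = "\<lambda>x. Im (f' x)"
    have rm: "?r \<in> borel_measurable borel" "?i \<in> borel_measurable borel" by measurable
    note pr = part[OF rm(1) abs_Re_le_cmod] and pi = part[OF rm(2) abs_Im_le_cmod]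
    note br = L.sinc_conv_bounded[OF rm(1) pr(1)] and bi = L.sinc_conv_bounded[OF rm(2) pi(1)]
    have int: "integrable lborel (\<lambda>y. complex_of_real (sinc (x - y)) * f' y)"
      and S_eq: "(LINT y|lborel. complex_of_real (sinc (x - y)) * f' y) = Complex (sinc_conv ?r x) (sinc_conv ?i x)" for x
    proof -
      have eq: "complex_of_real (sinc (x - y)) * f' y
          = complex_of_real (?r y * sinc (x - y)) + \<i> * complex_of_real (?i y * sinc (x - y))" for y
        by (simp only: complex_eq_iff) simp
      show "integrable lborel (\<lambda>y. complex_of_real (sinc (x - y)) * f' y)"
        unfolding eq by (intro Bochner_Integration.integrable_add integrable_mult_right integrable_of_real br(1) bi(1))
      have "(LINT y|lborel. complex_of_real (sinc (x - y)) * f' y)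
        = (LINT y|lborel. complex_of_real (?r y * sinc (x - y))) + \<i> * (LINT y|lborel. complex_of_real (?i y * sinc (x - y)))"
        unfolding eq integral_mult_right_zero[symmetric]
        by (intro Bochner_Integration.integral_add integrable_mult_right integrable_of_real br(1) bi(1))
      then show "(LINT y|lborel. complex_of_real (sinc (x - y)) * f' y) = Complex (sinc_conv ?r x) (sinc_conv ?i x)"
        unfolding integral_complex_of_real sinc_conv_def[symmetric] by (simp add: complex_eq_iff)
    qed
    let ?S = "\<lambda>x. Complex (sinc_conv ?r x) (sinc_conv ?i x)"
    have S: "segment_multiplier f = ?S"
      using segment_multiplier_borel(2)[OF fl f' ae] S_eq by (intro ext) simp
    have S_meas: "?S \<in> borel_measurable borel" using rm by (simp add: borel_measurable_complex_iff sinc_conv_measurable)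
    have S_meas': "?S \<in> borel_measurable lebesgue" by (rule lebesgue_measurableI[OF S_meas])
    have aeS: "AE x in lborel. ?S x = ?S x" by simp
    have pw: "norm (?S x) powr p * w' x \<le> 2 powr p * (\<bar>sinc_conv ?r x\<bar> powr p * w' x + \<bar>sinc_conv ?i x\<bar> powr p * w' x)" for x
    proof -
      let ?a = "\<bar>sinc_conv ?r x\<bar>" and ?b = "\<bar>sinc_conv ?i x\<bar>"
      have "norm (?S x) \<le> 2 * max ?a ?b" using cmod_le[of "?S x"] by simp
      then have "norm (?S x) powr p \<le> (2 * max ?a ?b) powr p" using pq(1) by (intro powr_mono2) auto
      also have "\<dots> = 2 powr p * max ?a ?b powr p" by (simp add: powr_mult)
      also have "\<dots> \<le> 2 powr p * (?a powr p + ?b powr p)" by (intro mult_left_mono) (auto simp: max_def)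
      finally have "norm (?S x) powr p * w' x \<le> 2 powr p * (?a powr p + ?b powr p) * w' x"
        using w_pos[of x] by (intro mult_right_mono) auto
      then show ?thesis by (simp add: algebra_simps)
    qed
    have [measurable]: "sinc_conv ?r \<in> borel_measurable borel" "sinc_conv ?i \<in> borel_measurable borel"
      using rm by (auto intro: sinc_conv_measurable)
    have "(\<integral>\<^sup>+x. ennreal (norm (?S x) powr p * w' x) \<partial>lborel)
      \<le> (\<integral>\<^sup>+x. ennreal (2 powr p) * (ennreal (\<bar>sinc_conv ?r x\<bar> powr p * w' x) + ennreal (\<bar>sinc_conv ?i x\<bar> powr p * w' x)) \<partial>lborel)"
    proof (intro nn_integral_mono)
      fix x
      have "ennreal (norm (?S x) powr p * w' x) \<le> ennreal (2 powr p * (\<bar>sinc_conv ?r x\<bar> powr p * w' x + \<bar>sinc_conv ?i x\<bar> powr p * w' x))"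
        by (rule ennreal_leI[OF pw])
      also have "\<dots> = ennreal (2 powr p) * (ennreal (\<bar>sinc_conv ?r x\<bar> powr p * w' x) + ennreal (\<bar>sinc_conv ?i x\<bar> powr p * w' x))"
        using w_pos[of x] by (simp add: ennreal_mult ennreal_plus less_imp_le)
      finally show "ennreal (norm (?S x) powr p * w' x) \<le> \<dots>" .
    qed
    also have "\<dots> = ennreal (2 powr p) * ((\<integral>\<^sup>+x. ennreal (\<bar>sinc_conv ?r x\<bar> powr p * w' x) \<partial>lborel) + (\<integral>\<^sup>+x. ennreal (\<bar>sinc_conv ?i x\<bar> powr p * w' x) \<partial>lborel))"
      by (subst nn_integral_cmult, measurable) (subst nn_integral_add, auto)
    also have "\<dots> \<le> ennreal (2 powr p) * (ennreal (L.strong_const * N) + ennreal (L.strong_const * N))"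
      using br(2) bi(2) pr(2) pi(2) L.strong_const_nonneg
      by (intro mult_left_mono add_mono) (auto intro!: order_trans[OF br(2)] order_trans[OF bi(2)] ennreal_leI mult_left_mono)
    also have "\<dots> = ennreal (K * N)"
      unfolding K_def using L.strong_const_nonneg N0
      by (subst ennreal_plus[symmetric]) (auto simp: ennreal_mult[symmetric] mult_ac)
    finally have bound: "(\<integral>\<^sup>+x. ennreal (norm (?S x) powr p * w' x) \<partial>lborel) \<le> ennreal (K * N)" .
    have Sm: "(\<lambda>x. norm (?S x) powr p * w' x) \<in> borel_measurable lborel" using S_meas by measurable
    have Sint: "integrable lborel (\<lambda>x. norm (?S x) powr p * w' x)"
    proof (rule integrableI_bounded[OF Sm])
      have "(\<integral>\<^sup>+x. ennreal (norm (norm (?S x) powr p * w' x)) \<partial>lborel) \<le> ennreal (K * N)"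
        using bound w_pos by (simp add: abs_mult abs_of_pos)
      also have "\<dots> < \<infinity>" by simp
      finally show "(\<integral>\<^sup>+x. ennreal (norm (norm (?S x) powr p * w' x)) \<partial>lborel) < \<infinity>" .
    qed
    define X where "X = (LINT x|lborel. norm (?S x) powr p * w' x)"
    have X0: "0 \<le> X" unfolding X_def using w_pos by (auto intro!: integral_nonneg_AE simp: less_imp_le)
    have "ennreal X = (\<integral>\<^sup>+x. ennreal (norm (?S x) powr p * w' x) \<partial>lborel)"
      unfolding X_def using Sint w_pos by (intro nn_integral_eq_integral[symmetric]) (auto simp: less_imp_le)
    then have "ennreal X \<le> ennreal (K * N)" using bound by (simp only:)
    then have XN: "X \<le> K * N" by (subst (asm) ennreal_le_iff) (simp_all add: K0 N0)
    have "X powr (1 / p) \<le> (K * N) powr (1 / p)" using X0 XN pq(1) by (intro powr_mono2) auto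
    also have "\<dots> = K powr (1 / p) * N powr (1 / p)" using K0 N0 by (simp add: powr_mult)
    finally have "Lp_norm p w ?S \<le> K powr (1 / p) * Lp_norm p w f"
      unfolding Lp_norm_def Lp_integral(2)[OF S_meas' S_meas aeS] Lp_integral(2)[OF fl f' ae] X_def N_def .
    moreover have "?S \<in> Lp_weighted p w" using Sint Lp_integral(1)[OF S_meas' S_meas aeS] by simp
    ultimately show ?thesis unfolding S using int segment_multiplier_borel(1)[OF fl f' ae] by simp
  qed
  show ?thesis
    unfolding segment_multiplier_bounded_def
    using main by (intro conjI ballI AE_I2 exI[of _ "K powr (1 / p)"]) blast+
qed

end

theorem theorem4p3:
  fixes p :: real and w :: "real \<Rightarrow> real"
  assumes "1 < p" and "weight w"
  shows "segment_multiplier_bounded p w \<longleftrightarrow> w \<in> A_p1 p"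
proof -
  obtain w' where w': "w' \<in> borel_measurable borel" "\<And>x. 0 < w' x" "AE x in lborel. w x = w' x" "locally_int w'"
    using weight_borel_version[OF assms(2)] by metis
  define q where "q = p / (p - 1)"
  have "1 / p + 1 / q = 1" using assms(1) by (simp add: q_def field_simps)
  then interpret borel_weight p q w w' "\<lambda>x. w' x powr (1 - q)"
    using assms w' by unfold_locales auto
  show ?thesis using bounded_imp_A_p1 A_p1_imp_bounded by blast
qed

end
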